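(* Let $d\ge 2$, let $A$ be a real $d\times d$ matrix whose eigenvalues, counted with algebraic multiplicity, have real parts $\Lambda_1\le\dots\le\Lambda_d<0$, and let $p\in\mathbb{R}^d\setminus\{0\}$ be such that $p,Ap,\dots,A^{d-1}p$ are linearly independent. Let $\alpha_{01},\alpha_{10}>0$, let $(X_t,I_t)_{t\ge0}$ be the associated switching process on $\mathbb{R}^d\times\{0,1\}$, let $\Pi$ be its unique invariant probability measure (which is absolutely continuous with respect to $\mathbf{m}=dx\otimes(\delta_0+\delta_1)$), and let $\Gamma$ be the accessible set. Let $r\ge 0$ be an integer and assume that $$\min(\alpha_{01},\alpha_{10})>-\Big[\sum_{i=1}^d\Lambda_i+r\Lambda_1\Big].$$ Then the density $\rho=(\rho_0,\rho_1)$ of $\Pi$ with respect to $\mathbf{m}$ is $C^r$ on $\mathbb{R}^d\times\{0,1\}$ (that is, $\Pi$ has a density such that $\rho_0$ and $\rho_1$ are of class $C^r$ on $\mathbb{R}^d$), and, for this density, $\{x\in\mathbb{R}^d:\rho_i(x)>0\}=\mathrm{Int}(\Gamma)$ for $i=0,1$.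
   Context: Switching process: set $F_0(x)=Ax$ and $F_1(x)=A(x-p)$ for $x\in\mathbb{R}^d$. $(I_t)_{t\ge0}$ is a continuous-time Markov chain on $\{0,1\}$ with transition rate $\alpha_{01}$ from $0$ to $1$ and $\alpha_{10}$ from $1$ to $0$ (its evolution does not depend on $X$), and $X_t$ solves $\frac{dX_t}{dt}=F_{I_t}(X_t)$. Let $P_tf(x,i)=\mathsf{E}(f(X_t,I_t)\mid X_0=x,I_0=i)$ for bounded measurable $f$. A probability measure $\Pi$ on $\mathbb{R}^d\times\{0,1\}$ is invariant if $\Pi P_t=\Pi$ for all $t\ge0$. Densities: $\mathbf{m}=dx\otimes(\delta_0+\delta_1)$ with $dx$ the Lebesgue measure on $\mathbb{R}^d$. If a measure $\mu$ on $\mathbb{R}^d\times\{0,1\}$ is absolutely continuous with respect to $\mathbf{m}$, its density is $\rho(x,i)=\rho_i(x)$ with $\rho_i=\frac{d\mu_i}{dx}$, $\mu_i(\cdot)=\mu(\cdot\times\{i\})$; $\rho$ is called $C^r$ if $\rho_0$ and $\rho_1$ are ($C^0$ meaning continuous). Accessible set: for $x\in\mathbb{R}^d$ and $j:[0,\infty)\to\{0,1\}$ piecewise continuous, let $t\mapsto y(t,x,j)$ be the solution of $\frac{dy}{dt}=F_{j(t)}(y)$, $y(0)=x$. Let $\gamma^+(x)$ be the set of all $y(t,x,j)$ with $t\ge0$ and $j$ piecewise continuous. Then $\Gamma=\bigcap_{x\in\mathbb{R}^d}\overline{\gamma^+(x)}$. *)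

theory Defs
  imports "HOL-Probability.Probability" "HOL-Computational_Algebra.Computational_Algebra"
begin

text \<open>
  The index set \<open>{0,1}\<close> is the type \<^typ>\<open>bool\<close>, with \<^term>\<open>False\<close> for \<open>0\<close> and
  \<^term>\<open>True\<close> for \<open>1\<close>.
\<close>

definition vfield :: "real^'d^'d \<Rightarrow> real^'d \<Rightarrow> bool \<Rightarrow> real^'d \<Rightarrow> real^'d" where
  "vfield A p i x = (if i then A *v (x - p) else A *v x)"

text \<open>
  One-sided limits at the discontinuities exist automatically, because \<^typ>\<open>bool\<close> is discrete:
  \<open>j\<close> is constant between consecutive discontinuities.
\<close>

definition piecewise_cont :: "(real \<Rightarrow> bool) \<Rightarrow> bool" where
  "piecewise_cont j \<longleftrightarrow> (\<forall>T\<ge>0. finite {t \<in> {0..T}. \<not> continuous (at t within {0..}) j})"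

text \<open>
  \<open>solves A p j x y\<close>: on \<open>[0,\<infinity>)\<close> the curve \<open>y\<close> solves \<open>y' = F\<^bsub>j(t)\<^esub>(y)\<close>, \<open>y(0) = x\<close>. As usual
  for piecewise continuous \<open>j\<close>, \<open>y\<close> is continuous and the equation is required away from the
  discontinuities of \<open>j\<close>.
\<close>

definition solves ::
  "real^'d^'d \<Rightarrow> real^'d \<Rightarrow> (real \<Rightarrow> bool) \<Rightarrow> real^'d \<Rightarrow> (real \<Rightarrow> real^'d) \<Rightarrow> bool" where
  "solves A p j x y \<longleftrightarrow>
     y 0 = x \<and> continuous_on {0..} y \<and>
     (\<forall>t\<ge>0. continuous (at t within {0..}) j \<longrightarrow>
        (y has_vector_derivative vfield A p (j t) (y t)) (at t within {0..}))"

definition reachable :: "real^'d^'d \<Rightarrow> real^'d \<Rightarrow> real^'d \<Rightarrow> (real^'d) set" where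
  "reachable A p x = {y t | t j y. 0 \<le> t \<and> piecewise_cont j \<and> solves A p j x y}"

definition accessible_set :: "real^'d^'d \<Rightarrow> real^'d \<Rightarrow> (real^'d) set" where
  "accessible_set A p = (\<Inter>x. closure (reachable A p x))"

text \<open>
  A continuous-time Markov chain on \<open>{0,1}\<close> started at \<open>i\<close>, given by its jump chain and holding
  times: the states visited are \<open>i, \<not>i, i, \<dots>\<close>, and the successive holding times \<open>S 0, S 1, \<dots>\<close> are
  independent, exponential with the rate of leaving the current state. The path is only
  constrained up to the supremum of the jump times, which is almost surely infinite.
\<close>

definition leave_rate :: "real \<Rightarrow> real \<Rightarrow> bool \<Rightarrow> real" where
  "leave_rate \<alpha>01 \<alpha>10 i = (if i then \<alpha>10 else \<alpha>01)"

definition markov_chain ::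
  "real \<Rightarrow> real \<Rightarrow> 'w measure \<Rightarrow> bool \<Rightarrow> (real \<Rightarrow> 'w \<Rightarrow> bool) \<Rightarrow> bool" where
  "markov_chain \<alpha>01 \<alpha>10 M i I \<longleftrightarrow>
     (\<forall>t\<ge>0. I t \<in> M \<rightarrow>\<^sub>M count_space UNIV) \<and>
     (\<exists>S :: nat \<Rightarrow> 'w \<Rightarrow> real.
        prob_space.indep_vars M (\<lambda>_. borel) S UNIV \<and>
        (\<forall>n. distributed M lborel (S n)
               (exponential_density (leave_rate \<alpha>01 \<alpha>10 ((Not ^^ n) i)))) \<and>
        (AE \<omega> in M. \<forall>n. \<forall>t\<in>{(\<Sum>k<n. S k \<omega>)..<(\<Sum>k<Suc n. S k \<omega>)}. I t \<omega> = (Not ^^ n) i))"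

text \<open>
  The switching process as a Markov family: \<open>M (x,i)\<close> is the probability measure under which
  \<open>(X, I)\<close> starts from \<open>(x,i)\<close>, so that integrals with respect to \<open>M (x,i)\<close> are the conditional
  expectations given \<open>X\<^sub>0 = x, I\<^sub>0 = i\<close>.
\<close>

definition switching_process ::
  "real^'d^'d \<Rightarrow> real^'d \<Rightarrow> real \<Rightarrow> real \<Rightarrow> ((real^'d) \<times> bool \<Rightarrow> 'w measure) \<Rightarrow>
   (real \<Rightarrow> 'w \<Rightarrow> real^'d) \<Rightarrow> (real \<Rightarrow> 'w \<Rightarrow> bool) \<Rightarrow> bool" where
  "switching_process A p \<alpha>01 \<alpha>10 M X I \<longleftrightarrow>
     (\<forall>x i. prob_space (M (x, i)) \<and>
        markov_chain \<alpha>01 \<alpha>10 (M (x, i)) i I \<and>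
        (\<forall>t\<ge>0. X t \<in> borel_measurable (M (x, i))) \<and>
        (AE \<omega> in M (x, i). solves A p (\<lambda>t. I t \<omega>) x (\<lambda>t. X t \<omega>)))"

definition semigroup_op ::
  "('s \<Rightarrow> 'w measure) \<Rightarrow> (real \<Rightarrow> 'w \<Rightarrow> real^'d) \<Rightarrow> (real \<Rightarrow> 'w \<Rightarrow> bool) \<Rightarrow> real \<Rightarrow>
   ((real^'d) \<times> bool \<Rightarrow> real) \<Rightarrow> 's \<Rightarrow> real" where
  "semigroup_op M X I t f z = (LINT \<omega>|M z. f (X t \<omega>, I t \<omega>))"

text \<open>\<open>dx \<otimes> (\<delta>\<^sub>0 + \<delta>\<^sub>1)\<close>\<close>

definition ref_measure :: "((real^'d) \<times> bool) measure" where
  "ref_measure = lborel \<Otimes>\<^sub>M count_space UNIV"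

definition invariant_prob ::
  "((real^'d) \<times> bool \<Rightarrow> 'w measure) \<Rightarrow> (real \<Rightarrow> 'w \<Rightarrow> real^'d) \<Rightarrow> (real \<Rightarrow> 'w \<Rightarrow> bool) \<Rightarrow>
   ((real^'d) \<times> bool) measure \<Rightarrow> bool" where
  "invariant_prob M X I \<mu> \<longleftrightarrow>
     prob_space \<mu> \<and> sets \<mu> = sets (borel \<Otimes>\<^sub>M count_space UNIV) \<and>
     (\<forall>t\<ge>0. \<forall>f \<in> borel_measurable (borel \<Otimes>\<^sub>M count_space UNIV). bounded (range f) \<longrightarrow>
        (LINT z|\<mu>. semigroup_op M X I t f z) = (LINT z|\<mu>. f z))"

definition charpoly :: "real^'d^'d \<Rightarrow> complex poly" where
  "charpoly A = det (\<chi> i j. (if i = j then [:0, 1:] else 0) - [:complex_of_real (A $ i $ j):])"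

primrec C_k :: "nat \<Rightarrow> (real^'d \<Rightarrow> real) \<Rightarrow> bool" where
  "C_k 0 f \<longleftrightarrow> continuous_on UNIV f"
| "C_k (Suc k) f \<longleftrightarrow>
     (\<forall>x. f differentiable (at x)) \<and> (\<forall>v. C_k k (\<lambda>x. frechet_derivative f (at x) v))"

end

theory Submission
  imports Defs "HOL-Real_Asymp.Real_Asymp"
begin

text \<open>
  Conditionally on the chain, \<open>X\<^sub>t = e\<^bsup>tA\<^esup> x + \<integral>\<^sub>0\<^sup>t 1[I\<^sub>s] e\<^bsup>(t-s)A\<^esup> b ds\<close> with \<open>b = -Ap\<close>. Hence the characteristic
  functions \<open>\<psi>\<^sub>j\<close> of the parts of \<open>\<Pi>\<close> on the modes \<open>j\<close> satisfy
  \<open>\<psi>\<^sub>j(\<xi>) = \<Sum>\<^sub>i u\<^sub>i\<^sub>j(\<xi>) \<psi>\<^sub>i(T \<xi>)\<close>, where \<open>T\<close> is the transpose of \<open>e\<^bsup>A\<^esup>\<close> and \<open>u\<^sub>i\<^sub>j\<close> is the characteristic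
  function of the noise accumulated over one unit of time. By controllability the phase velocity
  \<open>s \<mapsto> \<xi> \<bullet> e\<^bsup>sA\<^esup> b\<close> vanishes only countably often, so paths with a jump average out and
  \<open>\<bar>u\<^sub>i\<^sub>j(\<xi>)\<bar> \<le> e\<^bsup>-\<alpha>\<^sub>i\<^esup>[i = j] + \<epsilon>\<close> for large \<open>\<xi>\<close>. Iterating until \<open>T\<^sup>n \<xi>\<close> enters a fixed ball gives
  a factor close to \<open>e\<^bsup>-n min \<alpha>\<^esup>\<close>, while the volume of the region of such \<open>\<xi>\<close> grows like \<open>e\<^bsup>-n \<Sum> \<Lambda>\<^esup>\<close> and
  \<open>\<bar>\<xi>\<bar>\<^sup>r\<close> like \<open>e\<^bsup>-n r \<Lambda>\<^sub>1\<^esup>\<close>. So \<open>\<bar>\<xi>\<bar>\<^sup>r \<psi>\<^sub>j\<close> is integrable and Fourier inversion yields a \<open>C\<^sup>r\<close> density.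

  For the support, invariance and continuity show that \<open>U = {\<rho>\<^sub>i > 0}\<close> is forward invariant under both flows
  and the same for \<open>i = 0, 1\<close>; \<open>U \<subseteq> \<Gamma>\<close> because the flow contracts and \<open>\<Pi>\<close> charges every neighbourhood of a
  point of \<open>U\<close>. Conversely \<open>U\<close> is dense in \<open>\<Gamma>\<close>, and a point of the interior of \<open>\<Gamma>\<close> is reached from an open
  set of nearby points of \<open>\<Gamma>\<close> by controllability, hence from a point of \<open>U\<close>.
\<close>

text \<open>Paths without a jump contribute the term \<open>exp (- \<alpha>_i)\<close> to the noise
  characteristic function, and this term does not decay in \<xi>: it limits the smoothness and is
  the place where the minimum of the rates enters. For the other paths, conditioning on the number
  of jumps would lead to oscillatory integrals of every dimension. Instead one conditions on the
  first jump only. All later randomness then sits in the amplitude of a single integral over the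
  first jump time. The amplitude still oscillates, but after division by an explicit phase it is
  Lipschitz uniformly in \<xi>, so a one-dimensional argument suffices. No rate of decay is
  extracted from it: the strict inequality between the rates and the spectrum leaves a margin, which
  absorbs the error \<epsilon> as well as the polynomial factors that Jordan blocks produce. For the
  support, continuity of the density turns lower bounds for the mass of small balls into pointwise
  positivity.\<close>

section \<open>Flows of linear vector fields\<close>

text \<open>A copy of the bounded linear endomorphisms on which composition is the multiplication of a Banach
  algebra, so that \<^const>\<open>exp\<close> applies.\<close>

typedef ('d::finite) endo = "UNIV :: ((real^'d) \<Rightarrow>\<^sub>L (real^'d)) set" by simp
setup_lifting type_definition_endo

instantiation endo :: (finite) real_normed_vector
begin
lift_definition zero_endo :: "'a endo" is 0 .
lift_definition plus_endo :: "'a endo \<Rightarrow> 'a endo \<Rightarrow> 'a endo" is "(+)" .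
lift_definition minus_endo :: "'a endo \<Rightarrow> 'a endo \<Rightarrow> 'a endo" is "(-)" .
lift_definition uminus_endo :: "'a endo \<Rightarrow> 'a endo" is uminus .
lift_definition scaleR_endo :: "real \<Rightarrow> 'a endo \<Rightarrow> 'a endo" is scaleR .
lift_definition norm_endo :: "'a endo \<Rightarrow> real" is norm .
definition dist_endo :: "'a endo \<Rightarrow> 'a endo \<Rightarrow> real" where "dist_endo x y = norm (x - y)"
definition sgn_endo :: "'a endo \<Rightarrow> 'a endo" where "sgn_endo x = inverse (norm x) *\<^sub>R x"
definition uniformity_endo :: "('a endo \<times> 'a endo) filter"
  where "uniformity_endo = (INF e\<in>{0 <..}. principal {(x, y). dist x y < e})"
definition open_endo :: "'a endo set \<Rightarrow> bool"
  where "open_endo U = (\<forall>x\<in>U. eventually (\<lambda>(x', y). x' = x \<longrightarrow> y \<in> U) uniformity)"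
instance
  apply (intro_classes; (simp only: dist_endo_def sgn_endo_def uniformity_endo_def open_endo_def)?)
  apply (transfer; simp add: algebra_simps norm_triangle_ineq)+
  done
end

instantiation endo :: (finite) real_normed_algebra_1
begin
lift_definition one_endo :: "'a endo" is id_blinfun .
lift_definition times_endo :: "'a endo \<Rightarrow> 'a endo \<Rightarrow> 'a endo" is "(o\<^sub>L)" .
instance
proof
  fix a b c :: "'a endo" and r :: real
  show "a * b * c = a * (b * c)" by transfer (auto intro: blinfun_eqI)
  show "(a + b) * c = a * c + b * c" by transfer (auto intro: blinfun_eqI simp: blinfun.add_left)
  show "a * (b + c) = a * b + a * c" by transfer (auto intro: blinfun_eqI simp: blinfun.add_left blinfun.add_right)
  show "r *\<^sub>R a * b = r *\<^sub>R (a * b)" by transfer (auto intro: blinfun_eqI simp: blinfun.scaleR_left)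
  show "a * r *\<^sub>R b = r *\<^sub>R (a * b)" by transfer (auto intro: blinfun_eqI simp: blinfun.scaleR_left blinfun.scaleR_right)
  show "1 * a = a" by transfer (auto intro: blinfun_eqI)
  show "a * 1 = a" by transfer (auto intro: blinfun_eqI)
  show "norm (a * b) \<le> norm a * norm b" by transfer (rule norm_blinfun_compose)
  show "norm (1::'a endo) = 1"
    by transfer (simp add: norm_blinfun_id)
  then show "(0::'a endo) \<noteq> 1" by (metis norm_zero zero_neq_one)
qed
end

lemma dist_Rep_endo: "dist (Rep_endo x) (Rep_endo y) = dist x y"
  unfolding dist_norm by transfer simp

instance endo :: (finite) banach
proof
  fix X :: "nat \<Rightarrow> 'a endo"
  assume "Cauchy X"
  then have "Cauchy (\<lambda>n. Rep_endo (X n))" by (simp add: Cauchy_def dist_Rep_endo)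
  then obtain L where "(\<lambda>n. Rep_endo (X n)) \<longlonglongrightarrow> L"
    using Cauchy_convergent_iff convergent_def by blast
  then have "X \<longlonglongrightarrow> Abs_endo L"
    by (simp add: lim_sequentially dist_Rep_endo[symmetric] Abs_endo_inverse)
  then show "convergent X" by (auto simp: convergent_def)
qed

definition endo_apply :: "'d::finite endo \<Rightarrow> real^'d \<Rightarrow> real^'d" where
  "endo_apply T x = blinfun_apply (Rep_endo T) x"

lemma bounded_bilinear_endo_apply: "bounded_bilinear endo_apply"
proof
  fix a a' :: "'a endo" and b b' :: "real^'a" and r :: real
  show "endo_apply (a + a') b = endo_apply a b + endo_apply a' b"
    unfolding endo_apply_def by transfer (simp add: blinfun.add_left)
  show "endo_apply a (b + b') = endo_apply a b + endo_apply a b'"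
    unfolding endo_apply_def by (simp add: blinfun.add_right)
  show "endo_apply (r *\<^sub>R a) b = r *\<^sub>R endo_apply a b"
    unfolding endo_apply_def by transfer (simp add: blinfun.scaleR_left)
  show "endo_apply a (r *\<^sub>R b) = r *\<^sub>R endo_apply a b"
    unfolding endo_apply_def by (simp add: blinfun.scaleR_right)
  show "\<exists>K. \<forall>a b. norm (endo_apply (a::'a endo) b) \<le> norm a * norm b * K"
    unfolding endo_apply_def by (rule exI[of _ 1], transfer) (simp add: norm_blinfun)
qed

lemma endo_apply_mult: "endo_apply (S * T) x = endo_apply S (endo_apply T x)"
  unfolding endo_apply_def by transfer simp

lemma endo_apply_one: "endo_apply 1 x = x"
  unfolding endo_apply_def by transfer simp

definition endo_of_matrix :: "real^'d^'d \<Rightarrow> ('d::finite) endo" where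
  "endo_of_matrix A = Abs_endo (Blinfun ((*v) A))"

lemma endo_apply_of_matrix: "endo_apply (endo_of_matrix A) x = A *v x"
  unfolding endo_apply_def endo_of_matrix_def
  by (simp add: Abs_endo_inverse bounded_linear_Blinfun_apply matrix_vector_mul_bounded_linear)

definition flow :: "real^'d^'d \<Rightarrow> real \<Rightarrow> real^'d \<Rightarrow> real^('d::finite)" where
  "flow A t = endo_apply (exp (t *\<^sub>R endo_of_matrix A))"

lemma flow_0 [simp]: "flow A 0 x = x"
  by (simp add: flow_def endo_apply_one)

lemma flow_add: "flow A (s + t) x = flow A s (flow A t x)"
  unfolding flow_def
  by (simp add: endo_apply_mult[symmetric] exp_add_commuting[symmetric] scaleR_add_left)

lemma flow_minus [simp]: "flow A (- t) (flow A t x) = x" "flow A t (flow A (- t) x) = x"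
  by (simp_all add: flow_add[symmetric])

lemma bounded_linear_flow: "bounded_linear (flow A t)"
  unfolding flow_def by (rule bounded_bilinear.bounded_linear_right[OF bounded_bilinear_endo_apply])

lemmas linear_flow = bounded_linear.linear[OF bounded_linear_flow]
lemmas flow_simps = linear_add[OF linear_flow] linear_diff[OF linear_flow]
  linear_scale[OF linear_flow] linear_neg[OF linear_flow] linear_0[OF linear_flow]

lemma flow_has_vector_derivative:
  "((\<lambda>t. flow A t x) has_vector_derivative A *v flow A t x) (at t within S)"
  "((\<lambda>t. flow A t x) has_vector_derivative flow A t (A *v x)) (at t within S)"
proof -
  interpret bounded_linear "\<lambda>T. endo_apply T x"
    by (rule bounded_bilinear.bounded_linear_left[OF bounded_bilinear_endo_apply])
  note * = has_vector_derivative[OF exp_scaleR_has_vector_derivative_right[of "endo_of_matrix A" t S]]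
  show "((\<lambda>t. flow A t x) has_vector_derivative flow A t (A *v x)) (at t within S)"
    using * unfolding flow_def endo_apply_mult endo_apply_of_matrix .
  show "((\<lambda>t. flow A t x) has_vector_derivative A *v flow A t x) (at t within S)"
    using * unfolding flow_def exp_times_scaleR_commute endo_apply_mult endo_apply_of_matrix .
qed

lemma flow_commute: "flow A t (A *v x) = A *v flow A t x"
  using vector_derivative_unique_at[OF flow_has_vector_derivative(2)[of A x t UNIV]
    flow_has_vector_derivative(1)[of A x t UNIV]] by simp

lemma continuous_on_flow [continuous_intros]:
  fixes f :: "'a::topological_space \<Rightarrow> real"
  assumes "continuous_on S f" "continuous_on S g"
  shows "continuous_on S (\<lambda>s. flow A (f s) (g s))"
proof -
  have "continuous_on UNIV (\<lambda>t. exp (t *\<^sub>R endo_of_matrix A))"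
    by (intro continuous_at_imp_continuous_on ballI
        has_vector_derivative_continuous[OF exp_scaleR_has_vector_derivative_right])
  from continuous_on_compose2[OF this assms(1)]
  have "continuous_on S (\<lambda>s. exp (f s *\<^sub>R endo_of_matrix A))" by simp
  then show ?thesis
    unfolding flow_def
    by (intro bounded_bilinear.continuous_on[OF bounded_bilinear_endo_apply] assms)
qed

lemma flow_measurable [measurable]:
  fixes g :: "_ \<Rightarrow> real^'d::finite"
  assumes [measurable]: "f \<in> borel_measurable M" "g \<in> borel_measurable M"
  shows "(\<lambda>s. flow A (f s) (g s)) \<in> borel_measurable M"
proof -
  have "continuous_on UNIV (\<lambda>x::real \<times> (real^'d). flow A (fst x) (snd x))"
    by (intro continuous_intros)
  then have "(\<lambda>x::real \<times> (real^'d). flow A (fst x) (snd x)) \<in> borel_measurable borel"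
    by (rule borel_measurable_continuous_onI)
  from measurable_compose[OF borel_measurable_Pair[OF assms] this] show ?thesis by simp
qed

text \<open>A crude bound, valid for both signs of \<open>t\<close>; the rate dictated by the
  spectrum is the subject of \<open>flow_growth\<close>.\<close>

lemma norm_flow_le: "norm (flow A t x) \<le> exp (\<bar>t\<bar> * norm (endo_of_matrix A)) * norm x"
proof -
  have "norm (flow A t x) \<le> norm (exp (t *\<^sub>R endo_of_matrix A)) * norm x"
    unfolding flow_def endo_apply_def norm_endo.rep_eq by (rule norm_blinfun)
  also have "\<dots> \<le> exp (\<bar>t\<bar> * norm (endo_of_matrix A)) * norm x"
    using norm_exp[of "t *\<^sub>R endo_of_matrix A"] by (intro mult_right_mono) auto
  finally show ?thesis .
qed

text \<open>With \<open>c = - 1\<close> the backward flow becomes the forward flow of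
  \<open>- A\<close>, so growth bounds for positive times cover both directions.\<close>

lemma flow_mult_left: "flow (c *\<^sub>R A) t = flow A (c * t)"
proof -
  have "endo_of_matrix (c *\<^sub>R A) = c *\<^sub>R endo_of_matrix A"
  proof -
    have "(\<lambda>x. (c *\<^sub>R A) *v x) = (\<lambda>x. c *\<^sub>R (A *v x))"
      by (simp add: scaleR_matrix_vector_assoc)
    moreover have "Blinfun (\<lambda>x. c *\<^sub>R (A *v x)) = c *\<^sub>R Blinfun ((*v) A)"
      by (rule blinfun_eqI) (simp add: blinfun.scaleR_left bounded_linear_Blinfun_apply
          matrix_vector_mul_bounded_linear bounded_linear_scaleR_right bounded_linear_const_scaleR)
    ultimately show ?thesis
      unfolding endo_of_matrix_def
      by (metis (no_types, lifting) Abs_endo_inverse Rep_endo_inverse UNIV_I scaleR_endo.rep_eq ext)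
  qed
  then show ?thesis by (simp add: flow_def mult.commute)
qed

section \<open>Growth of the flow from the real parts of the eigenvalues\<close>

text \<open>Variation of constants: after multiplication by \<open>exp (- m * t)\<close> the
  derivative has size at most \<open>K * exp (\<delta> * t)\<close> with
  \<open>\<delta> = c - Re m > 0\<close>. The strict gap makes the integral of this comparable to
  its last value, so no factor \<open>t\<close> appears.\<close>

lemma duhamel_growth:
  fixes u f :: "real \<Rightarrow> complex"
  assumes u: "\<And>t. (u has_vector_derivative m * u t + f t) (at t)"
    and f: "\<And>t. t \<ge> 0 \<Longrightarrow> norm (f t) \<le> K * exp (c * t)"
    and m: "Re m < c"
  obtains C where "\<And>t. t \<ge> 0 \<Longrightarrow> norm (u t) \<le> C * exp (c * t)"
proof -
  have K: "K \<ge> 0" using f[of 0] norm_ge_zero[of "f 0"] by (simp del: norm_ge_zero)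
  define \<delta> where "\<delta> = c - Re m"
  have \<delta>: "\<delta> > 0" using m by (simp add: \<delta>_def)
  define z where "z t = exp (- m * of_real t) * u t" for t
  have z: "(z has_vector_derivative exp (- m * of_real t) * f t) (at t)" for t
  proof -
    have "((\<lambda>t. exp (- m * of_real t)) has_vector_derivative - m * exp (- m * of_real t)) (at t)"
      by (auto intro!: derivative_eq_intros has_vector_derivative_real_field)
    from has_vector_derivative_mult[OF this u[of t]] show ?thesis
      unfolding z_def by (simp add: algebra_simps)
  qed
  have nz: "norm (exp (- m * of_real t)) = exp (- Re m * t)" for t
    by (simp add: norm_exp_eq_Re)
  have "norm (u t) \<le> (norm (u 0) + K / \<delta>) * exp (c * t)" if t: "t \<ge> 0" for t
  proof -
    \<comment> \<open>Mean value inequality against a primitive of the bound on the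
      derivative.\<close>
    have "norm (z t - z 0) \<le> K / \<delta> * exp (\<delta> * t) - K / \<delta> * exp (\<delta> * 0)"
    proof (cases "t = 0")
      case False
      then have "0 < t" using t by simp
      then show ?thesis
      proof (rule differentiable_bound_general[of 0 t z "\<lambda>t. K / \<delta> * exp (\<delta> * t)"
            "\<lambda>t. exp (- m * of_real t) * f t" "\<lambda>t. K * exp (\<delta> * t)"])
        show "continuous_on {0..t} z"
          by (intro continuous_at_imp_continuous_on ballI has_vector_derivative_continuous[OF z])
        show "continuous_on {0..t} (\<lambda>t. K / \<delta> * exp (\<delta> * t))"
          by (intro continuous_intros)
        fix s assume s: "0 < s" "s < t"
        show "(z has_vector_derivative exp (- m * of_real s) * f s) (at s)" by (rule z)
        show "((\<lambda>t. K / \<delta> * exp (\<delta> * t)) has_vector_derivative K * exp (\<delta> * s)) (at s)"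
          using \<delta> unfolding has_real_derivative_iff_has_vector_derivative[symmetric]
          by (auto intro!: derivative_eq_intros)
        have "norm (exp (- m * of_real s) * f s) \<le> exp (- Re m * s) * (K * exp (c * s))"
          unfolding norm_mult nz using f[of s] s by (intro mult_left_mono) auto
        also have "\<dots> = K * exp (\<delta> * s)"
          by (simp add: \<delta>_def exp_add[symmetric] algebra_simps flip: exp_add)
        finally show "norm (exp (- m * of_real s) * f s) \<le> K * exp (\<delta> * s)" .
      qed
    qed simp
    also have "\<dots> \<le> K / \<delta> * exp (\<delta> * t)" using K \<delta> by simp
    finally have "norm (z t) \<le> norm (z 0) + K / \<delta> * exp (\<delta> * t)"
      using norm_triangle_sub[of "z t" "z 0"] by linarith
    also have "norm (z 0) \<le> norm (u 0) * exp (\<delta> * t)"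
      using t \<delta> by (simp add: z_def mult_le_cancel_left1)
    finally have 1: "norm (z t) \<le> (norm (u 0) + K / \<delta>) * exp (\<delta> * t)"
      by (simp add: algebra_simps)
    have "norm (u t) = exp (Re m * t) * norm (z t)"
      unfolding z_def norm_mult nz by (simp add: exp_minus)
    also have "\<dots> \<le> exp (Re m * t) * ((norm (u 0) + K / \<delta>) * exp (\<delta> * t))"
      by (intro mult_left_mono 1) auto
    also have "\<dots> = (norm (u 0) + K / \<delta>) * (exp (Re m * t) * exp (\<delta> * t))" by simp
    also have "exp (Re m * t) * exp (\<delta> * t) = exp (c * t)"
      by (simp add: \<delta>_def exp_add[symmetric] algebra_simps flip: exp_add)
    finally show ?thesis .
  qed
  with that show ?thesis by blast
qed

text \<open>The operator \<open>B - m I\<close>. Operators of this kind for one \<open>B\<close>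
  commute, which lets the factors of an annihilating product be reordered at will.\<close>

definition shift_mul :: "complex^'d^'d \<Rightarrow> complex \<Rightarrow> complex^'d \<Rightarrow> complex^('d::finite)" where
  "shift_mul B m w = B *v w - m *s w"

lemma shift_mul_linear:
  "shift_mul B m (x + y) = shift_mul B m x + shift_mul B m y"
  "shift_mul B m (c *s x) = c *s shift_mul B m x"
  "shift_mul B m 0 = 0"
  by (simp_all add: shift_mul_def matrix_vector_right_distrib vector_add_ldistrib vec_eq_iff
      matrix_vector_mult_def sum_distrib_left sum.distrib algebra_simps)

lemma shift_mul_commute: "shift_mul B m (shift_mul B n w) = shift_mul B n (shift_mul B m w)"
  by (simp add: shift_mul_def matrix_vector_mult_diff_distrib vector_scalar_commute
      vector_sub_rdistrib vec_eq_iff algebra_simps)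

abbreviation shift_prod :: "complex^'d^'d \<Rightarrow> complex list \<Rightarrow> complex^'d \<Rightarrow> complex^('d::finite)" where
  "shift_prod B ms w \<equiv> foldr (shift_mul B) ms w"

lemma shift_prod_shift_mul: "shift_prod B ms (shift_mul B m w) = shift_mul B m (shift_prod B ms w)"
  by (induction ms) (auto simp: shift_mul_commute)

lemma shift_prod_smult: "shift_prod B ms (c *s w) = c *s shift_prod B ms w"
  by (induction ms) (auto simp: shift_mul_linear)

definition poly_act :: "complex^'d^'d \<Rightarrow> complex poly \<Rightarrow> complex^'d \<Rightarrow> complex^('d::finite)" where
  "poly_act B p w = (\<Sum>k\<le>degree p. coeff p k *s (((*v) B) ^^ k) w)"

lemma poly_act_upto:
  assumes "degree p \<le> n"
  shows "poly_act B p w = (\<Sum>k\<le>n. coeff p k *s (((*v) B) ^^ k) w)"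
  unfolding poly_act_def using assms
  by (intro sum.mono_neutral_left) (auto simp: coeff_eq_0)

lemma matrix_vector_right_distrib_sum:
  fixes B :: "complex^'n^'m"
  shows "B *v (\<Sum>k\<le>n. g k) = (\<Sum>k\<le>(n::nat). B *v g k)"
  by (induction n) (simp_all add: matrix_vector_right_distrib)

lemma scaleR_eq_smult_of_real: "c *\<^sub>R v = complex_of_real c *s v"
  unfolding vec_eq_iff vector_scaleR_component vector_smult_component by (simp add: scaleR_conv_of_real)

lemma mat_mult_vector: "mat m *v x = (m::'a::semiring_1) *s x"
  by (simp add: vec_eq_iff matrix_vector_mult_def mat_def if_distrib if_distribR cong: if_cong)

lemma poly_act_linear_factor:
  "poly_act B ([:-m, 1:] * p) w = shift_mul B m (poly_act B p w)"
proof -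
  define n where "n = Suc (degree p)"
  have d: "degree ([:-m, 1:] * p) \<le> Suc n" "degree p \<le> n" "degree p \<le> Suc n"
    using degree_mult_le[of "[:-m, 1:]" p] by (auto simp: n_def degree_pCons_eq_if split: if_splits)
  define f where "f k = (((*v) B) ^^ k) w" for k
  have fS: "B *v f k = f (Suc k)" for k by (simp add: f_def)
  have "poly_act B ([:-m, 1:] * p) w = (\<Sum>k\<le>Suc n. coeff (pCons 0 p - smult m p) k *s f k)"
    unfolding poly_act_upto[OF d(1)] f_def by simp
  also have "\<dots> = (\<Sum>k\<le>Suc n. coeff (pCons 0 p) k *s f k) - (\<Sum>k\<le>Suc n. (m * coeff p k) *s f k)"
    by (simp only: coeff_diff coeff_smult vector_sub_rdistrib sum_subtractf)
  also have "(\<Sum>k\<le>Suc n. coeff (pCons 0 p) k *s f k) = (\<Sum>k\<le>n. coeff p k *s f (Suc k))"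
    unfolding sum.atMost_Suc_shift by simp
  also have "\<dots> = B *v poly_act B p w"
    unfolding poly_act_upto[OF d(2)] matrix_vector_right_distrib_sum
    by (simp add: f_def vector_scalar_commute)
  also have "(\<Sum>k\<le>Suc n. (m * coeff p k) *s f k) = m *s poly_act B p w"
    unfolding poly_act_upto[OF d(3)] vec_eq_iff by (simp add: f_def sum_distrib_left mult.assoc)
  finally show ?thesis by (simp add: shift_mul_def)
qed

text \<open>One vector more than the dimension forces a linear relation. A repeated vector
  disappears from the image set, so that case supplies its own two-term relation.\<close>

lemma dependent_sequence:
  fixes f :: "nat \<Rightarrow> 'a::euclidean_space"
  obtains c :: "nat \<Rightarrow> real" and N where "\<exists>k\<le>N. c k \<noteq> 0" "(\<Sum>k\<le>N. c k *\<^sub>R f k) = 0"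
proof (cases "inj_on f {..DIM('a)}")
  case True
  then have "dependent (f ` {..DIM('a)})"
    using independent_bound[of "f ` {..DIM('a)}"] card_image[OF True] by auto
  then obtain u where u: "\<exists>v\<in>f ` {..DIM('a)}. u v \<noteq> 0" "(\<Sum>v\<in>f ` {..DIM('a)}. u v *\<^sub>R v) = 0"
    using dependent_finite[of "f ` {..DIM('a)}"] by auto
  show ?thesis
    by (rule that[of "DIM('a)" "u \<circ> f"]) (use u True in \<open>auto simp: sum.reindex\<close>)
next
  case False
  then obtain i j where ij: "i \<noteq> j" "f i = f j" by (auto simp: inj_on_def)
  define c :: "nat \<Rightarrow> real" where "c k = (if k = i then 1 else if k = j then -1 else 0)" for k
  have "(\<Sum>k\<le>max i j. c k *\<^sub>R f k) = (\<Sum>k\<in>{i,j}. c k *\<^sub>R f k)"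
    by (rule sum.mono_neutral_right) (auto simp: c_def)
  also have "\<dots> = 0" using ij by (simp add: c_def)
  finally show ?thesis by (intro that[of "max i j" c]) (auto simp: c_def intro!: exI[of _ i])
qed

text \<open>The iterates \<open>B^k w\<close> satisfy a nontrivial linear relation, that is
  \<open>p(B) w = 0\<close> with \<open>p \<noteq> 0\<close>, and over the complex numbers
  \<open>p\<close> splits into linear factors.\<close>

lemma shift_prod_annihilates: "\<exists>ms. shift_prod B ms w = 0"
proof -
  \<comment> \<open>\<open>complex^'d\<close> is treated as a real Euclidean space here, so the
    coefficients come out real.\<close>
  obtain c :: "nat \<Rightarrow> real" and N
    where c: "\<exists>k\<le>N. c k \<noteq> 0" "(\<Sum>k\<le>N. c k *\<^sub>R (((*v) B) ^^ k) w) = 0"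
    by (rule dependent_sequence)
  define p where "p = (\<Sum>k\<le>N. monom (complex_of_real (c k)) k)"
  have cp: "coeff p k = (if k \<le> N then complex_of_real (c k) else 0)" for k
    by (auto simp: p_def coeff_sum)
  have p0: "p \<noteq> 0" using c(1) cp by (metis coeff_0 of_real_eq_0_iff)
  have "degree p \<le> N" by (rule degree_le) (auto simp: cp)
  then have "poly_act B p w = 0"
    using c(2) by (simp add: poly_act_upto cp scaleR_eq_smult_of_real)
  moreover have "\<exists>ms. poly_act B p w = lead_coeff p *s shift_prod B ms w"
  proof -
    obtain ms where "p = smult (lead_coeff p) (\<Prod>m\<leftarrow>ms. [:-m, 1:])"
      using alg_closed_imp_factorization[OF p0]
      by (metis ex_mset mset_map prod_mset_prod_list)
    moreover have "poly_act B (smult a (\<Prod>m\<leftarrow>ms. [:-m, 1:])) w = a *s shift_prod B ms w" for a ms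
    proof (induction ms)
      case Nil
      show ?case by (simp add: poly_act_def)
    next
      case (Cons m ms)
      have "smult a (\<Prod>m\<leftarrow>m # ms. [:-m, 1:]) = [:-m, 1:] * smult a (\<Prod>m\<leftarrow>ms. [:-m, 1:])"
        by simp
      then show ?case
        by (simp only: poly_act_linear_factor Cons.IH shift_mul_linear foldr_Cons o_apply)
    qed
    ultimately show ?thesis by metis
  qed
  ultimately show ?thesis using p0 by auto
qed

text \<open>In a shortest annihilating list every entry is an eigenvalue: a factor with nonzero
  determinant could be commuted to the front and cancelled.\<close>

lemma shift_prod_annihilates_eigen:
  obtains ms where "shift_prod B ms w = 0" "\<And>m. m \<in> set ms \<Longrightarrow> det (mat m - B) = 0"
proof -
  obtain ms where ms: "shift_prod B ms w = 0"
    and min: "\<And>ns. shift_prod B ns w = 0 \<Longrightarrow> length ms \<le> length ns"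
    using shift_prod_annihilates[of B w] ex_has_least_nat[of "\<lambda>ms. shift_prod B ms w = 0" _ length]
    by metis
  have "det (mat m - B) = 0" if m: "m \<in> set ms" for m
  proof (rule ccontr)
    assume "det (mat m - B) \<noteq> 0"
    then have inv: "invertible (mat m - B)" by (simp add: invertible_det_nz)
    obtain xs ys where xy: "ms = xs @ m # ys" using m split_list by metis
    have "shift_mul B m (shift_prod B (xs @ ys) w) = 0"
      using ms unfolding xy by (simp add: shift_prod_shift_mul)
    then have "(mat m - B) *v shift_prod B (xs @ ys) w = 0"
      by (simp add: shift_mul_def matrix_vector_mult_diff_rdistrib mat_mult_vector)
    then have "shift_prod B (xs @ ys) w = 0"
      using inv by (metis invertible_def matrix_vector_mul_assoc matrix_vector_mul_lid matrix_vector_mult_0_right)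
    then show False using min[of "xs @ ys"] xy by simp
  qed
  with ms that show ?thesis by blast
qed

definition cvec :: "real^'d \<Rightarrow> complex^'d" where "cvec x = (\<chi> i. complex_of_real (x $ i))"
definition cmat :: "real^'d^'d \<Rightarrow> complex^'d^'d" where "cmat A = (\<chi> i j. complex_of_real (A $ i $ j))"

lemma cmat_mult_cvec: "cmat A *v cvec x = cvec (A *v x)"
  by (simp add: cmat_def cvec_def matrix_vector_mult_def vec_eq_iff)

lemma cvec_has_vector_derivative:
  fixes f :: "real \<Rightarrow> real^'d"
  assumes "(f has_vector_derivative f') F"
  shows "((\<lambda>t. cvec (f t) $ i) has_vector_derivative cvec f' $ i) F"
proof -
  have "((\<lambda>t. f t $ i) has_vector_derivative f' $ i) F"
    using bounded_linear.has_vector_derivative[OF bounded_linear_vec_nth assms] .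
  from bounded_linear.has_vector_derivative[OF bounded_linear_of_real this]
  show ?thesis by (simp add: cvec_def)
qed

lemma shift_prod_append_commute:
  "shift_prod B (ms @ ns) w = shift_prod B ns (shift_prod B ms w)"
  by (induction ms) (auto simp: shift_prod_shift_mul)

lemma shift_prod_add: "shift_prod B ms (x + y) = shift_prod B ms x + shift_prod B ms y"
  by (induction ms) (auto simp: shift_mul_linear)

lemma shift_prod_0: "shift_prod B ms 0 = 0"
  by (induction ms) (auto simp: shift_mul_linear)

text \<open>Since the factors commute, the concatenation of the lists of the unit vectors kills each
  unit vector, hence everything. This stands in for the Cayley-Hamilton theorem.\<close>

lemma shift_prod_annihilates_all:
  fixes B :: "complex^'d^'d"
  obtains ms where "\<And>w. shift_prod B ms w = 0" "\<And>m. m \<in> set ms \<Longrightarrow> det (mat m - B) = 0"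
proof -
  have "\<forall>i. \<exists>ms. shift_prod B ms (axis i 1) = 0 \<and> (\<forall>m\<in>set ms. det (mat m - B) = 0)"
    using shift_prod_annihilates_eigen[of B] by metis
  then obtain f where f: "\<And>i. shift_prod B (f i) (axis i 1) = 0"
      "\<And>i m. m \<in> set (f i) \<Longrightarrow> det (mat m - B) = 0"
    by metis
  obtain ks :: "'d list" where ks: "set ks = UNIV" using finite_list[OF finite] by auto
  define ms where "ms = concat (map f ks)"
  have ann: "shift_prod B ms (axis i 1) = 0" for i
  proof -
    obtain us vs where "ks = us @ i # vs" using ks split_list[of i ks] by auto
    then have "ms = concat (map f us) @ f i @ concat (map f vs)" by (simp add: ms_def)
    then have "ms = concat (map f us) @ (f i @ concat (map f vs))" by simp
    then show ?thesis
      by (simp only: foldr_append[of _ "concat (map f us)"] o_apply shift_prod_append_commute[of _ "f i"] f(1) shift_prod_0)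
  qed
  have all: "shift_prod B ms (\<Sum>i\<in>S. w $ i *s axis i 1) = 0" if "finite S" for w S
    using that by (induction S) (auto simp: shift_prod_0 shift_prod_add shift_prod_smult ann)
  have "w = (\<Sum>i\<in>UNIV. w $ i *s axis i 1)" for w :: "complex^'d"
    by (simp add: basis_expansion)
  then have "shift_prod B ms w = 0" for w using all[of UNIV w] by simp
  then show ?thesis by (rule that) (auto simp: ms_def f(2))
qed

text \<open>Induction that peels one factor off the list: with \<open>w\<close> the product of the
  remaining factors applied to the flow, \<open>w' = m w + (B - m) w\<close> holds componentwise,
  the last term is controlled by hypothesis, and \<open>duhamel_growth\<close> bounds
  \<open>w\<close>.\<close>

lemma shift_prod_flow_growth:
  fixes A :: "real^'d^'d" and x :: "real^'d" and c :: real
  assumes "\<And>m. m \<in> set ms \<Longrightarrow> Re m < c"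
    and "\<exists>C. \<forall>t\<ge>(0::real). \<forall>i. norm (shift_prod (cmat A) ms (cvec (flow A t x)) $ i) \<le> C * exp (c * t)"
  shows "\<exists>C. \<forall>t\<ge>(0::real). \<forall>i. norm (cvec (flow A t x) $ i) \<le> C * exp (c * t)"
  using assms
proof (induction ms)
  case (Cons m ns)
  define w where "w t = shift_prod (cmat A) ns (cvec (flow A t x))" for t
  \<comment> \<open>The factors commute with \<open>A\<close>, so each shifted copy of the flow
    solves the same linear equation.\<close>
  have der: "((\<lambda>t. shift_prod (cmat A) ns (cvec (flow A t x)) $ i) has_vector_derivative
      (cmat A *v shift_prod (cmat A) ns (cvec (flow A t x))) $ i) (at t)" for ns t i
  proof (induction ns arbitrary: i)
    case Nil
    show ?case
      using cvec_has_vector_derivative[OF flow_has_vector_derivative(1), of A x i t UNIV]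
      by (simp add: cmat_mult_cvec)
  next
    case (Cons m ns)
    define w where "w t = shift_prod (cmat A) ns (cvec (flow A t x))" for t
    have IH: "((\<lambda>t. w t $ i) has_vector_derivative (cmat A *v w t) $ i) (at t)" for i
      using Cons.IH by (simp add: w_def)
    have "((\<lambda>t. (\<Sum>j\<in>UNIV. cmat A $ i $ j * w t $ j) - m * w t $ i) has_vector_derivative
        (\<Sum>j\<in>UNIV. cmat A $ i $ j * (cmat A *v w t) $ j) - m * (cmat A *v w t) $ i) (at t)"
      by (intro has_vector_derivative_diff has_vector_derivative_sum has_vector_derivative_mult_right IH)
    moreover have "(\<Sum>j\<in>UNIV. cmat A $ i $ j * v $ j) - m * v $ i = shift_mul (cmat A) m v $ i" for v
      by (simp add: shift_mul_def matrix_vector_mult_def)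
    ultimately have "((\<lambda>t. shift_mul (cmat A) m (w t) $ i) has_vector_derivative
        (shift_mul (cmat A) m (cmat A *v w t)) $ i) (at t)" by simp
    moreover have "shift_mul (cmat A) m (cmat A *v w t) = cmat A *v shift_mul (cmat A) m (w t)"
      by (simp add: shift_mul_def matrix_vector_mult_diff_distrib vector_scalar_commute)
    ultimately show ?case by (simp add: w_def)
  qed
  obtain C where C: "\<And>t i. t \<ge> 0 \<Longrightarrow> norm (shift_mul (cmat A) m (w t) $ i) \<le> C * exp (c * t)"
    using Cons.prems(2) by (auto simp: w_def)
  have "\<exists>D. \<forall>t\<ge>0. norm (w t $ i) \<le> D * exp (c * t)" for i
  proof (rule duhamel_growth[of "\<lambda>t. w t $ i" m "\<lambda>t. shift_mul (cmat A) m (w t) $ i" C c])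
    show "((\<lambda>t. w t $ i) has_vector_derivative m * w t $ i + shift_mul (cmat A) m (w t) $ i) (at t)" for t
      using der[of ns i t] by (simp add: w_def shift_mul_def)
  qed (use C Cons.prems(1) in auto)
  then obtain D where D: "\<And>i t. t \<ge> 0 \<Longrightarrow> norm (w t $ i) \<le> D i * exp (c * t)" by metis
  have "norm (w t $ i) \<le> (MAX i. D i) * exp (c * t)" if "t \<ge> 0" for t i
    using D[OF that, of i] by (rule order_trans) (auto intro!: mult_right_mono)
  then show ?case using Cons.IH Cons.prems(1) by (auto simp: w_def)
qed simp

text \<open>An annihilating list makes the hypothesis of \<open>shift_prod_flow_growth\<close> hold
  with constant 0. Taking \<open>c\<close> strictly above all real parts absorbs the polynomial
  factors of nontrivial Jordan blocks.\<close>

theorem flow_growth: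
  fixes A :: "real^'d^'d"
  assumes "\<And>m. det (mat m - cmat A) = 0 \<Longrightarrow> Re m < c"
  obtains C where "C > 0" "\<And>t x. t \<ge> 0 \<Longrightarrow> norm (flow A t x) \<le> C * exp (c * t) * norm x"
proof -
  obtain ms where ms: "\<And>w. shift_prod (cmat A) ms w = 0" "\<And>m. m \<in> set ms \<Longrightarrow> det (mat m - cmat A) = 0"
    using shift_prod_annihilates_all[of "cmat A"] by metis
  have "\<exists>C. \<forall>t\<ge>0. norm (flow A t x) \<le> C * exp (c * t)" for x
  proof -
    have "\<exists>C. \<forall>t\<ge>0. \<forall>i. norm (cvec (flow A t x) $ i) \<le> C * exp (c * t)"
      by (rule shift_prod_flow_growth[of ms]) (use ms assms in \<open>auto intro!: exI[of _ 0]\<close>)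
    then obtain C where C: "\<And>t i. t \<ge> 0 \<Longrightarrow> \<bar>flow A t x $ i\<bar> \<le> C * exp (c * t)"
      by (auto simp: cvec_def)
    have "norm (flow A t x) \<le> (real CARD('d) * C) * exp (c * t)" if "t \<ge> 0" for t
      using norm_le_l1_cart[of "flow A t x"] sum_mono[of UNIV "\<lambda>i. \<bar>flow A t x $ i\<bar>", OF C[OF that]]
      by simp
    then show ?thesis by blast
  qed
  then obtain C where C: "\<And>x t. t \<ge> 0 \<Longrightarrow> norm (flow A t x) \<le> C x * exp (c * t)" by metis
  \<comment> \<open>Expanding \<open>x\<close> in the basis makes the constant independent of
    \<open>x\<close>.\<close>
  define K where "K = 1 + (\<Sum>b\<in>Basis. \<bar>C b\<bar>)"
  have K: "K > 0" unfolding K_def by (intro add_pos_nonneg sum_nonneg) auto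
  have "norm (flow A t x) \<le> K * exp (c * t) * norm x" if t: "t \<ge> 0" for t x
  proof -
    have "norm (flow A t x) = norm (flow A t (\<Sum>b\<in>Basis. (x \<bullet> b) *\<^sub>R b))"
      by (simp add: euclidean_representation)
    also have "\<dots> = norm (\<Sum>b\<in>Basis. (x \<bullet> b) *\<^sub>R flow A t b)"
      by (simp add: linear_sum[OF linear_flow] flow_simps)
    also have "\<dots> \<le> (\<Sum>b\<in>Basis. norm x * (\<bar>C b\<bar> * exp (c * t)))"
    proof (rule sum_norm_le)
      fix b :: "real^'d" assume b: "b \<in> Basis"
      have "norm (flow A t b) \<le> \<bar>C b\<bar> * exp (c * t)"
        using C[OF t, of b] by (rule order_trans) (auto intro!: mult_right_mono)
      then show "norm ((x \<bullet> b) *\<^sub>R flow A t b) \<le> norm x * (\<bar>C b\<bar> * exp (c * t))"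
        using Basis_le_norm[OF b, of x] by (auto intro!: mult_mono)
    qed
    also have "\<dots> = norm x * (\<Sum>b\<in>Basis. \<bar>C b\<bar>) * exp (c * t)"
      by (simp add: sum_distrib_left sum_distrib_right mult.assoc)
    also have "\<dots> \<le> norm x * K * exp (c * t)"
      by (intro mult_right_mono mult_left_mono) (auto simp: K_def)
    finally show ?thesis by (simp add: mult_ac)
  qed
  with K show ?thesis by (rule that)
qed

section \<open>Spectrum and observability\<close>

lemma poly_det: "poly (det M) z = det (\<chi> i j. poly (M $ i $ j) z)"
  by (simp add: det_def poly_sum poly_prod)

lemma poly_charpoly: "poly (charpoly A) z = det (mat z - cmat A)"
proof -
  have "(\<chi> i j. poly ((\<chi> i j. (if i = j then [:0, 1:] else 0) - [:complex_of_real (A $ i $ j):]) $ i $ j) z)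
      = mat z - cmat A"
    by (simp add: vec_eq_iff mat_def cmat_def)
  then show ?thesis by (simp add: charpoly_def poly_det)
qed

lemma det_smult_matrix: "det (\<chi> i j. c * B $ i $ j) = c ^ CARD('d) * det (B :: 'a::comm_ring_1^'d^'d)"
  using det_rows_mul[of "\<lambda>_. c" "\<lambda>i. B $ i"] by (simp add: vector_scalar_mult_def)

locale spectrum =
  fixes A :: "real^'d^'d" and \<Lambda> :: "nat \<Rightarrow> real"
  assumes roots: "image_mset \<Lambda> (mset_set {1..CARD('d)}) = image_mset Re (proots (charpoly A))"
begin

lemma charpoly_nz: "charpoly A \<noteq> 0"
proof
  assume "charpoly A = 0"
  \<comment> \<open>By convention the zero polynomial has no roots, while the left multiset has
    \<open>CARD('d)\<close> elements.\<close>
  then have "image_mset \<Lambda> (mset_set {1..CARD('d)}) = {#}" using roots by simp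
  then show False by (simp add: mset_set_empty_iff)
qed

lemma size_proots: "size (proots (charpoly A)) = CARD('d)"
  using arg_cong[OF roots, of size] by (metis card_atLeastAtMost diff_Suc_1 size_image_mset size_mset_set)

lemma eigenvalue_Re:
  assumes "det (mat m - cmat A) = 0"
  obtains k where "k \<in> {1..CARD('d)}" "Re m = \<Lambda> k"
proof -
  have "m \<in> set_mset (proots (charpoly A))"
    using assms charpoly_nz by (simp add: poly_charpoly)
  then have "Re m \<in> set_mset (image_mset \<Lambda> (mset_set {1..CARD('d)}))"
    unfolding roots by simp
  then show ?thesis using that by auto
qed

lemma eigenvalue_Re_neg:
  assumes "det (mat m - cmat (- A)) = 0"
  obtains k where "k \<in> {1..CARD('d)}" "Re m = - \<Lambda> k"
proof -
  have "(\<chi> i j. (-1) * (mat m - cmat (- A)) $ i $ j) = mat (- m) - cmat A"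
    by (simp add: vec_eq_iff mat_def cmat_def)
  then have "det (mat (- m) - cmat A) = 0"
    using det_smult_matrix[of "-1" "mat m - cmat (- A)"] assms by simp
  then show ?thesis by (elim eigenvalue_Re) (use that in auto)
qed

lemma sum_Re_proots: "Re (\<Sum>m\<in>#proots (charpoly A). m) = (\<Sum>i=1..CARD('d). \<Lambda> i)"
proof -
  have "Re (\<Sum>m\<in>#M. m) = sum_mset (image_mset Re M)" for M
    by (induction M) auto
  then have "Re (\<Sum>m\<in>#proots (charpoly A). m) = sum_mset (image_mset \<Lambda> (mset_set {1..CARD('d)}))"
    unfolding roots .
  then show ?thesis by (simp add: sum_unfold_sum_mset)
qed

text \<open>For \<open>t \<noteq> 0\<close> both sides are the characteristic polynomial at
  \<open>- 1 / t\<close>, up to a power of \<open>t\<close> and the leading coefficient. That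
  coefficient is found by letting \<open>t\<close> tend to 0, where both sides are 1.\<close>

lemma det_one_plus: "complex_of_real (det (mat 1 + t *\<^sub>R A)) = (\<Prod>m\<in>#proots (charpoly A). 1 + of_real t * m)"
proof -
  define P where "P t = (\<Prod>m\<in>#proots (charpoly A). 1 + of_real t * m)" for t :: real
  define D where "D t = complex_of_real (det (mat 1 + t *\<^sub>R A))" for t
  define c where "c = lead_coeff (charpoly A)"
  have eq: "D t = c * P t" if "t \<noteq> 0" for t
  proof -
    define z where "z = complex_of_real (- 1 / t)"
    have z: "z \<noteq> 0" using that by (simp add: z_def)
    have "(\<chi> i j. z * (cmat (mat 1 + t *\<^sub>R A)) $ i $ j) = mat z - cmat A"
      using that by (simp add: vec_eq_iff mat_def cmat_def z_def field_simps)
    then have "poly (charpoly A) z = z ^ CARD('d) * det (cmat (mat 1 + t *\<^sub>R A))"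
      using det_smult_matrix[of z "cmat (mat 1 + t *\<^sub>R A)"] by (simp add: poly_charpoly)
    moreover have "det (cmat B) = complex_of_real (det B)" for B :: "real^'d^'d"
      by (simp add: det_def cmat_def)
    moreover have "poly (charpoly A) z = c * z ^ CARD('d) * P t"
    proof -
      have "(\<Prod>m\<in>#M. z - m) = z ^ size M * (\<Prod>m\<in>#M. 1 + of_real t * m)" for M
        using that by (induction M) (auto simp: z_def field_simps)
      moreover have "poly (\<Prod>m\<in>#M. [:-m, 1:]) z = (\<Prod>m\<in>#M. z - m)" for M
        by (induction M) (auto simp: algebra_simps)
      ultimately show ?thesis
        by (subst complex_poly_decompose_multiset[symmetric]) (simp add: c_def P_def size_proots)
    qed
    ultimately show ?thesis using z by (simp add: D_def)
  qed
  have contP: "isCont P 0"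
  proof -
    have "isCont (\<lambda>t. \<Prod>m\<in>#M. 1 + complex_of_real t * m) 0" for M
      by (induction M) (auto intro!: continuous_intros)
    then show ?thesis unfolding P_def .
  qed
  have contD: "isCont D 0"
    unfolding D_def det_def by (auto intro!: continuous_intros)
  have D0: "D 0 = 1" and P0: "P 0 = 1" by (simp_all add: D_def P_def)
  have "(D \<longlongrightarrow> c * P 0) (at 0)"
  proof (rule Lim_transform_eventually)
    show "((\<lambda>t. c * P t) \<longlongrightarrow> c * P 0) (at 0)"
      by (intro tendsto_intros) (use contP isCont_def in blast)
    show "\<forall>\<^sub>F t in at 0. c * P t = D t"
      using eq by (auto simp: eventually_at_filter)
  qed
  then have "c * P 0 = D 0" using contD LIM_unique unfolding isCont_def by blast
  then have c: "c = 1" by (simp add: D0 P0)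
  show ?thesis
    using eq[of t] c D0 P0 by (cases "t = 0") (auto simp: D_def P_def)
qed

end

lemma det_has_real_derivative:
  fixes B :: "real \<Rightarrow> real^'d^'d"
  assumes "\<And>i j. ((\<lambda>t. B t $ i $ j) has_real_derivative C $ i $ j) (at s)"
  shows "((\<lambda>t. det (B t)) has_real_derivative
    (\<Sum>q | q permutes UNIV. of_int (sign q) * (\<Sum>i\<in>UNIV. C $ i $ q i * (\<Prod>j\<in>UNIV - {i}. B s $ j $ q j)))) (at s)"
  unfolding det_def
  by (intro DERIV_sum DERIV_cmult has_field_derivative_prod assms)

lemma matrix_flow_component_derivative:
  "((\<lambda>t. matrix (flow A t) $ i $ j) has_real_derivative (A ** matrix (flow A s)) $ i $ j) (at s)"
proof -
  have "((\<lambda>t. flow A t (axis j 1) $ i) has_vector_derivative (A *v flow A s (axis j 1)) $ i) (at s)"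
    by (rule bounded_linear.has_vector_derivative[OF bounded_linear_vec_nth flow_has_vector_derivative(1)])
  then show ?thesis
    by (simp add: has_real_derivative_iff_has_vector_derivative matrix_def matrix_matrix_mult_def
        matrix_vector_mult_def)
qed

lemma matrix_flow_0: "matrix (flow A 0) = mat 1"
  by (auto simp: matrix_def mat_def vec_eq_iff axis_def)

text \<open>Liouville's formula. By multiplicativity in \<open>t\<close> everything is determined by
  the derivative at 0; it coincides with that of \<open>det (mat 1 + t *\<^sub>R A)\<close>, which
  \<open>det_one_plus\<close> turns into the sum of the eigenvalues.\<close>

lemma (in spectrum) det_flow: "det (matrix (flow A t)) = exp (t * (\<Sum>i=1..CARD('d). \<Lambda> i))"
proof -
  define \<tau> where "\<tau> = (\<Sum>i=1..CARD('d). \<Lambda> i)"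
  define D where "D t = det (matrix (flow A t))" for t
  have add: "D (s + t) = D s * D t" for s t
  proof -
    have "flow A (s + t) = flow A s \<circ> flow A t" by (auto simp: flow_add)
    then show ?thesis by (simp add: D_def matrix_compose[OF linear_flow linear_flow] det_mul)
  qed
  \<comment> \<open>Both derivatives are the same unevaluated Leibniz sum, because the derivative of
    a determinant depends only on the matrix and its derivative at the point.\<close>
  obtain d where d1: "(D has_real_derivative d) (at 0)"
    and d2: "((\<lambda>t. det (mat 1 + t *\<^sub>R A)) has_real_derivative d) (at 0)"
  proof
    show "(D has_real_derivative (\<Sum>q | q permutes UNIV. of_int (sign q) *
        (\<Sum>i\<in>UNIV. A $ i $ q i * (\<Prod>j\<in>UNIV - {i}. mat 1 $ j $ q j)))) (at 0)"
      unfolding D_def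
      using det_has_real_derivative[OF matrix_flow_component_derivative, of A 0]
      by (simp add: matrix_flow_0)
    have "((\<lambda>t. (mat 1 + t *\<^sub>R A) $ i $ j) has_real_derivative A $ i $ j) (at 0)" for i j
      by (auto intro!: derivative_eq_intros)
    from det_has_real_derivative[OF this]
    show "((\<lambda>t. det (mat 1 + t *\<^sub>R A)) has_real_derivative (\<Sum>q | q permutes UNIV. of_int (sign q) *
        (\<Sum>i\<in>UNIV. A $ i $ q i * (\<Prod>j\<in>UNIV - {i}. mat 1 $ j $ q j)))) (at 0)"
      by simp
  qed
  have "((\<lambda>t. complex_of_real (det (mat 1 + t *\<^sub>R A))) has_vector_derivative of_real d) (at 0)"
    by (rule bounded_linear.has_vector_derivative[OF bounded_linear_of_real])
      (use d2 in \<open>simp add: has_real_derivative_iff_has_vector_derivative\<close>)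
  moreover have "((\<lambda>t. \<Prod>m\<in>#M. 1 + complex_of_real t * m) has_vector_derivative (\<Sum>m\<in>#M. m)) (at 0)" for M
  proof (induction M)
    case (add m M)
    have "((\<lambda>t. 1 + complex_of_real t * m) has_vector_derivative m) (at 0)"
      by (auto intro!: derivative_eq_intros has_vector_derivative_real_field)
    from has_vector_derivative_mult[OF this add] show ?case by (simp add: add.commute)
  qed simp
  ultimately have "complex_of_real d = (\<Sum>m\<in>#proots (charpoly A). m)"
    unfolding det_one_plus by (rule vector_derivative_unique_at)
  then have d: "d = \<tau>" using sum_Re_proots unfolding \<tau>_def by (metis Re_complex_of_real)
  have "(D has_real_derivative \<tau> * D t) (at t)" for t
  proof -
    have "((\<lambda>h. D (h - t) * D t) has_real_derivative d * D t) (at (0 + t))"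
      by (rule DERIV_cmult_right) (use d1 DERIV_shift[of "\<lambda>h. D (h - t)" d 0 t] in simp)
    moreover have "D (h - t) * D t = D h" for h by (simp add: add[symmetric])
    ultimately show ?thesis by (simp add: d)
  qed
  then have "((\<lambda>t. D t * exp (- (\<tau> * t))) has_real_derivative 0) (at t)" for t
    by (auto intro!: derivative_eq_intros)
  then have "D t * exp (- (\<tau> * t)) = D 0 * exp (- (\<tau> * 0))"
    using DERIV_isconst_all by blast
  then have "D t * exp (- (\<tau> * t)) = 1" by (simp add: D_def matrix_flow_0)
  then show ?thesis unfolding D_def \<tau>_def by (simp add: exp_minus field_simps)
qed

section \<open>Zeros of the phase velocity\<close>

text \<open>Each isolated point has a basic open set that meets \<open>Z\<close> in this point
  alone, and there are countably many basic open sets.\<close>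

lemma countable_isolated_points:
  fixes Z :: "real set"
  shows "countable {s \<in> Z. \<not> s islimpt Z}"
proof -
  obtain B :: "real set set" where B: "countable B" "\<And>X x. open X \<Longrightarrow> x \<in> X \<Longrightarrow> \<exists>b\<in>B. x \<in> b \<and> b \<subseteq> X"
    using ex_countable_basis topological_basisE by metis
  have "\<exists>b\<in>B. s \<in> b \<and> b \<inter> Z = {s}" if "s \<in> Z" "\<not> s islimpt Z" for s
  proof -
    have "s isolated_in Z" using that by (simp add: isolated_in_islimpt_iff)
    then obtain X where X: "open X" "X \<inter> Z = {s}" by (rule isolated_inE)
    then show ?thesis using B(2)[of X s] that(1) by blast
  qed
  then obtain f where f: "\<And>s. s \<in> {s \<in> Z. \<not> s islimpt Z} \<Longrightarrow> f s \<in> B \<and> f s \<inter> Z = {s}"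
    by (metis (no_types, lifting) mem_Collect_eq)
  have "inj_on f {s \<in> Z. \<not> s islimpt Z}" by (rule inj_onI) (metis f singleton_inject)
  moreover have "f ` {s \<in> Z. \<not> s islimpt Z} \<subseteq> B" using f by blast
  ultimately show ?thesis using B(1) countable_image_inj_on countable_subset by metis
qed

text \<open>\<open>f k\<close> is the \<open>k\<close>-th derivative of
  \<open>s \<mapsto> \<theta> \<bullet> flow A s b\<close>. At a limit point of common zeros of
  \<open>f 0, ..., f k\<close> some difference quotients of \<open>f k\<close> vanish along a
  sequence, so \<open>f (Suc k)\<close> vanishes too: passing from \<open>Z k\<close> to
  \<open>Z (Suc k)\<close> loses isolated points only. Observability empties
  \<open>Z n\<close>.\<close>

lemma countable_zeros_flow:
  fixes A :: "real^'d^'d"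
  assumes obs: "\<And>\<theta>. (\<And>k. k < n \<Longrightarrow> \<theta> \<bullet> (((*v) A) ^^ k) b = 0) \<Longrightarrow> \<theta> = 0"
    and "\<theta> \<noteq> 0"
  shows "countable {s. \<theta> \<bullet> flow A s b = 0}"
proof -
  define f where "f k s = \<theta> \<bullet> flow A s ((((*v) A) ^^ k) b)" for k s
  have f: "(f k has_real_derivative f (Suc k) s) (at s)" for k s
    unfolding f_def has_real_derivative_iff_has_vector_derivative
    using bounded_linear.has_vector_derivative[OF bounded_linear_inner_right
        flow_has_vector_derivative(2)[of A "(((*v) A) ^^ k) b" s UNIV], of \<theta>] by simp
  define Z where "Z k = {s. \<forall>j\<le>k. f j s = 0}" for k
  have "Z k \<subseteq> {s \<in> Z k. \<not> s islimpt Z k} \<union> Z (Suc k)" for k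
  proof
    fix s assume s: "s \<in> Z k"
    show "s \<in> {s \<in> Z k. \<not> s islimpt Z k} \<union> Z (Suc k)"
    proof (cases "s islimpt Z k")
      case True
      then obtain x where x: "\<And>n. x n \<in> Z k - {s}" "x \<longlonglongrightarrow> s"
        unfolding islimpt_sequential by auto
      have "((\<lambda>y. (f k y - f k s) / (y - s)) \<longlongrightarrow> f (Suc k) s) (at s)"
        using f[of k s] by (simp add: has_field_derivative_iff)
      moreover have "filterlim x (at s) sequentially"
        using x by (auto simp: filterlim_at)
      ultimately have "(\<lambda>n. (f k (x n) - f k s) / (x n - s)) \<longlonglongrightarrow> f (Suc k) s"
        by (rule filterlim_compose)
      moreover have "(f k (x n) - f k s) / (x n - s) = 0" for n
        using x(1)[of n] s by (simp add: Z_def)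
      ultimately have "f (Suc k) s = 0" using LIMSEQ_unique[OF _ tendsto_const[of 0]] by simp
      then show ?thesis using s by (auto simp: Z_def le_Suc_eq)
    qed (use s in auto)
  qed
  then have step: "countable (Z (Suc k)) \<Longrightarrow> countable (Z k)" for k
    using countable_isolated_points[of "Z k"] by (meson countable_Un countable_subset)
  have "Z n = {}"
  proof (rule ccontr)
    assume "Z n \<noteq> {}"
    then obtain s where s: "\<And>k. k \<le> n \<Longrightarrow> f k s = 0" by (auto simp: Z_def)
    have "adjoint (flow A s) \<theta> \<bullet> x = \<theta> \<bullet> flow A s x" for x
      using adjoint_works[OF linear_flow, of x A s \<theta>] by (simp add: inner_commute)
    then have "adjoint (flow A s) \<theta> = 0" by (intro obs) (use s in \<open>auto simp: f_def\<close>)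
    \<comment> \<open>Testing the vanishing functional on \<open>flow A (- s) \<theta>\<close>
      yields \<open>\<theta> \<bullet> \<theta> = 0\<close>.\<close>
    then have "\<theta> \<bullet> flow A s (flow A (- s) \<theta>) = 0"
      using \<open>\<And>x. adjoint (flow A s) \<theta> \<bullet> x = \<theta> \<bullet> flow A s x\<close> by (metis inner_zero_left)
    then show False using \<open>\<theta> \<noteq> 0\<close> by simp
  qed
  then have "countable (Z n)" by simp
  then have "countable (Z 0)"
    by (induction n) (auto intro: step)
  then show ?thesis by (simp add: Z_def f_def)
qed

section \<open>Oscillatory integrals\<close>

text \<open>Compactness of the unit sphere: if the bound failed for every
  \<open>\<delta> = 1 / Suc n\<close>, the offending directions would have a limit \<open>l\<close>
  along a subsequence. The integrands, all at most 1, tend to 0 off the null set where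
  \<open>l \<bullet> v s = 0\<close>, and dominated convergence gives a contradiction.\<close>

lemma small_denominator_uniform:
  fixes v :: "real \<Rightarrow> 'a::euclidean_space"
  assumes v: "continuous_on {0..1} v"
    and zeros: "\<And>\<theta>. \<theta> \<noteq> 0 \<Longrightarrow> negligible {s \<in> {0..1}. \<theta> \<bullet> v s = 0}"
    and "\<eta> > 0"
  obtains \<delta> :: real where "\<delta> > 0"
    "\<And>\<theta>. norm \<theta> = 1 \<Longrightarrow> integral {0..1} (\<lambda>s. \<delta>\<^sup>2 / ((\<theta> \<bullet> v s)\<^sup>2 + \<delta>\<^sup>2)) < \<eta>"
proof (rule ccontr)
  assume contra: "\<not> thesis"
  define f where "f \<delta> \<theta> s = \<delta>\<^sup>2 / ((\<theta> \<bullet> v s)\<^sup>2 + \<delta>\<^sup>2)" for \<delta> \<theta> s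
  have "\<exists>\<theta>. norm \<theta> = 1 \<and> \<eta> \<le> integral {0..1} (f (1 / real (Suc n)) \<theta>)" for n
    unfolding f_def using contra that[of "1 / real (Suc n)"]
    by (metis not_le of_nat_0_less_iff zero_less_Suc zero_less_divide_1_iff)
  then obtain \<theta> where \<theta>: "\<And>n. norm (\<theta> n) = 1" "\<And>n. \<eta> \<le> integral {0..1} (f (1 / real (Suc n)) (\<theta> n))"
    by metis
  have "compact (sphere (0::'a) 1)" by simp
  then obtain l r where l: "l \<in> sphere (0::'a) 1" "strict_mono r" "(\<theta> \<circ> r) \<longlonglongrightarrow> l"
    using \<theta>(1) unfolding compact_def by (metis mem_sphere_0)
  have "l \<noteq> 0" using l(1) by auto
  define Z where "Z = {s \<in> {0..1}. l \<bullet> v s = 0}"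
  have Z: "negligible Z" unfolding Z_def by (rule zeros) fact
  define d where "d k = 1 / real (Suc (r k))" for k
  have d0: "d k > 0" for k by (simp add: d_def)
  have "(\<lambda>n. 1 / real (Suc n)) \<longlonglongrightarrow> 0" by (rule LIMSEQ_inverse_real_of_nat[unfolded inverse_eq_divide])
  then have d: "d \<longlonglongrightarrow> 0"
    using LIMSEQ_subseq_LIMSEQ[OF _ l(2)] by (auto simp: d_def[abs_def] o_def simp del: of_nat_Suc)
  \<comment> \<open>Set to 0 on \<open>Z\<close>, where the quotient need not tend to 0, so that
    pointwise convergence holds everywhere.\<close>
  define g where "g k s = (if s \<in> Z then 0 else f (d k) (\<theta> (r k)) s)" for k s
  have cont: "continuous_on {0..1} (f (d k) \<theta>)" for k \<theta>
  proof -
    have "(\<theta> \<bullet> v s)\<^sup>2 + (d k)\<^sup>2 \<noteq> 0" for s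
      using d0[of k] by (metis add_nonneg_pos less_irrefl zero_le_power2 zero_less_power)
    then show ?thesis unfolding f_def by (intro continuous_intros v) auto
  qed
  have 1: "g k integrable_on {0..1}" for k
    by (rule integrable_spike[OF integrable_continuous_real[OF cont[of k "\<theta> (r k)"]] Z]) (auto simp: g_def)
  have 2: "norm (g k s) \<le> 1" for k s
    using d0[of k] by (auto simp: g_def f_def divide_simps add_nonneg_pos)
  have 3: "(\<lambda>k. g k s) \<longlonglongrightarrow> 0" if s: "s \<in> {0..1}" for s
  proof (cases "s \<in> Z")
    case False
    then have nz: "l \<bullet> v s \<noteq> 0" using s by (auto simp: Z_def)
    have "(\<lambda>k. f (d k) (\<theta> (r k)) s) \<longlonglongrightarrow> 0\<^sup>2 / ((l \<bullet> v s)\<^sup>2 + 0\<^sup>2)"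
      unfolding f_def by (intro tendsto_intros d l(3)[unfolded o_def]) (use nz in auto)
    then show ?thesis using False by (simp add: g_def)
  qed (simp add: g_def)
  have "(\<lambda>k. integral {0..1} (g k)) \<longlonglongrightarrow> integral {0..1} (\<lambda>s::real. 0::real)"
    using 1 2 3 by (intro dominated_convergence(2)[where h = "\<lambda>_. 1"]) auto
  moreover have "integral {0..1} (g k) = integral {0..1} (f (d k) (\<theta> (r k)))" for k
    by (rule integral_spike[OF Z]) (auto simp: g_def)
  ultimately have "(\<lambda>k. integral {0..1} (f (d k) (\<theta> (r k)))) \<longlonglongrightarrow> 0" by simp
  then have "\<eta> \<le> 0"
    by (rule LIMSEQ_le_const) (use \<theta>(2) in \<open>auto simp: d_def\<close>)
  then show False using \<open>\<eta> > 0\<close> by simp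
qed

text \<open>
  Integration by parts with the weight \<open>w = \<lambda> / (\<lambda>\<^sup>2 + c\<^sup>2)\<close> in place of \<open>1 / \<lambda>\<close>, which is singular at the
  zeros of the phase velocity \<open>\<lambda>\<close>.
\<close>

lemma oscillatory_integral_bound:
  fixes \<Phi> lam lam' :: "real \<Rightarrow> real" and g g' :: "real \<Rightarrow> complex"
  assumes \<Phi>: "\<And>s. s \<in> {0..1} \<Longrightarrow> (\<Phi> has_real_derivative lam s) (at s within {0..1})"
    and lam: "\<And>s. s \<in> {0..1} \<Longrightarrow> (lam has_real_derivative lam' s) (at s within {0..1})"
    and lam': "\<And>s. s \<in> {0..1} \<Longrightarrow> \<bar>lam' s\<bar> \<le> V"
    and g: "\<And>s. s \<in> {0..1} \<Longrightarrow> (g has_vector_derivative g' s) (at s within {0..1})"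
    and K: "\<And>s. s \<in> {0..1} \<Longrightarrow> norm (g s) \<le> K" "\<And>s. s \<in> {0..1} \<Longrightarrow> norm (g' s) \<le> K"
    and c: "c > 0"
  shows "norm (integral {0..1} (\<lambda>s. exp (\<i> * of_real (\<Phi> s)) * g s))
    \<le> 3 * K / c + K * V / c\<^sup>2 + K * integral {0..1} (\<lambda>s. c\<^sup>2 / ((lam s)\<^sup>2 + c\<^sup>2))"
proof -
  define e where "e s = exp (\<i> * of_real (\<Phi> s))" for s
  define w where "w s = lam s / ((lam s)\<^sup>2 + c\<^sup>2)" for s
  define w' where "w' s = lam' s * (c\<^sup>2 - (lam s)\<^sup>2) / ((lam s)\<^sup>2 + c\<^sup>2)\<^sup>2" for s
  define q where "q s = c\<^sup>2 / ((lam s)\<^sup>2 + c\<^sup>2)" for s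
  have K0: "K \<ge> 0" using K(1)[of 0] norm_ge_zero[of "g 0"] by (simp del: norm_ge_zero)
  have V0: "V \<ge> 0" using lam'[of 0] by simp
  have pos: "(lam s)\<^sup>2 + c\<^sup>2 > 0" for s using c by (simp add: add_nonneg_pos)
  have ne: "norm (e s) = 1" for s by (simp add: e_def)
  have w_le: "\<bar>w s\<bar> \<le> 1 / c" for s
  proof -
    have "\<bar>lam s\<bar> * c \<le> (lam s)\<^sup>2 + c\<^sup>2"
      using c sum_squares_bound[of "\<bar>lam s\<bar>" c] mult_nonneg_nonneg[of "\<bar>lam s\<bar>" c]
      by (simp only: power2_abs) linarith
    then have "\<bar>lam s\<bar> \<le> 1 / c * ((lam s)\<^sup>2 + c\<^sup>2)"
      using c by (simp add: pos_le_divide_eq)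
    then have "\<bar>lam s\<bar> / ((lam s)\<^sup>2 + c\<^sup>2) \<le> 1 / c"
      using pos by (intro mult_imp_div_pos_le)
    then show ?thesis using pos[of s] by (simp add: w_def abs_divide)
  qed
  have w'_le: "\<bar>w' s\<bar> \<le> V / c\<^sup>2" if "s \<in> {0..1}" for s
  proof -
    have "\<bar>w' s\<bar> = \<bar>lam' s\<bar> * \<bar>c\<^sup>2 - (lam s)\<^sup>2\<bar> / ((lam s)\<^sup>2 + c\<^sup>2)\<^sup>2"
      by (simp add: w'_def abs_mult abs_divide)
    also have "\<dots> \<le> V * ((lam s)\<^sup>2 + c\<^sup>2) / ((lam s)\<^sup>2 + c\<^sup>2)\<^sup>2"
      using lam'[OF that] V0 by (intro divide_right_mono mult_mono) (auto simp: abs_le_iff)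
    also have "\<dots> = V / ((lam s)\<^sup>2 + c\<^sup>2)" using pos[of s] by (simp add: power2_eq_square)
    also have "\<dots> \<le> V / c\<^sup>2" using V0 c by (intro divide_left_mono) (auto simp: add_nonneg_pos)
    finally show ?thesis .
  qed
  have de: "(e has_vector_derivative \<i> * of_real (lam s) * e s) (at s within {0..1})" if "s \<in> {0..1}" for s
  proof -
    have "((\<lambda>s. of_real (\<Phi> s)) has_vector_derivative complex_of_real (lam s)) (at s within {0..1})"
      by (rule bounded_linear.has_vector_derivative[OF bounded_linear_of_real])
        (use \<Phi>[OF that] in \<open>simp add: has_real_derivative_iff_has_vector_derivative\<close>)
    from has_vector_derivative_mult_right[OF this, of \<i>]
    have "((\<lambda>s. \<i> * of_real (\<Phi> s)) has_vector_derivative \<i> * of_real (lam s)) (at s within {0..1})" .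
    from field_vector_diff_chain_within[OF this, of exp]
    show ?thesis unfolding e_def o_def by (auto intro: DERIV_subset[OF DERIV_exp])
  qed
  have dw: "((\<lambda>s. complex_of_real (w s)) has_vector_derivative of_real (w' s)) (at s within {0..1})"
    if "s \<in> {0..1}" for s
  proof (rule bounded_linear.has_vector_derivative[OF bounded_linear_of_real])
    have "(w has_real_derivative (lam' s * ((lam s)\<^sup>2 + c\<^sup>2) - lam s * (2 * lam s * lam' s + 0))
        / (((lam s)\<^sup>2 + c\<^sup>2) * ((lam s)\<^sup>2 + c\<^sup>2))) (at s within {0..1})"
      unfolding w_def
      by (rule DERIV_divide[OF lam[OF that]] DERIV_add DERIV_const)+
        (use DERIV_power[OF lam[OF that], of 2] pos[of s] in \<open>auto simp: mult_ac\<close>)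
    moreover have "(lam' s * ((lam s)\<^sup>2 + c\<^sup>2) - lam s * (2 * lam s * lam' s + 0))
        / (((lam s)\<^sup>2 + c\<^sup>2) * ((lam s)\<^sup>2 + c\<^sup>2)) = w' s"
      unfolding w'_def power2_eq_square[of "(lam s)\<^sup>2 + c\<^sup>2"]
      by (rule arg_cong[where f = "\<lambda>x. x / _"]) (simp add: algebra_simps power2_eq_square)
    ultimately have "(w has_real_derivative w' s) (at s within {0..1})" by simp
    then show "(w has_vector_derivative w' s) (at s within {0..1})"
      by (simp add: has_real_derivative_iff_has_vector_derivative)
  qed
  \<comment> \<open>\<open>h1 + h2\<close> is the derivative of the boundary function
    \<open>H\<close>: \<open>h1\<close> comes from differentiating \<open>e\<close> and equals the
    integrand times \<open>lam * w = 1 - q\<close>, \<open>h2\<close> comes from the two slow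
    factors. In the final bound two of the three terms \<open>K / c\<close> are boundary values and
    the third is due to \<open>w * g'\<close>.\<close>
  define H where "H s = - \<i> * (e s * (of_real (w s) * g s))" for s
  define h1 where "h1 s = e s * of_real (lam s * w s) * g s" for s
  define h2 where "h2 s = - \<i> * e s * (of_real (w' s) * g s + of_real (w s) * g' s)" for s
  have "(H has_vector_derivative (h1 s + h2 s)) (at s within {0..1})" if "s \<in> {0..1}" for s
  proof -
    have "(H has_vector_derivative - \<i> * (e s * (of_real (w s) * g' s + of_real (w' s) * g s)
        + \<i> * of_real (lam s) * e s * (of_real (w s) * g s))) (at s within {0..1})"
      unfolding H_def
      by (intro has_vector_derivative_mult_right has_vector_derivative_mult de dw g that)
    then show ?thesis by (simp add: h1_def h2_def algebra_simps)
  qed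
  then have H: "((\<lambda>s. h1 s + h2 s) has_integral (H 1 - H 0)) {0..1}"
    by (intro fundamental_theorem_of_calculus) auto
  have conte: "continuous_on {0..1} e" and contg: "continuous_on {0..1} g" and contl: "continuous_on {0..1} lam"
    by (rule continuous_on_vector_derivative[OF de] continuous_on_vector_derivative[OF g]
        DERIV_continuous_on[OF lam]; assumption)+
  have eg: "(\<lambda>s. e s * g s) integrable_on {0..1}"
    by (intro integrable_continuous_real continuous_intros conte contg)
  have q_int: "q integrable_on {0..1}"
    unfolding q_def using pos by (intro integrable_continuous_real continuous_intros contl) (metis less_irrefl)
  have eq: "integral {0..1} (\<lambda>s. e s * g s)
      = (H 1 - H 0) + integral {0..1} (\<lambda>s. e s * g s - (h1 s + h2 s))"
    using integral_diff[OF eg has_integral_integrable[OF H]] integral_unique[OF H] by simp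
  have "norm (integral {0..1} (\<lambda>s. e s * g s - (h1 s + h2 s)))
      \<le> integral {0..1} (\<lambda>s. K * q s + (K * V / c\<^sup>2 + K / c))"
  proof (rule integral_norm_bound_integral)
    show "(\<lambda>s. e s * g s - (h1 s + h2 s)) integrable_on {0..1}"
      using eg has_integral_integrable[OF H] by (rule integrable_diff)
    show "(\<lambda>s. K * q s + (K * V / c\<^sup>2 + K / c)) integrable_on {0..1}"
      using integrable_on_mult_right[OF q_int, of K] by (intro integrable_add) auto
    fix s :: real assume s: "s \<in> {0..1}"
    have "1 - lam s * w s = q s"
    proof -
      have "(lam s)\<^sup>2 / ((lam s)\<^sup>2 + c\<^sup>2) + c\<^sup>2 / ((lam s)\<^sup>2 + c\<^sup>2) = 1"
        unfolding add_divide_distrib[symmetric] by (rule divide_self) (rule less_imp_neq[OF pos[of s], symmetric])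
      then show ?thesis by (simp add: w_def q_def power2_eq_square)
    qed
    then have "e s * g s - (h1 s + h2 s) = e s * of_real (q s) * g s - h2 s"
      by (simp add: h1_def algebra_simps flip: \<open>1 - lam s * w s = q s\<close>)
    also have "norm \<dots> \<le> norm (e s * of_real (q s) * g s) + norm (h2 s)" by (rule norm_triangle_ineq4)
    also have "norm (e s * of_real (q s) * g s) \<le> K * q s"
    proof -
      have "q s \<ge> 0" using pos[of s] by (simp add: q_def)
      then show ?thesis
        using mult_right_mono[OF K(1)[OF s], of "q s"] by (simp add: norm_mult ne mult.commute)
    qed
    also have "norm (h2 s) = norm (of_real (w' s) * g s + of_real (w s) * g' s)"
      unfolding h2_def norm_mult by (simp add: ne)
    also have "\<dots> \<le> norm (of_real (w' s) * g s) + norm (of_real (w s) * g' s)"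
      by (rule norm_triangle_ineq)
    also have "\<dots> \<le> V / c\<^sup>2 * K + 1 / c * K"
      unfolding norm_mult norm_of_real real_norm_def
      using w_le[of s] w'_le[OF s] K(1)[OF s] K(2)[OF s] V0 c by (intro add_mono mult_mono) auto
    finally show "norm (e s * g s - (h1 s + h2 s)) \<le> K * q s + (K * V / c\<^sup>2 + K / c)"
      by (simp add: mult.commute)
  qed
  also have "\<dots> = K * integral {0..1} q + (K * V / c\<^sup>2 + K / c)"
    using integrable_on_mult_right[OF q_int, of K] by (subst integral_add) auto
  finally have A: "norm (integral {0..1} (\<lambda>s. e s * g s - (h1 s + h2 s)))
      \<le> K * integral {0..1} q + (K * V / c\<^sup>2 + K / c)" .
  have Hb: "norm (H s) \<le> K / c" if "s \<in> {0..1}" for s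
  proof -
    have "norm (H s) = \<bar>w s\<bar> * norm (g s)" by (simp add: H_def norm_mult ne)
    also have "\<dots> \<le> 1 / c * K" using w_le[of s] K(1)[OF that] c by (intro mult_mono) auto
    finally show ?thesis by simp
  qed
  have "norm (integral {0..1} (\<lambda>s. e s * g s)) \<le> norm (H 1 - H 0) + (K * integral {0..1} q + (K * V / c\<^sup>2 + K / c))"
    unfolding eq by (rule norm_triangle_le) (use A in simp)
  also have "norm (H 1 - H 0) \<le> K / c + K / c"
    by (rule norm_triangle_le_diff) (intro add_mono Hb, auto)
  finally show ?thesis by (simp add: e_def q_def[abs_def])
qed

text \<open>With \<open>c = \<delta> * norm \<xi>\<close> the last term of
  \<open>oscillatory_integral_bound\<close> depends on the direction of \<open>\<xi>\<close> alone
  and is below \<open>\<epsilon> / 2\<close> by the choice of \<open>\<delta>\<close>; the other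
  terms add up to \<open>B / norm \<xi>\<close>. The amplitude enters through \<open>K\<close>
  alone, so one \<open>R\<close> serves a whole class of amplitudes.\<close>

lemma oscillatory_integral_small:
  fixes v v' :: "real \<Rightarrow> 'a::euclidean_space"
  assumes v: "\<And>s. s \<in> {0..1} \<Longrightarrow> (v has_vector_derivative v' s) (at s within {0..1})"
    and V: "\<And>s. s \<in> {0..1} \<Longrightarrow> norm (v' s) \<le> V"
    and zeros: "\<And>\<theta>. \<theta> \<noteq> 0 \<Longrightarrow> negligible {s \<in> {0..1}. \<theta> \<bullet> v s = 0}"
    and "\<epsilon> > 0" "K > 0"
  obtains R :: real where "R > 0"
    "\<And>\<xi> \<Phi> g g'. \<lbrakk>norm \<xi> \<ge> R;
       \<And>s. s \<in> {0..1} \<Longrightarrow> (\<Phi> has_real_derivative \<xi> \<bullet> v s) (at s within {0..1});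
       \<And>s. s \<in> {0..1} \<Longrightarrow> (g has_vector_derivative g' s) (at s within {0..1});
       \<And>s. s \<in> {0..1} \<Longrightarrow> norm (g s) \<le> K; \<And>s. s \<in> {0..1} \<Longrightarrow> norm (g' s) \<le> K\<rbrakk>
     \<Longrightarrow> norm (integral {0..1} (\<lambda>s. exp (\<i> * of_real (\<Phi> s)) * g s)) \<le> (\<epsilon>::real)"
proof -
  have contv: "continuous_on {0..1} v"
    using v by (rule continuous_on_vector_derivative)
  have V0: "V \<ge> 0" using V[of 0] norm_ge_zero[of "v' 0"] by (simp del: norm_ge_zero)
  have "\<epsilon> / (2 * K) > 0" using assms by simp
  then obtain \<delta> where \<delta>: "\<delta> > 0"
    "\<And>\<theta>. norm \<theta> = 1 \<Longrightarrow> integral {0..1} (\<lambda>s. \<delta>\<^sup>2 / ((\<theta> \<bullet> v s)\<^sup>2 + \<delta>\<^sup>2)) < \<epsilon> / (2 * K)"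
    using small_denominator_uniform[OF contv zeros] by metis
  define B where "B = 3 * K / \<delta> + K * V / \<delta>\<^sup>2"
  have B: "B > 0" using \<open>K > 0\<close> \<delta>(1) V0 unfolding B_def by (intro add_pos_nonneg) auto
  show ?thesis
  proof (rule that[of "2 * B / \<epsilon>"])
    show "2 * B / \<epsilon> > 0" using B \<open>\<epsilon> > 0\<close> by simp
    fix \<xi> \<Phi> and g g' :: "real \<Rightarrow> complex"
    assume \<xi>: "norm \<xi> \<ge> 2 * B / \<epsilon>"
      and \<Phi>: "\<And>s. s \<in> {0..1} \<Longrightarrow> (\<Phi> has_real_derivative \<xi> \<bullet> v s) (at s within {0..1})"
      and g: "\<And>s. s \<in> {0..1} \<Longrightarrow> (g has_vector_derivative g' s) (at s within {0..1})"
      and K: "\<And>s. s \<in> {0..1} \<Longrightarrow> norm (g s) \<le> K" "\<And>s. s \<in> {0..1} \<Longrightarrow> norm (g' s) \<le> K"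
    define N where "N = norm \<xi>"
    have N: "N > 0" using \<xi> B \<open>\<epsilon> > 0\<close> unfolding N_def by (meson divide_pos_pos less_le_trans mult_pos_pos zero_less_numeral)
    have c: "\<delta> * N > 0" using \<delta>(1) N by simp
    have "norm (integral {0..1} (\<lambda>s. exp (\<i> * of_real (\<Phi> s)) * g s))
      \<le> 3 * K / (\<delta> * N) + K * (N * V) / (\<delta> * N)\<^sup>2
        + K * integral {0..1} (\<lambda>s. (\<delta> * N)\<^sup>2 / ((\<xi> \<bullet> v s)\<^sup>2 + (\<delta> * N)\<^sup>2))"
    proof (rule oscillatory_integral_bound[where lam' = "\<lambda>s. \<xi> \<bullet> v' s", OF \<Phi> _ _ g K c])
      fix s :: real assume s: "s \<in> {0..1}"
      show "((\<lambda>s. \<xi> \<bullet> v s) has_real_derivative \<xi> \<bullet> v' s) (at s within {0..1})"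
        unfolding has_real_derivative_iff_has_vector_derivative
        by (rule bounded_linear.has_vector_derivative[OF bounded_linear_inner_right v[OF s]])
      have "\<bar>\<xi> \<bullet> v' s\<bar> \<le> norm \<xi> * norm (v' s)" by (rule Cauchy_Schwarz_ineq2)
      also have "\<dots> \<le> N * V" unfolding N_def by (intro mult_left_mono V s) auto
      finally show "\<bar>\<xi> \<bullet> v' s\<bar> \<le> N * V" .
    qed auto
    also have "(\<lambda>s. (\<delta> * N)\<^sup>2 / ((\<xi> \<bullet> v s)\<^sup>2 + (\<delta> * N)\<^sup>2))
        = (\<lambda>s. \<delta>\<^sup>2 / (((\<xi> /\<^sub>R N) \<bullet> v s)\<^sup>2 + \<delta>\<^sup>2))"
      using N \<delta>(1) by (auto simp: fun_eq_iff field_simps power_mult_distrib)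
    also have "K * integral {0..1} \<dots> \<le> \<epsilon> / 2"
    proof -
      have "norm (\<xi> /\<^sub>R N) = 1" using N by (simp add: N_def)
      from \<delta>(2)[OF this] show ?thesis using \<open>K > 0\<close> by (simp add: field_simps)
    qed
    also have "3 * K / (\<delta> * N) + K * (N * V) / (\<delta> * N)\<^sup>2 = B / N"
      using N \<delta>(1) by (simp add: B_def field_simps power2_eq_square)
    also have "B / N \<le> \<epsilon> / 2" using \<xi> N B \<open>\<epsilon> > 0\<close> by (simp add: N_def field_simps)
    finally show "norm (integral {0..1} (\<lambda>s. exp (\<i> * of_real (\<Phi> s)) * g s)) \<le> \<epsilon>" by simp
  qed
qed

section \<open>Fourier inversion\<close>

lemma lborel_integral_affine:
  fixes f :: "'a::euclidean_space \<Rightarrow> 'b::{banach, second_countable_topology}"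
  assumes [measurable]: "f \<in> borel_measurable borel" and "c > 0"
  shows "(\<integral>x. f x \<partial>lborel) = c ^ DIM('a) *\<^sub>R (\<integral>x. f (t + c *\<^sub>R x) \<partial>lborel)"
proof -
  have "(\<integral>x. f x \<partial>lborel) = (\<integral>x. f x \<partial>(density (distr lborel borel (\<lambda>x. t + c *\<^sub>R x)) (\<lambda>_. \<bar>c\<bar> ^ DIM('a))))"
    using lborel_affine[of c t] \<open>c > 0\<close> by simp
  also have "\<dots> = (\<integral>x. (\<bar>c\<bar> ^ DIM('a)) *\<^sub>R f x \<partial>distr lborel borel (\<lambda>x. t + c *\<^sub>R x))"
    using integral_density[of f "distr lborel borel (\<lambda>x. t + c *\<^sub>R x)" "\<lambda>_. \<bar>c\<bar> ^ DIM('a)"] by simp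
  also have "\<dots> = (\<bar>c\<bar> ^ DIM('a)) *\<^sub>R (\<integral>x. f (t + c *\<^sub>R x) \<partial>lborel)"
    by (subst integral_scaleR_right[symmetric]) (simp add: integral_distr)
  finally show ?thesis using \<open>c > 0\<close> by simp
qed

lemma lborel_integrable_affine:
  fixes f :: "'a::euclidean_space \<Rightarrow> 'b::{banach, second_countable_topology}"
  assumes f: "integrable lborel f" and "c > 0"
  shows "integrable lborel (\<lambda>x. f (t + c *\<^sub>R x))"
proof -
  have [measurable]: "f \<in> borel_measurable borel" using f by simp
  have "integrable (density (distr lborel borel (\<lambda>x. t + c *\<^sub>R x)) (\<lambda>_. ennreal (\<bar>c\<bar> ^ DIM('a)))) f"
    using f lborel_affine[of c t] \<open>c > 0\<close> by simp
  then have "integrable (distr lborel borel (\<lambda>x. t + c *\<^sub>R x)) (\<lambda>x. (\<bar>c\<bar> ^ DIM('a)) *\<^sub>R f x)"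
    by (subst (asm) integrable_density) auto
  then have "integrable lborel (\<lambda>x. (\<bar>c\<bar> ^ DIM('a)) *\<^sub>R f (t + c *\<^sub>R x))"
    by (subst (asm) integrable_distr_eq) auto
  from integrable_scaleR_right[OF this, of "inverse (\<bar>c\<bar> ^ DIM('a))"]
  show ?thesis using \<open>c > 0\<close> by simp
qed

lemma lborel_integral_prod:
  fixes f :: "'a::euclidean_space \<Rightarrow> real \<Rightarrow> 'b::{real_normed_field, banach, second_countable_topology}"
  assumes f: "\<And>b. b \<in> Basis \<Longrightarrow> integrable lborel (f b)"
  shows "integrable lborel (\<lambda>x. \<Prod>b\<in>Basis. f b (x \<bullet> b))"
    and "(\<integral>x. (\<Prod>b\<in>Basis. f b (x \<bullet> b)) \<partial>lborel) = (\<Prod>b\<in>Basis. \<integral>x. f b x \<partial>lborel)"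
proof -
  interpret product_sigma_finite "\<lambda>_::'a. lborel :: real measure" ..
  have [measurable]: "b \<in> Basis \<Longrightarrow> f b \<in> borel_measurable borel" for b
    using borel_measurable_integrable[OF f[of b]] by simp
  have eq: "(\<Prod>b\<in>Basis. f b ((\<Sum>b'\<in>Basis. x b' *\<^sub>R b') \<bullet> b)) = (\<Prod>b\<in>Basis. f b (x b))" for x
    by (intro prod.cong) auto
  have int: "integrable (Pi\<^sub>M Basis (\<lambda>_. lborel)) (\<lambda>x. \<Prod>b\<in>Basis. f b (x b))"
    by (rule product_integrable_prod) (auto intro: f)
  then show "integrable lborel (\<lambda>x. \<Prod>b\<in>Basis. f b (x \<bullet> b))"
    by (subst lborel_eq, subst integrable_distr_eq) (auto simp: eq)
  show "(\<integral>x. (\<Prod>b\<in>Basis. f b (x \<bullet> b)) \<partial>lborel) = (\<Prod>b\<in>Basis. \<integral>x. f b x \<partial>lborel)"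
    by (subst lborel_eq, subst integral_distr) (auto simp: eq product_integral_prod f)
qed

section \<open>The Gaussian kernel and its Fourier transform\<close>

definition gauss :: "'a::euclidean_space \<Rightarrow> real" where
  "gauss x = exp (- (norm x)\<^sup>2 / 2) / sqrt (2 * pi) ^ DIM('a)"

lemma gauss_measurable [measurable]: "gauss \<in> borel_measurable borel"
  unfolding gauss_def by measurable

lemma gauss_nonneg: "gauss x \<ge> 0"
  by (simp add: gauss_def)

lemma gauss_eq_prod: "gauss x = (\<Prod>b\<in>Basis. std_normal_density (x \<bullet> b))"
proof -
  have "(norm x)\<^sup>2 = (\<Sum>b\<in>Basis. (x \<bullet> b)\<^sup>2)"
    by (subst power2_norm_eq_inner, subst euclidean_inner) (simp add: power2_eq_square)
  then have "exp (- (norm x)\<^sup>2 / 2) = (\<Prod>b\<in>Basis. exp (- (x \<bullet> b)\<^sup>2 / 2))"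
    by (simp add: exp_sum[symmetric] sum_negf sum_divide_distrib)
  then show ?thesis
    by (simp add: gauss_def std_normal_density_def prod.distrib prod_dividef)
qed

lemma integrable_std_normal_density: "integrable lborel std_normal_density"
  by (rule integrable_normal_density) simp

lemma integrable_gauss: "integrable lborel (gauss :: 'a::euclidean_space \<Rightarrow> real)"
  unfolding gauss_eq_prod[abs_def]
  by (intro lborel_integral_prod(1) integrable_std_normal_density)

lemma integral_gauss: "(\<integral>x. gauss (x::'a::euclidean_space) \<partial>lborel) = 1"
  unfolding gauss_eq_prod
  by (subst lborel_integral_prod(2)) (simp_all add: integrable_std_normal_density integral_normal_density)

lemma fourier_gauss:
  fixes u :: "'a::euclidean_space"
  shows "(\<integral>x. iexp (u \<bullet> x) * of_real (gauss x) \<partial>lborel) = of_real (exp (- (norm u)\<^sup>2 / 2))"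
proof -
  have one: "integrable lborel (\<lambda>x. iexp (t * x) * of_real (std_normal_density x))" for t
    by (rule Bochner_Integration.integrable_bound[OF integrable_std_normal_density]) (auto simp: norm_mult)
  have two: "(\<integral>x. iexp (t * x) * of_real (std_normal_density x) \<partial>lborel) = of_real (exp (- t\<^sup>2 / 2))" for t
  proof -
    have "char std_normal_distribution t = (\<integral>x. std_normal_density x *\<^sub>R iexp (t * x) \<partial>lborel)"
      unfolding char_def by (subst integral_density) (auto simp: normal_density_nonneg)
    then show ?thesis
      by (simp add: char_std_normal_distribution scaleR_conv_of_real mult.commute)
  qed
  have "(\<integral>x. iexp (u \<bullet> x) * of_real (gauss x) \<partial>lborel)
    = (\<integral>x. (\<Prod>b\<in>Basis. iexp ((u \<bullet> b) * (x \<bullet> b)) * of_real (std_normal_density (x \<bullet> b))) \<partial>lborel)"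
  proof (rule Bochner_Integration.integral_cong[OF refl])
    fix x :: 'a
    have "iexp (u \<bullet> x) = (\<Prod>b\<in>Basis. iexp ((u \<bullet> b) * (x \<bullet> b)))"
      by (subst euclidean_inner) (simp add: exp_sum[symmetric] sum_distrib_left)
    then show "iexp (u \<bullet> x) * of_real (gauss x)
        = (\<Prod>b\<in>Basis. iexp ((u \<bullet> b) * (x \<bullet> b)) * of_real (std_normal_density (x \<bullet> b)))"
      by (simp add: gauss_eq_prod prod.distrib)
  qed
  also have "\<dots> = (\<Prod>b\<in>Basis. of_real (exp (- (u \<bullet> b)\<^sup>2 / 2)))"
    by (subst lborel_integral_prod(2)) (auto simp only: one two)
  also have "\<dots> = of_real (exp (- (norm u)\<^sup>2 / 2))"
  proof -
    have "(norm u)\<^sup>2 = (\<Sum>b\<in>Basis. (u \<bullet> b)\<^sup>2)"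
      by (subst power2_norm_eq_inner, subst euclidean_inner) (simp add: power2_eq_square)
    then show ?thesis
      by (simp add: exp_sum[symmetric] sum_negf sum_divide_distrib flip: of_real_prod)
  qed
  finally show ?thesis .
qed

lemma fourier_gauss_scaled:
  fixes u :: "'a::euclidean_space"
  assumes h: "h > 0"
  shows "(\<integral>\<xi>. iexp (u \<bullet> \<xi>) * of_real (exp (- (norm (h *\<^sub>R \<xi>))\<^sup>2 / 2)) \<partial>lborel)
    = of_real ((2 * pi / h) ^ DIM('a) * gauss (u /\<^sub>R h))"
proof -
  have "(\<integral>\<xi>. iexp (u \<bullet> \<xi>) * of_real (exp (- (norm (h *\<^sub>R \<xi>))\<^sup>2 / 2)) \<partial>lborel)
    = (1 / h) ^ DIM('a) *\<^sub>R (\<integral>\<xi>. iexp (u \<bullet> (0 + (1 / h) *\<^sub>R \<xi>)) * of_real (exp (- (norm (h *\<^sub>R (0 + (1 / h) *\<^sub>R \<xi>)))\<^sup>2 / 2)) \<partial>lborel)"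
    by (rule lborel_integral_affine) (use h in auto)
  also have "(\<lambda>\<xi>. iexp (u \<bullet> (0 + (1 / h) *\<^sub>R \<xi>)) * complex_of_real (exp (- (norm (h *\<^sub>R (0 + (1 / h) *\<^sub>R \<xi>)))\<^sup>2 / 2)))
    = (\<lambda>\<xi>. of_real (sqrt (2 * pi) ^ DIM('a)) * (iexp ((u /\<^sub>R h) \<bullet> \<xi>) * of_real (gauss \<xi>)))"
  proof
    fix \<xi> :: 'a
    have 1: "h *\<^sub>R (0 + (1 / h) *\<^sub>R \<xi>) = \<xi>" "u \<bullet> (0 + (1 / h) *\<^sub>R \<xi>) = (u /\<^sub>R h) \<bullet> \<xi>"
      using h by (simp_all add: divide_inverse)
    have 2: "exp (- (norm \<xi>)\<^sup>2 / 2) = sqrt (2 * pi) ^ DIM('a) * gauss \<xi>"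
      by (simp add: gauss_def)
    show "iexp (u \<bullet> (0 + (1 / h) *\<^sub>R \<xi>)) * complex_of_real (exp (- (norm (h *\<^sub>R (0 + (1 / h) *\<^sub>R \<xi>)))\<^sup>2 / 2))
        = of_real (sqrt (2 * pi) ^ DIM('a)) * (iexp ((u /\<^sub>R h) \<bullet> \<xi>) * of_real (gauss \<xi>))"
      unfolding 1 2 of_real_mult by (rule mult.left_commute)
  qed
  also have "(\<integral>\<xi>. \<dots> \<xi> \<partial>lborel) = of_real (sqrt (2 * pi) ^ DIM('a)) * of_real (exp (- (norm (u /\<^sub>R h))\<^sup>2 / 2))"
    by (simp only: integral_mult_right_zero fourier_gauss)
  also have "\<dots> = of_real (sqrt (2 * pi) ^ DIM('a) * (sqrt (2 * pi) ^ DIM('a) * gauss (u /\<^sub>R h)))"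
    by (simp add: gauss_def)
  also have "\<dots> = of_real ((2 * pi) ^ DIM('a) * gauss (u /\<^sub>R h))"
  proof -
    have "sqrt (2 * pi) ^ DIM('a) * sqrt (2 * pi) ^ DIM('a) = (2 * pi) ^ DIM('a)"
      unfolding power_mult_distrib[symmetric] by simp
    then show ?thesis by (simp only: mult.assoc[symmetric])
  qed
  finally show ?thesis by (simp add: scaleR_conv_of_real power_divide)
qed

lemma integrable_gauss_exp:
  assumes "h > 0"
  shows "integrable lborel (\<lambda>\<xi>::'a::euclidean_space. exp (- (norm (h *\<^sub>R \<xi>))\<^sup>2 / 2))"
proof -
  have "integrable lborel (\<lambda>\<xi>::'a. sqrt (2 * pi) ^ DIM('a) * gauss (0 + h *\<^sub>R \<xi>))"
    by (intro integrable_mult_right lborel_integrable_affine integrable_gauss assms)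
  then show ?thesis by (simp add: gauss_def)
qed

section \<open>Differentiability of inverse Fourier transforms\<close>

text \<open>The real part is taken under the integral so that densities are real-valued by
  construction; for integrable characteristic functions of measures the discarded part cancels
  between \<open>\<xi>\<close> and \<open>- \<xi>\<close>.\<close>

definition inv_fourier :: "('a::euclidean_space \<Rightarrow> complex) \<Rightarrow> 'a \<Rightarrow> real" where
  "inv_fourier \<psi> x = (\<integral>\<xi>. Re (iexp (- (\<xi> \<bullet> x)) * \<psi> \<xi>) \<partial>lborel) / (2 * pi) ^ DIM('a)"

lemma abs_Re_iexp_mult_le: "\<bar>Re (iexp t * z)\<bar> \<le> norm z"
  using abs_Re_le_cmod[of "iexp t * z"] by (simp add: norm_mult)

lemma integrable_fourier_integrand:
  fixes h :: "'a::euclidean_space \<Rightarrow> complex"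
  assumes h: "integrable lborel h"
  shows "integrable lborel (\<lambda>\<xi>. Re (iexp (- (\<xi> \<bullet> x)) * h \<xi>))"
proof (rule Bochner_Integration.integrable_bound[OF h])
  have [measurable]: "h \<in> borel_measurable borel" using h by simp
  show "(\<lambda>\<xi>. Re (iexp (- (\<xi> \<bullet> x)) * h \<xi>)) \<in> borel_measurable lborel" by measurable
qed (intro AE_I2, simp only: real_norm_def abs_Re_iexp_mult_le)

lemma continuous_on_inv_fourier:
  fixes h :: "'a::euclidean_space \<Rightarrow> complex"
  assumes h: "integrable lborel h"
  shows "continuous_on UNIV (inv_fourier h)"
proof (rule continuous_on_sequentiallyI)
  fix u and a :: 'a assume u: "u \<longlonglongrightarrow> a"
  have [measurable]: "h \<in> borel_measurable borel" using h by simp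
  have "(\<lambda>n. \<integral>\<xi>. Re (iexp (- (\<xi> \<bullet> u n)) * h \<xi>) \<partial>lborel) \<longlonglongrightarrow> (\<integral>\<xi>. Re (iexp (- (\<xi> \<bullet> a)) * h \<xi>) \<partial>lborel)"
  proof (rule integral_dominated_convergence[where w = "\<lambda>\<xi>. norm (h \<xi>)"])
    show "AE \<xi> in lborel. (\<lambda>n. Re (iexp (- (\<xi> \<bullet> u n)) * h \<xi>)) \<longlonglongrightarrow> Re (iexp (- (\<xi> \<bullet> a)) * h \<xi>)"
      by (intro AE_I2 tendsto_intros u)
    show "AE \<xi> in lborel. norm (Re (iexp (- (\<xi> \<bullet> u n)) * h \<xi>)) \<le> norm (h \<xi>)" for n
      by (intro AE_I2) (simp only: real_norm_def abs_Re_iexp_mult_le)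
  qed (use h in auto)
  then show "(\<lambda>n. inv_fourier h (u n)) \<longlonglongrightarrow> inv_fourier h a"
    unfolding inv_fourier_def by (rule tendsto_divide) auto
qed

lemma has_derivative_inv_fourier:
  fixes h :: "'a::euclidean_space \<Rightarrow> complex"
  assumes h: "integrable lborel h" and h1: "integrable lborel (\<lambda>\<xi>. norm \<xi> * norm (h \<xi>))"
  shows "(inv_fourier h has_derivative (\<lambda>v. inv_fourier (\<lambda>\<xi>. - \<i> * of_real (\<xi> \<bullet> v) * h \<xi>) x)) (at x)"
proof -
  have [measurable]: "h \<in> borel_measurable borel" using h by simp
  define D where "D v \<xi> = Re (iexp (- (\<xi> \<bullet> x)) * (- \<i> * of_real (\<xi> \<bullet> v) * h \<xi>))" for v \<xi>
  have [measurable]: "D v \<in> borel_measurable borel" for v unfolding D_def by measurable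
  have Dint: "integrable lborel (D v)" for v
    unfolding D_def
  proof (rule integrable_fourier_integrand, rule Bochner_Integration.integrable_bound)
    show "integrable lborel (\<lambda>\<xi>. norm v * (norm \<xi> * norm (h \<xi>)))" by (intro integrable_mult_right h1)
    show "AE \<xi> in lborel. norm (- \<i> * of_real (\<xi> \<bullet> v) * h \<xi>) \<le> norm (norm v * (norm \<xi> * norm (h \<xi>)))"
    proof (rule AE_I2)
      fix \<xi>
      have "\<bar>\<xi> \<bullet> v\<bar> * norm (h \<xi>) \<le> (norm \<xi> * norm v) * norm (h \<xi>)"
        by (intro mult_right_mono Cauchy_Schwarz_ineq2) auto
      then show "norm (- \<i> * of_real (\<xi> \<bullet> v) * h \<xi>) \<le> norm (norm v * (norm \<xi> * norm (h \<xi>)))"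
        by (simp add: norm_mult abs_mult mult_ac)
    qed
  qed measurable
  define F where "F y = (\<integral>\<xi>. Re (iexp (- (\<xi> \<bullet> y)) * h \<xi>) \<partial>lborel)" for y
  define F' where "F' v = (\<integral>\<xi>. D v \<xi> \<partial>lborel)" for v
  have lin: "linear F'"
  proof (rule linearI)
    fix v w :: 'a and c :: real
    have "D (v + w) = (\<lambda>\<xi>. D v \<xi> + D w \<xi>)" "D (c *\<^sub>R v) = (\<lambda>\<xi>. c * D v \<xi>)"
      by (simp_all add: fun_eq_iff D_def inner_add_right algebra_simps)
    then show "F' (v + w) = F' v + F' w" "F' (c *\<^sub>R v) = c *\<^sub>R F' v"
      unfolding F'_def by (simp_all add: Dint)
  qed
  define Q where "Q v \<xi> = (Re (iexp (- (\<xi> \<bullet> (x + v))) * h \<xi>) - Re (iexp (- (\<xi> \<bullet> x)) * h \<xi>) - D v \<xi>) /\<^sub>R norm v" for v \<xi>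
  have Q_eq: "(F (x + v) - F x - F' v) /\<^sub>R norm v = (\<integral>\<xi>. Q v \<xi> \<partial>lborel)" for v
    unfolding F_def F'_def Q_def
    by (simp only: integral_scaleR_right Bochner_Integration.integral_diff
        integrable_fourier_integrand[OF h] Dint Bochner_Integration.integrable_diff)
  have Q_re: "(Re (iexp (- (\<xi> \<bullet> (x + v))) * h \<xi>) - Re (iexp (- (\<xi> \<bullet> x)) * h \<xi>) - D v \<xi>)
      = Re (iexp (- (\<xi> \<bullet> x)) * ((iexp (- (\<xi> \<bullet> v)) - (1 + \<i> * of_real (- (\<xi> \<bullet> v)))) * h \<xi>))" for v \<xi>
    by (simp add: D_def inner_add_right exp_add algebra_simps exp_diff exp_minus divide_inverse)
  have Q_le: "\<bar>Q v \<xi>\<bar> \<le> inverse (norm v) * (norm (iexp (- (\<xi> \<bullet> v)) - (1 + \<i> * of_real (- (\<xi> \<bullet> v)))) * norm (h \<xi>))" for v \<xi>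
  proof -
    have "\<bar>Q v \<xi>\<bar> = inverse (norm v) * \<bar>Re (iexp (- (\<xi> \<bullet> x)) * ((iexp (- (\<xi> \<bullet> v)) - (1 + \<i> * of_real (- (\<xi> \<bullet> v)))) * h \<xi>))\<bar>"
      unfolding Q_def Q_re by (simp only: real_scaleR_def abs_mult abs_inverse abs_norm_cancel)
    also have "\<dots> \<le> inverse (norm v) * norm ((iexp (- (\<xi> \<bullet> v)) - (1 + \<i> * of_real (- (\<xi> \<bullet> v)))) * h \<xi>)"
      by (intro mult_left_mono abs_Re_iexp_mult_le) auto
    finally show ?thesis by (simp only: norm_mult)
  qed
  \<comment> \<open>Two bounds for the same quotient: this one is uniform in \<open>v\<close> and
    serves as the integrable majorant; the quadratic one below gives the pointwise limit, and its
    factor \<open>(norm \<xi>)\<^sup>2\<close> is never integrated.\<close>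
  have Q1: "\<bar>Q v \<xi>\<bar> \<le> 2 * (norm \<xi> * norm (h \<xi>))" for v \<xi>
  proof (cases "v = 0")
    case False
    have "norm (iexp t - (1 + \<i> * of_real t)) \<le> 2 * \<bar>t\<bar>" for t
    proof -
      have "norm (iexp t - 1) \<le> \<bar>t\<bar>" using iexp_approx1[of t 0] by simp
      then show ?thesis using norm_triangle_ineq4[of "iexp t - 1" "\<i> * of_real t"]
        by (simp add: norm_mult diff_diff_eq)
    qed
    then have "norm (iexp (- (\<xi> \<bullet> v)) - (1 + \<i> * of_real (- (\<xi> \<bullet> v)))) \<le> 2 * \<bar>- (\<xi> \<bullet> v)\<bar>" .
    also have "\<dots> \<le> 2 * (norm \<xi> * norm v)" using Cauchy_Schwarz_ineq2[of \<xi> v] by simp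
    finally have "inverse (norm v) * (norm (iexp (- (\<xi> \<bullet> v)) - (1 + \<i> * of_real (- (\<xi> \<bullet> v)))) * norm (h \<xi>))
        \<le> inverse (norm v) * (2 * (norm \<xi> * norm v) * norm (h \<xi>))"
      by (intro mult_left_mono mult_right_mono) auto
    also have "\<dots> = 2 * (norm \<xi> * norm (h \<xi>))" using False by simp
    finally show ?thesis using Q_le[of v \<xi>] by linarith
  qed (simp add: Q_def)
  have Q2: "\<bar>Q v \<xi>\<bar> \<le> norm v * ((norm \<xi>)\<^sup>2 * norm (h \<xi>))" for v \<xi>
  proof (cases "v = 0")
    case False
    have "norm (iexp t - (1 + \<i> * of_real t)) \<le> t\<^sup>2" for t
    proof -
      have "norm (iexp t - (1 + \<i> * of_real t)) \<le> t\<^sup>2 / 2" using iexp_approx1[of t 1] by (simp add: power2_eq_square)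
      then show ?thesis using zero_le_power2[of t] by linarith
    qed
    then have "norm (iexp (- (\<xi> \<bullet> v)) - (1 + \<i> * of_real (- (\<xi> \<bullet> v)))) \<le> (- (\<xi> \<bullet> v))\<^sup>2" .
    also have "\<dots> = \<bar>\<xi> \<bullet> v\<bar>\<^sup>2" by simp
    also have "\<dots> \<le> (norm \<xi> * norm v)\<^sup>2" by (intro power_mono Cauchy_Schwarz_ineq2) auto
    finally have "inverse (norm v) * (norm (iexp (- (\<xi> \<bullet> v)) - (1 + \<i> * of_real (- (\<xi> \<bullet> v)))) * norm (h \<xi>))
        \<le> inverse (norm v) * ((norm \<xi> * norm v)\<^sup>2 * norm (h \<xi>))"
      by (intro mult_left_mono mult_right_mono) auto
    also have "\<dots> = norm v * ((norm \<xi>)\<^sup>2 * norm (h \<xi>))" using False by (simp add: power2_eq_square)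
    finally show ?thesis using Q_le[of v \<xi>] by linarith
  qed (simp add: Q_def)
  have "((\<lambda>v. \<integral>\<xi>. Q v \<xi> \<partial>lborel) \<longlongrightarrow> 0) (at 0)"
  proof (subst tendsto_at_iff_sequentially, intro allI impI)
    fix X :: "nat \<Rightarrow> 'a" assume X: "\<forall>i. X i \<in> UNIV - {0}" "X \<longlonglongrightarrow> 0"
    have "(\<lambda>n. \<integral>\<xi>. Q (X n) \<xi> \<partial>lborel) \<longlonglongrightarrow> (\<integral>\<xi>. (0::real) \<partial>(lborel :: 'a measure))"
    proof (rule integral_dominated_convergence[where w = "\<lambda>\<xi>. 2 * (norm \<xi> * norm (h \<xi>))"])
      show "AE \<xi> in lborel. (\<lambda>n. Q (X n) \<xi>) \<longlonglongrightarrow> 0"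
      proof (rule AE_I2)
        fix \<xi>
        have "(\<lambda>n. norm (X n) * ((norm \<xi>)\<^sup>2 * norm (h \<xi>))) \<longlonglongrightarrow> norm (0::'a) * ((norm \<xi>)\<^sup>2 * norm (h \<xi>))"
          by (intro tendsto_intros X)
        then have "(\<lambda>n. norm (X n) * ((norm \<xi>)\<^sup>2 * norm (h \<xi>))) \<longlonglongrightarrow> 0" by simp
        then show "(\<lambda>n. Q (X n) \<xi>) \<longlonglongrightarrow> 0"
          by (rule Lim_null_comparison[rotated]) (auto simp: Q2)
      qed
    qed (use h1 Q1 in \<open>auto simp: Q_def\<close>)
    then show "((\<lambda>v. \<integral>\<xi>. Q v \<xi> \<partial>lborel) \<circ> X) \<longlonglongrightarrow> 0" by (simp add: o_def)
  qed
  then have "((\<lambda>v. norm (\<integral>\<xi>. Q v \<xi> \<partial>lborel)) \<longlongrightarrow> 0) (at 0)"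
    by (rule tendsto_norm_zero)
  moreover have "norm (\<integral>\<xi>. Q v \<xi> \<partial>lborel) = norm (F (x + v) - F x - F' v) / norm v" for v
    unfolding Q_eq[symmetric] by (simp add: divide_inverse mult.commute abs_mult)
  ultimately have "(F has_derivative F') (at x)"
    unfolding has_derivative_at using lin by (simp add: linear_conv_bounded_linear)
  then have "((\<lambda>y. F y / (2 * pi) ^ DIM('a)) has_derivative (\<lambda>v. F' v / (2 * pi) ^ DIM('a))) (at x)"
    by (rule bounded_linear.has_derivative[OF bounded_linear_divide])
  then show ?thesis by (simp only: F_def F'_def D_def inv_fourier_def[abs_def])
qed

text \<open>Each derivative brings down a factor \<open>- \<i> * (\<xi> \<bullet> v)\<close> and so
  uses up one power of the weight.\<close>

lemma C_k_inv_fourier: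
  fixes h :: "real^'d \<Rightarrow> complex"
  assumes "h \<in> borel_measurable borel" "integrable lborel (\<lambda>\<xi>. (1 + norm \<xi>) ^ k * norm (h \<xi>))"
  shows "C_k k (inv_fourier h)"
  using assms
proof (induction k arbitrary: h)
  case 0
  then have "integrable lborel h" by (simp add: integrable_norm_iff)
  then show ?case by (simp add: continuous_on_inv_fourier)
next
  case (Suc k)
  note [measurable] = Suc.prems(1)
  have int: "integrable lborel h" "integrable lborel (\<lambda>\<xi>. norm \<xi> * norm (h \<xi>))"
  proof -
    have "1 * norm (h \<xi>) \<le> (1 + norm \<xi>) ^ Suc k * norm (h \<xi>)" for \<xi>
      by (intro mult_right_mono one_le_power) auto
    then show "integrable lborel h"
      by (intro Bochner_Integration.integrable_bound[OF Suc.prems(2)]) auto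
    have "norm \<xi> * norm (h \<xi>) \<le> (1 + norm \<xi>) ^ Suc k * norm (h \<xi>)" for \<xi>
    proof (rule mult_right_mono)
      have "norm \<xi> \<le> (1 + norm \<xi>) ^ 1" by simp
      also have "\<dots> \<le> (1 + norm \<xi>) ^ Suc k" by (rule power_increasing) auto
      finally show "norm \<xi> \<le> (1 + norm \<xi>) ^ Suc k" .
    qed auto
    then show "integrable lborel (\<lambda>\<xi>. norm \<xi> * norm (h \<xi>))"
      by (intro Bochner_Integration.integrable_bound[OF Suc.prems(2)]) (auto simp: abs_mult)
  qed
  have C: "C_k k (inv_fourier (\<lambda>\<xi>. - \<i> * of_real (\<xi> \<bullet> v) * h \<xi>))" for v
  proof (rule Suc.IH)
    show "integrable lborel (\<lambda>\<xi>. (1 + norm \<xi>) ^ k * norm (- \<i> * of_real (\<xi> \<bullet> v) * h \<xi>))"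
    proof (rule Bochner_Integration.integrable_bound[OF integrable_mult_right[OF Suc.prems(2), of "norm v"]])
      show "AE \<xi> in lborel. norm ((1 + norm \<xi>) ^ k * norm (- \<i> * of_real (\<xi> \<bullet> v) * h \<xi>))
          \<le> norm (norm v * ((1 + norm \<xi>) ^ Suc k * norm (h \<xi>)))"
      proof (rule AE_I2)
        fix \<xi>
        have "\<bar>\<xi> \<bullet> v\<bar> \<le> norm \<xi> * norm v" by (rule Cauchy_Schwarz_ineq2)
        also have "\<dots> \<le> (1 + norm \<xi>) * norm v" by (intro mult_right_mono) auto
        finally have "(1 + norm \<xi>) ^ k * (\<bar>\<xi> \<bullet> v\<bar> * norm (h \<xi>)) \<le> (1 + norm \<xi>) ^ k * (((1 + norm \<xi>) * norm v) * norm (h \<xi>))"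
          by (intro mult_left_mono mult_right_mono) auto
        then show "norm ((1 + norm \<xi>) ^ k * norm (- \<i> * of_real (\<xi> \<bullet> v) * h \<xi>))
          \<le> norm (norm v * ((1 + norm \<xi>) ^ Suc k * norm (h \<xi>)))"
          by (simp add: norm_mult abs_mult mult_ac)
      qed
    qed measurable
  qed measurable
  have "frechet_derivative (inv_fourier h) (at x) = (\<lambda>v. inv_fourier (\<lambda>\<xi>. - \<i> * of_real (\<xi> \<bullet> v) * h \<xi>) x)" for x
    using has_derivative_inv_fourier[OF int] by (rule frechet_derivative_at[symmetric])
  moreover have "inv_fourier h differentiable (at x)" for x
    using has_derivative_inv_fourier[OF int] by (rule differentiableI)
  ultimately show ?case using C by simp
qed

section \<open>Inversion formula for finite measures\<close>

definition cfun :: "'a::euclidean_space measure \<Rightarrow> 'a \<Rightarrow> complex" where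
  "cfun \<nu> \<xi> = (\<integral>x. iexp (\<xi> \<bullet> x) \<partial>\<nu>)"

locale finite_borel = finite_measure \<nu> for \<nu> :: "'a::euclidean_space measure" +
  assumes sets_eq [measurable_cong]: "sets \<nu> = sets borel"
begin

lemma space_eq [simp]: "space \<nu> = UNIV"
  using sets_eq_imp_space_eq[OF sets_eq] by simp

lemma cfun_measurable [measurable]: "cfun \<nu> \<in> borel_measurable borel"
  unfolding cfun_def by measurable

lemma norm_cfun_le: "norm (cfun \<nu> \<xi>) \<le> measure \<nu> UNIV"
proof -
  have "norm (cfun \<nu> \<xi>) \<le> (\<integral>x. norm (iexp (\<xi> \<bullet> x)) \<partial>\<nu>)"
    unfolding cfun_def by (rule integral_norm_bound)
  then show ?thesis by simp
qed

text \<open>The Gaussian factor makes the double integral absolutely convergent for any finite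
  measure, so Fubini applies; the outcome is the convolution of \<open>\<nu>\<close> with a Gaussian
  of width \<open>h\<close>.\<close>

lemma inv_fourier_smoothed:
  assumes h: "h > 0"
  shows "inv_fourier (\<lambda>\<xi>. cfun \<nu> \<xi> * of_real (exp (- (norm (h *\<^sub>R \<xi>))\<^sup>2 / 2))) x
    = (\<integral>y. gauss ((x - y) /\<^sub>R h) / h ^ DIM('a) \<partial>\<nu>)"
proof -
  define e where "e \<xi> = exp (- (norm (h *\<^sub>R \<xi>))\<^sup>2 / 2)" for \<xi> :: 'a
  have [measurable]: "e \<in> borel_measurable borel" unfolding e_def by measurable
  have e: "integrable lborel e" unfolding e_def by (rule integrable_gauss_exp[OF h])
  have e0: "e \<xi> \<ge> 0" for \<xi> by (simp add: e_def)
  interpret P: pair_sigma_finite lborel \<nu> ..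
  define F where "F \<xi> y = iexp ((y - x) \<bullet> \<xi>) * of_real (e \<xi>)" for \<xi> y
  have int: "integrable (lborel \<Otimes>\<^sub>M \<nu>) (case_prod F)"
  proof (rule P.Fubini_integrable)
    show "case_prod F \<in> borel_measurable (lborel \<Otimes>\<^sub>M \<nu>)" unfolding F_def by measurable
    show "integrable lborel (\<lambda>\<xi>. \<integral>y. norm (case_prod F (\<xi>, y)) \<partial>\<nu>)"
      using e by (simp add: F_def norm_mult e0)
    show "AE \<xi> in lborel. integrable \<nu> (\<lambda>y. case_prod F (\<xi>, y))"
      unfolding F_def by (intro AE_I2 integrable_const_bound[where B = "e _"]) (auto simp: norm_mult e0)
  qed
  have eq: "iexp (- (\<xi> \<bullet> x)) * (cfun \<nu> \<xi> * of_real (e \<xi>)) = (\<integral>y. F \<xi> y \<partial>\<nu>)" for \<xi>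
  proof -
    have "(\<integral>y. F \<xi> y \<partial>\<nu>) = (\<integral>y. (iexp (- (\<xi> \<bullet> x)) * of_real (e \<xi>)) * iexp (\<xi> \<bullet> y) \<partial>\<nu>)"
      by (intro Bochner_Integration.integral_cong)
        (auto simp: F_def inner_diff_left inner_commute algebra_simps simp flip: exp_add)
    then show ?thesis by (simp add: cfun_def)
  qed
  have "(\<integral>\<xi>. Re (iexp (- (\<xi> \<bullet> x)) * (cfun \<nu> \<xi> * of_real (e \<xi>))) \<partial>lborel)
      = Re (\<integral>\<xi>. (\<integral>y. F \<xi> y \<partial>\<nu>) \<partial>lborel)"
    unfolding eq by (rule integral_Re[OF P.integrable_fst'[OF int, simplified]])
  also have "(\<integral>\<xi>. (\<integral>y. F \<xi> y \<partial>\<nu>) \<partial>lborel) = (\<integral>y. (\<integral>\<xi>. F \<xi> y \<partial>lborel) \<partial>\<nu>)"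
    by (rule P.Fubini_integral[OF int, symmetric])
  also have "\<dots> = (\<integral>y. of_real ((2 * pi / h) ^ DIM('a) * gauss ((y - x) /\<^sub>R h)) \<partial>\<nu>)"
    unfolding F_def e_def fourier_gauss_scaled[OF h] ..
  also have "\<dots> = of_real (\<integral>y. (2 * pi / h) ^ DIM('a) * gauss ((y - x) /\<^sub>R h) \<partial>\<nu>)"
    by (rule integral_complex_of_real)
  finally have "inv_fourier (\<lambda>\<xi>. cfun \<nu> \<xi> * of_real (e \<xi>)) x
      = (\<integral>y. (2 * pi / h) ^ DIM('a) * gauss ((y - x) /\<^sub>R h) \<partial>\<nu>) / (2 * pi) ^ DIM('a)"
    unfolding inv_fourier_def by simp
  also have "\<dots> = (\<integral>y. gauss ((x - y) /\<^sub>R h) / h ^ DIM('a) \<partial>\<nu>)"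
    by (subst integral_divide_zero[symmetric])
      (simp add: gauss_def power_divide norm_minus_commute)
  finally show ?thesis unfolding e_def .
qed

text \<open>Compact generators fit \<open>integral_test_function\<close>, whose test functions
  vanish outside a ball.\<close>

lemma sets_borel_compact: "sets (borel :: 'b::heine_borel measure) = sigma_sets UNIV (Collect compact)"
proof -
  have "sets (borel :: 'b measure) = sigma_sets UNIV (Collect closed)"
    by (subst borel_eq_closed) simp
  also have "\<dots> = sigma_sets UNIV (Collect compact)"
  proof (rule sigma_sets_eqI)
    fix S :: "'b set" assume "S \<in> Collect closed"
    then have "S \<inter> cball undefined (real n) \<in> sigma_sets UNIV (Collect compact)" for n
      by (intro sigma_sets.Basic) (auto intro: closed_Int_compact)
    then have "(\<Union>n. S \<inter> cball undefined (real n)) \<in> sigma_sets UNIV (Collect compact)"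
      by (rule sigma_sets.Union)
    moreover have "(\<Union>n. S \<inter> cball undefined (real n)) = S" by (auto simp: real_arch_simple)
    ultimately show "S \<in> sigma_sets UNIV (Collect compact)" by simp
  qed (auto intro: sigma_sets.Basic compact_imp_closed)
  finally show ?thesis .
qed

context
  assumes int: "integrable lborel (cfun \<nu>)"
begin

abbreviation "\<rho> \<equiv> inv_fourier (cfun \<nu>)"

text \<open>The Gaussian width shrinks to 0. The bound, uniform in \<open>n\<close> and
  \<open>x\<close>, supplies the majorants for the later limits on the density side.\<close>

lemma inv_fourier_approx:
  "(\<lambda>n. \<integral>y. gauss ((x - y) /\<^sub>R (1 / Suc n)) / (1 / Suc n) ^ DIM('a) \<partial>\<nu>) \<longlonglongrightarrow> \<rho> x"
  "norm (\<integral>y. gauss ((x - y) /\<^sub>R (1 / Suc n)) / (1 / Suc n) ^ DIM('a) \<partial>\<nu>)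
    \<le> (\<integral>\<xi>. norm (cfun \<nu> \<xi>) \<partial>lborel) / (2 * pi) ^ DIM('a)"
proof -
  define e where "e n \<xi> = exp (- (norm ((1 / real (Suc n)) *\<^sub>R \<xi>))\<^sup>2 / 2)" for n and \<xi> :: 'a
  have [measurable]: "e n \<in> borel_measurable borel" for n unfolding e_def by measurable
  have e1: "0 \<le> e n \<xi>" "e n \<xi> \<le> 1" for n \<xi> by (simp_all add: e_def)
  have eq: "(\<integral>y. gauss ((x - y) /\<^sub>R (1 / Suc n)) / (1 / Suc n) ^ DIM('a) \<partial>\<nu>)
      = inv_fourier (\<lambda>\<xi>. cfun \<nu> \<xi> * of_real (e n \<xi>)) x" for n
    unfolding e_def by (rule inv_fourier_smoothed[symmetric]) simp
  have bd: "norm (Re (iexp (- (\<xi> \<bullet> x)) * (cfun \<nu> \<xi> * of_real (e n \<xi>)))) \<le> norm (cfun \<nu> \<xi>)" for n \<xi>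
  proof -
    have "norm (Re (iexp (- (\<xi> \<bullet> x)) * (cfun \<nu> \<xi> * of_real (e n \<xi>))))
        \<le> norm (iexp (- (\<xi> \<bullet> x)) * (cfun \<nu> \<xi> * of_real (e n \<xi>)))"
      using abs_Re_le_cmod by (simp only: real_norm_def)
    also have "\<dots> = norm (cfun \<nu> \<xi>) * e n \<xi>"
      using e1(1)[of n \<xi>] by (simp add: norm_mult)
    also have "\<dots> \<le> norm (cfun \<nu> \<xi>)" using e1[of n \<xi>] by (intro mult_left_le) auto
    finally show ?thesis .
  qed
  have lim: "(\<lambda>n. e n \<xi>) \<longlonglongrightarrow> 1" for \<xi>
  proof -
    have "(\<lambda>n. exp (- (norm ((1 / real (Suc n)) *\<^sub>R \<xi>))\<^sup>2 / 2)) \<longlonglongrightarrow> exp (- (norm (0 *\<^sub>R \<xi>))\<^sup>2 / 2)"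
      by (intro tendsto_intros LIMSEQ_inverse_real_of_nat[unfolded inverse_eq_divide]) auto
    then show ?thesis by (simp add: e_def)
  qed
  have "(\<lambda>n. \<integral>\<xi>. Re (iexp (- (\<xi> \<bullet> x)) * (cfun \<nu> \<xi> * of_real (e n \<xi>))) \<partial>lborel)
      \<longlonglongrightarrow> (\<integral>\<xi>. Re (iexp (- (\<xi> \<bullet> x)) * (cfun \<nu> \<xi> * of_real 1)) \<partial>lborel)"
  proof (rule integral_dominated_convergence[where w = "\<lambda>\<xi>. norm (cfun \<nu> \<xi>)"])
    show "AE \<xi> in lborel. (\<lambda>n. Re (iexp (- (\<xi> \<bullet> x)) * (cfun \<nu> \<xi> * of_real (e n \<xi>))))
        \<longlonglongrightarrow> Re (iexp (- (\<xi> \<bullet> x)) * (cfun \<nu> \<xi> * of_real 1))"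
      by (intro AE_I2 tendsto_intros lim)
  qed (use int bd in \<open>simp_all only: integrable_norm AE_I2\<close>, measurable)
  then show "(\<lambda>n. \<integral>y. gauss ((x - y) /\<^sub>R (1 / Suc n)) / (1 / Suc n) ^ DIM('a) \<partial>\<nu>) \<longlonglongrightarrow> \<rho> x"
    unfolding eq unfolding inv_fourier_def by (intro tendsto_intros) auto
  have "norm (\<integral>\<xi>. Re (iexp (- (\<xi> \<bullet> x)) * (cfun \<nu> \<xi> * of_real (e n \<xi>))) \<partial>lborel)
      \<le> (\<integral>\<xi>. norm (cfun \<nu> \<xi>) \<partial>lborel)"
  proof (rule Bochner_Integration.integral_norm_bound_integral)
    show "integrable lborel (\<lambda>\<xi>. Re (iexp (- (\<xi> \<bullet> x)) * (cfun \<nu> \<xi> * of_real (e n \<xi>))))"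
      by (rule Bochner_Integration.integrable_bound[OF integrable_norm[OF int]], measurable)
        (intro AE_I2, use bd in \<open>simp only: real_norm_def abs_norm_cancel\<close>)
  qed (use int bd in \<open>simp_all only: integrable_norm\<close>)
  then show "norm (\<integral>y. gauss ((x - y) /\<^sub>R (1 / Suc n)) / (1 / Suc n) ^ DIM('a) \<partial>\<nu>)
      \<le> (\<integral>\<xi>. norm (cfun \<nu> \<xi>) \<partial>lborel) / (2 * pi) ^ DIM('a)"
    unfolding eq unfolding inv_fourier_def by (simp add: divide_right_mono)
qed

lemma inv_fourier_nonneg: "\<rho> x \<ge> 0"
proof (rule LIMSEQ_le_const[OF inv_fourier_approx(1)[of x]], intro exI allI impI)
  fix n :: nat
  show "0 \<le> (\<integral>y. gauss ((x - y) /\<^sub>R (1 / Suc n)) / (1 / Suc n) ^ DIM('a) \<partial>\<nu>)"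
    by (intro integral_nonneg_AE AE_I2) (simp add: gauss_nonneg)
qed

lemma inv_fourier_measurable [measurable]: "\<rho> \<in> borel_measurable borel"
  unfolding inv_fourier_def by measurable

text \<open>The integral of \<open>f\<close> against the smoothed measure has two limits: the
  smoothed densities converge boundedly to \<open>\<rho>\<close>, and, after Fubini, averages of
  \<open>f\<close> over shrinking Gaussians converge to \<open>f\<close>. Bounded support gives the
  majorant in the first.\<close>

lemma integral_test_function:
  fixes f :: "'a \<Rightarrow> real"
  assumes f: "continuous_on UNIV f" and B: "\<And>x. \<bar>f x\<bar> \<le> B" and supp: "\<And>x. norm x > R \<Longrightarrow> f x = 0"
  shows "(\<integral>x. f x \<partial>\<nu>) = (\<integral>x. f x * \<rho> x \<partial>lborel)"
proof -
  have fm [measurable]: "f \<in> borel_measurable borel" using f by (rule borel_measurable_continuous_onI)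
  have B0: "B \<ge> 0" using B[of 0] by simp
  define h where "h n = 1 / real (Suc n)" for n
  have h: "h n > 0" for n by (simp add: h_def)
  have h0: "h \<longlonglongrightarrow> 0"
    unfolding h_def by (rule LIMSEQ_inverse_real_of_nat[unfolded inverse_eq_divide])
  define g where "g n x y = gauss ((x - y) /\<^sub>R h n) / h n ^ DIM('a)" for n and x y :: 'a
  have g0: "g n x y \<ge> 0" for n x y using h[of n] by (simp add: g_def gauss_nonneg)
  have [measurable]: "(\<lambda>p. g n (fst p) (snd p)) \<in> borel_measurable (borel \<Otimes>\<^sub>M borel)" for n
    unfolding g_def by measurable
  \<comment> \<open>Substituting \<open>x = y + h n *\<^sub>R z\<close> moves the dependence on
    \<open>n\<close> from the kernel into the argument of \<open>F\<close>.\<close>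
  have shift: "(\<integral>x. F x * g n x y \<partial>lborel) = (\<integral>z. F (y + h n *\<^sub>R z) * gauss z \<partial>lborel)"
    if [measurable]: "F \<in> borel_measurable borel" for F :: "'a \<Rightarrow> real" and n y
  proof -
    have "(\<integral>x. F x * g n x y \<partial>lborel)
      = h n ^ DIM('a) *\<^sub>R (\<integral>z. F (y + h n *\<^sub>R z) * g n (y + h n *\<^sub>R z) y \<partial>lborel)"
      unfolding g_def by (rule lborel_integral_affine) (use h in measurable)
    also have "\<dots> = (\<integral>z. h n ^ DIM('a) * (F (y + h n *\<^sub>R z) * g n (y + h n *\<^sub>R z) y) \<partial>lborel)"
      by simp
    also have "\<dots> = (\<integral>z. F (y + h n *\<^sub>R z) * gauss z \<partial>lborel)"
      using h[of n] by (intro Bochner_Integration.integral_cong) (auto simp: g_def)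
    finally show ?thesis .
  qed
  define M where "M = (\<integral>\<xi>. norm (cfun \<nu> \<xi>) \<partial>lborel) / (2 * pi) ^ DIM('a)"
  have lim: "(\<lambda>n. \<integral>y. g n x y \<partial>\<nu>) \<longlonglongrightarrow> \<rho> x" and bd: "norm (\<integral>y. g n x y \<partial>\<nu>) \<le> M" for n x
    using inv_fourier_approx(1)[of x] inv_fourier_approx(2)[where x = x and n = n]
    by (simp_all add: g_def h_def M_def)
  have M0: "M \<ge> 0" using order_trans[OF norm_ge_zero bd] .
  have L1: "(\<lambda>n. \<integral>x. f x * (\<integral>y. g n x y \<partial>\<nu>) \<partial>lborel) \<longlonglongrightarrow> (\<integral>x. f x * \<rho> x \<partial>lborel)"
  proof (rule integral_dominated_convergence[where w = "\<lambda>x. B * M * indicator (cball 0 R) x"])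
    show "(\<lambda>x. f x * \<rho> x) \<in> borel_measurable lborel"
      using borel_measurable_times[OF fm inv_fourier_measurable] by simp
    have "(\<lambda>x. \<integral>y. g n x y \<partial>\<nu>) \<in> borel_measurable borel" for n unfolding g_def by measurable
    then show "(\<lambda>x. f x * (\<integral>y. g n x y \<partial>\<nu>)) \<in> borel_measurable lborel" for n
      using borel_measurable_times[OF fm] by simp
    show "integrable lborel (\<lambda>x. B * M * indicator (cball 0 R) x :: real)"
      by (intro integrable_mult_right) (auto simp: integrable_indicator_iff emeasure_lborel_cball_finite[simplified])
    show "AE x in lborel. (\<lambda>n. f x * (\<integral>y. g n x y \<partial>\<nu>)) \<longlonglongrightarrow> f x * \<rho> x"
      by (intro AE_I2 tendsto_intros lim)
    show "AE x in lborel. norm (f x * (\<integral>y. g n x y \<partial>\<nu>)) \<le> B * M * indicator (cball 0 R) x" for n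
    proof (rule AE_I2)
      fix x
      show "norm (f x * (\<integral>y. g n x y \<partial>\<nu>)) \<le> B * M * indicator (cball 0 R) x"
        using supp[of x] mult_mono[OF B[of x] bd[of n x]] B0
        by (auto simp: abs_mult indicator_def not_le)
    qed
  qed
  have swap: "(\<integral>x. f x * (\<integral>y. g n x y \<partial>\<nu>) \<partial>lborel) = (\<integral>y. (\<integral>z. f (y + h n *\<^sub>R z) * gauss z \<partial>lborel) \<partial>\<nu>)" for n
  proof -
    interpret P: pair_sigma_finite \<nu> lborel ..
    have "integrable (\<nu> \<Otimes>\<^sub>M lborel) (\<lambda>(y, x). f x * g n x y)"
    proof (rule P.Fubini_integrable)
      show "(\<lambda>(y, x). f x * g n x y) \<in> borel_measurable (\<nu> \<Otimes>\<^sub>M lborel)"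
        unfolding g_def by measurable
      have gi: "integrable lborel (\<lambda>x. g n x y)" for y
      proof -
        have "integrable lborel (\<lambda>x. gauss ((- y /\<^sub>R h n) + (1 / h n) *\<^sub>R x))"
          using h[of n] by (intro lborel_integrable_affine integrable_gauss) auto
        moreover have "(- y /\<^sub>R h n) + (1 / h n) *\<^sub>R x = (x - y) /\<^sub>R h n" for x
          by (simp add: scaleR_diff_right divide_inverse)
        ultimately show ?thesis unfolding g_def by simp
      qed
      have fgi: "integrable lborel (\<lambda>x. f x * g n x y)" for y
      proof (rule Bochner_Integration.integrable_bound[OF integrable_mult_right[OF gi[of y], of B]])
        show "AE x in lborel. norm (f x * g n x y) \<le> norm (B * g n x y)"
          using B B0 g0 by (intro AE_I2) (auto simp: abs_mult intro!: mult_mono)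
      qed (simp add: g_def)
      then show "AE y in \<nu>. integrable lborel (\<lambda>x. case (y, x) of (y, x) \<Rightarrow> f x * g n x y)" by simp
      show "integrable \<nu> (\<lambda>y. \<integral>x. norm (case (y, x) of (y, x) \<Rightarrow> f x * g n x y) \<partial>lborel)"
      proof (rule integrable_const_bound[where B = B])
        show "AE y in \<nu>. norm (\<integral>x. norm (case (y, x) of (y, x) \<Rightarrow> f x * g n x y) \<partial>lborel) \<le> B"
        proof (rule AE_I2)
          fix y
          have "(\<integral>x. norm (f x * g n x y) \<partial>lborel) \<le> (\<integral>x. B * g n x y \<partial>lborel)"
            using B B0 g0 by (intro Bochner_Integration.integral_mono integrable_norm fgi integrable_mult_right gi)
              (auto simp: abs_mult intro!: mult_mono)
          also have "\<dots> = B" using shift[of "\<lambda>_. B" n y] by (simp add: integral_gauss)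
          finally show "norm (\<integral>x. norm (case (y, x) of (y, x) \<Rightarrow> f x * g n x y) \<partial>lborel) \<le> B"
            by (simp add: integral_nonneg_AE)
        qed
      qed (unfold g_def, measurable)
    qed
    from P.Fubini_integral[OF this] show ?thesis by (simp add: shift[symmetric])
  qed
  have "(\<lambda>n. \<integral>y. (\<integral>z. f (y + h n *\<^sub>R z) * gauss z \<partial>lborel) \<partial>\<nu>) \<longlonglongrightarrow> (\<integral>y. f y \<partial>\<nu>)"
  proof (rule integral_dominated_convergence[where w = "\<lambda>_. B"])
    show "AE y in \<nu>. (\<lambda>n. \<integral>z. f (y + h n *\<^sub>R z) * gauss z \<partial>lborel) \<longlonglongrightarrow> f y"
    proof (rule AE_I2)
      fix y
      have "(\<lambda>n. \<integral>z. f (y + h n *\<^sub>R z) * gauss z \<partial>lborel) \<longlonglongrightarrow> (\<integral>z. f y * gauss (z::'a) \<partial>lborel)"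
      proof (rule integral_dominated_convergence[where w = "\<lambda>z. B * gauss z"])
        show "integrable lborel (\<lambda>z::'a. B * gauss z)" by (intro integrable_mult_right integrable_gauss)
        show "AE z in lborel. (\<lambda>n. f (y + h n *\<^sub>R z) * gauss z) \<longlonglongrightarrow> f y * gauss z"
        proof (intro AE_I2 tendsto_intros)
          fix z
          have "(\<lambda>n. y + h n *\<^sub>R z) \<longlonglongrightarrow> y + 0 *\<^sub>R z" by (intro tendsto_intros h0)
          then have "(\<lambda>n. y + h n *\<^sub>R z) \<longlonglongrightarrow> y" by simp
          then show "(\<lambda>n. f (y + h n *\<^sub>R z)) \<longlonglongrightarrow> f y"
            using f by (auto intro: continuous_on_tendsto_compose)
        qed
        show "AE z in lborel. norm (f (y + h n *\<^sub>R z) * gauss z) \<le> B * gauss z" for n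
          using B by (intro AE_I2) (auto simp: abs_mult gauss_nonneg intro!: mult_right_mono)
      qed measurable
      then show "(\<lambda>n. \<integral>z. f (y + h n *\<^sub>R z) * gauss z \<partial>lborel) \<longlonglongrightarrow> f y" by (simp add: integral_gauss)
    qed
    show "f \<in> borel_measurable \<nu>"
      unfolding measurable_cong_sets[OF sets_eq refl] by (rule fm)
    have "(\<lambda>y. \<integral>z. f (y + h n *\<^sub>R z) * gauss z \<partial>lborel) \<in> borel_measurable borel" for n by measurable
    then show "(\<lambda>y. \<integral>z. f (y + h n *\<^sub>R z) * gauss z \<partial>lborel) \<in> borel_measurable \<nu>" for n
      unfolding measurable_cong_sets[OF sets_eq refl] .
    show "integrable \<nu> (\<lambda>_. B)" by simp
    show "AE y in \<nu>. norm (\<integral>z. f (y + h n *\<^sub>R z) * gauss z \<partial>lborel) \<le> B" for n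
    proof (rule AE_I2)
      fix y
      have "norm (\<integral>z. f (y + h n *\<^sub>R z) * gauss z \<partial>lborel) \<le> (\<integral>z. B * gauss (z::'a) \<partial>lborel)"
      proof (rule Bochner_Integration.integral_norm_bound_integral)
        show ig: "integrable lborel (\<lambda>z::'a. B * gauss z)" by (intro integrable_mult_right integrable_gauss)
        show "integrable lborel (\<lambda>z. f (y + h n *\<^sub>R z) * gauss z)"
          by (rule Bochner_Integration.integrable_bound[OF ig], measurable)
            (use B B0 in \<open>auto simp: abs_mult gauss_nonneg intro!: mult_right_mono\<close>)
      qed (use B in \<open>auto simp: abs_mult gauss_nonneg intro!: mult_right_mono\<close>)
      then show "norm (\<integral>z. f (y + h n *\<^sub>R z) * gauss z \<partial>lborel) \<le> B" by (simp add: integral_gauss)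
    qed
  qed
  from LIMSEQ_unique[OF this L1[unfolded swap]] show ?thesis .
qed

text \<open>Compact sets generate the Borel sets and are stable under intersection, so comparing
  them suffices; the indicator of one is a limit of continuous functions that fall off with the
  distance to it.\<close>

lemma measure_eq_density_inv_fourier: "\<nu> = density lborel (\<lambda>x. ennreal (\<rho> x))"
proof (rule measure_eqI_generator_eq)
  show "Int_stable (Collect compact :: 'a set set)" by (rule Int_stableI) (auto simp: compact_Int)
  show "(Collect compact :: 'a set set) \<subseteq> Pow UNIV" by simp
  show "sets \<nu> = sigma_sets UNIV (Collect compact)"
    "sets (density lborel (\<lambda>x. ennreal (\<rho> x))) = sigma_sets UNIV (Collect compact)"
    by (simp_all add: sets_eq sets_borel_compact)
  show "range (\<lambda>n. cball (0::'a) (real n)) \<subseteq> Collect compact" by auto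
  show "(\<Union>n. cball (0::'a) (real n)) = UNIV"
    by (auto simp: real_arch_simple)
  show "emeasure \<nu> (cball 0 (real n)) \<noteq> \<infinity>" for n by simp
next
  fix K :: "'a set" assume "K \<in> Collect compact"
  then have K: "compact K" "closed K" by (auto simp: compact_imp_closed)
  show "emeasure \<nu> K = emeasure (density lborel (\<lambda>x. ennreal (\<rho> x))) K"
  \<comment> \<open>\<open>infdist\<close> to the empty set is 0 by convention, so the approximation
    below concerns nonempty \<open>K\<close>.\<close>
  proof (cases "K = {}")
    case False
    obtain R where R: "\<And>x. x \<in> K \<Longrightarrow> norm x \<le> R" using K(1) compact_imp_bounded bounded_iff by metis
    have [measurable]: "K \<in> sets borel" using K by auto
    \<comment> \<open>\<open>f 0\<close> is the constant 1; the functions \<open>f (Suc n)\<close>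
      vanish outside a ball, hence the shifted index throughout.\<close>
    define f where "f n x = max 0 (1 - real n * infdist x K)" for n and x :: 'a
    have f_cont: "continuous_on UNIV (f n)" for n unfolding f_def by (intro continuous_intros)
    have [measurable]: "f n \<in> borel_measurable borel" for n
      using f_cont by (rule borel_measurable_continuous_onI)
    have f_bd: "\<bar>f n x\<bar> \<le> 1" for n x by (auto simp: f_def infdist_nonneg)
    have f_supp: "f (Suc n) x = 0" if "norm x > R + 1" for n x
    proof -
      obtain y where y: "y \<in> K" "infdist x K = dist x y" using infdist_attains_inf[OF K(2) False] by metis
      have "norm x \<le> norm y + dist x y" by (metis add.commute dist_norm norm_triangle_sub)
      then have "infdist x K > 1" using y R[of y] that by simp
      then have "real (Suc n) * infdist x K \<ge> 1 * 1" by (intro mult_mono) auto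
      then show ?thesis by (simp add: f_def)
    qed
    have f_lim: "(\<lambda>n. f (Suc n) x) \<longlonglongrightarrow> indicator K x" for x
    proof (cases "x \<in> K")
      case False
      then have "infdist x K > 0" using K(2) \<open>K \<noteq> {}\<close>
        by (metis in_closed_iff_infdist_zero infdist_nonneg less_eq_real_def)
      then obtain N where N: "real N * infdist x K > 1" using reals_Archimedean3 by blast
      have "f (Suc n) x = 0" if "n \<ge> N" for n
      proof -
        have "real N * infdist x K \<le> real (Suc n) * infdist x K" using that by (intro mult_right_mono) (auto simp: infdist_nonneg)
        then show ?thesis using N by (simp add: f_def)
      qed
      then have "\<forall>\<^sub>F n in sequentially. f (Suc n) x = indicator K x"
        using False by (auto simp: eventually_sequentially)
      then show ?thesis by (rule tendsto_eventually)
    qed (simp add: f_def)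
    have "(\<lambda>n. \<integral>x. f (Suc n) x \<partial>\<nu>) \<longlonglongrightarrow> (\<integral>x. indicator K x \<partial>\<nu>)"
      by (rule integral_dominated_convergence[where w = "\<lambda>_. 1"])
        (auto intro!: f_lim f_bd AE_I2 simp: real_norm_def)
    moreover have "(\<lambda>n. \<integral>x. f (Suc n) x * \<rho> x \<partial>lborel) \<longlonglongrightarrow> (\<integral>x. indicator K x * \<rho> x \<partial>lborel)"
    proof (rule integral_dominated_convergence[where w = "\<lambda>x. ((\<integral>\<xi>. norm (cfun \<nu> \<xi>) \<partial>lborel) / (2 * pi) ^ DIM('a)) * indicator (cball 0 (R + 1)) x"])
      show "integrable lborel (\<lambda>x. ((\<integral>\<xi>. norm (cfun \<nu> \<xi>) \<partial>lborel) / (2 * pi) ^ DIM('a)) * indicator (cball (0::'a) (R + 1)) x)"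
        by (intro integrable_mult_right) (auto simp: integrable_indicator_iff emeasure_lborel_cball_finite[simplified])
      fix n
      have "\<bar>\<rho> x\<bar> \<le> (\<integral>\<xi>. norm (cfun \<nu> \<xi>) \<partial>lborel) / (2 * pi) ^ DIM('a)" for x
        using LIMSEQ_le_const2[OF tendsto_norm[OF inv_fourier_approx(1)[of x]]] inv_fourier_approx(2)[where x = x]
        unfolding real_norm_def by blast
      then show "AE x in lborel. norm (f (Suc n) x * \<rho> x) \<le> ((\<integral>\<xi>. norm (cfun \<nu> \<xi>) \<partial>lborel) / (2 * pi) ^ DIM('a)) * indicator (cball 0 (R + 1)) x"
        using f_supp[of _ n] mult_mono[OF f_bd[of "Suc n"]]
        by (intro AE_I2) (auto simp: abs_mult indicator_def not_le)
    qed (auto intro!: AE_I2 tendsto_intros f_lim)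
    moreover have "(\<integral>x. f (Suc n) x \<partial>\<nu>) = (\<integral>x. f (Suc n) x * \<rho> x \<partial>lborel)" for n
      by (rule integral_test_function[OF f_cont f_bd f_supp])
    ultimately have "(\<integral>x. indicator K x \<partial>\<nu>) = (\<integral>x. indicator K x * \<rho> x \<partial>lborel)"
      using LIMSEQ_unique by auto
    moreover have "integrable lborel (\<lambda>x. indicator K x * \<rho> x)"
    proof (rule Bochner_Integration.integrable_bound[where f = "\<lambda>x. ((\<integral>\<xi>. norm (cfun \<nu> \<xi>) \<partial>lborel) / (2 * pi) ^ DIM('a)) * indicator K x"])
      show "integrable lborel (\<lambda>x. ((\<integral>\<xi>. norm (cfun \<nu> \<xi>) \<partial>lborel) / (2 * pi) ^ DIM('a)) * indicator K x)"
        using K(1) by (intro integrable_mult_right) (auto simp: integrable_indicator_iff emeasure_compact_finite[simplified])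
      have "\<bar>\<rho> x\<bar> \<le> (\<integral>\<xi>. norm (cfun \<nu> \<xi>) \<partial>lborel) / (2 * pi) ^ DIM('a)" for x
        using LIMSEQ_le_const2[OF tendsto_norm[OF inv_fourier_approx(1)[of x]]] inv_fourier_approx(2)[where x = x]
        unfolding real_norm_def by blast
      then show "AE x in lborel. norm (indicator K x * \<rho> x) \<le> norm (((\<integral>\<xi>. norm (cfun \<nu> \<xi>) \<partial>lborel) / (2 * pi) ^ DIM('a)) * indicator K x)"
        by (intro AE_I2) (auto simp: indicator_def intro: order_trans[OF _ abs_ge_self])
    qed measurable
    ultimately show ?thesis
      by (simp add: emeasure_density nn_integral_eq_integral inv_fourier_nonneg emeasure_eq_measure
          mult.commute flip: ennreal_indicator ennreal_mult')
  qed simp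
qed

end

end

section \<open>The switching process on the canonical space\<close>

text \<open>Rate-one holding times serve both modes: the rates enter later as divisors, so all
  paths, from either starting mode, live on the single product space \<open>expos\<close>.\<close>

definition expo :: "real measure" where
  "expo = density lborel (\<lambda>x. ennreal (exponential_density 1 x))"

lemma sets_expo [measurable_cong]: "sets expo = sets borel"
  by (simp add: expo_def)

lemma space_expo [simp]: "space expo = UNIV"
  by (simp add: expo_def)

interpretation expo: prob_space expo
  unfolding expo_def by (rule prob_space_exponential_density) simp

interpretation stream: sequence_space expo
  by unfold_locales

abbreviation expos :: "(nat \<Rightarrow> real) measure" where
  "expos \<equiv> \<Pi>\<^sub>M i\<in>UNIV. expo"

lemma space_expos [simp]: "space expos = UNIV"
  by (simp add: space_PiM)

lemma AE_expo_pos: "AE x in expo. 0 < x"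
proof -
  have "AE x in lborel. x \<noteq> (0::real)" by (rule AE_lborel_singleton)
  then show ?thesis
    unfolding expo_def by (subst AE_density) (auto simp: exponential_density_def elim!: eventually_mono)
qed

lemma distributed_expo_id: "distributed expo lborel (\<lambda>x. x) (exponential_density 1)"
  unfolding distributed_def expo_def
  by (auto simp: distr_id2)

lemma prob_expo_greater: "0 \<le> a \<Longrightarrow> expo.prob {a<..} = exp (- a)"
  using expo.exponential_distributedD_gt[OF distributed_expo_id, of a] by (simp add: greaterThan_def)

lemma prob_expo_atMost: "0 \<le> a \<Longrightarrow> expo.prob {..a} = 1 - exp (- a)"
  using expo.exponential_distributedD_le[OF distributed_expo_id, of a] by (simp add: atMost_def)

text \<open>No instantaneous jumps and no explosion, so that every nonnegative time lies in exactly
  one holding interval.\<close>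

definition good :: "(nat \<Rightarrow> real) \<Rightarrow> bool" where
  "good e \<longleftrightarrow> (\<forall>k. e k > 0) \<and> (\<forall>C. \<exists>n. C < (\<Sum>k<n. e k))"

text \<open>Almost surely infinitely many entries exceed 1, since \<open>n\<close> given ones all
  stay below with probability \<open>c ^ n\<close>; then the partial sums are unbounded.\<close>

lemma AE_good: "AE e in expos. good e"
proof -
  have pos: "AE e in expos. \<forall>k. 0 < e k"
    unfolding AE_all_countable by (intro allI stream.AE_component AE_expo_pos) simp
  have "AE e in expos. \<forall>m. \<exists>k\<ge>m. e k > 1"
    unfolding AE_all_countable
  proof
    fix m :: nat
    define B where "B k = (if k < m then UNIV else {..1::real})" for k
    have B [measurable]: "B k \<in> sets expo" for k by (simp add: B_def sets_expo)
    define c where "c = 1 - exp (- 1 :: real)"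
    have c: "0 \<le> c" "c < 1" by (simp_all add: c_def)
    have "(\<Prod>i\<le>n. expo.prob (B i)) \<le> c ^ (Suc n - m)" for n
    proof -
      have "(\<Prod>i\<le>n. expo.prob (B i)) = (\<Prod>i\<le>n. if i < m then 1 else c)"
        using expo.prob_space by (intro prod.cong) (auto simp: B_def c_def prob_expo_atMost)
      also have "\<dots> = (\<Prod>i\<in>{m..n}. c)"
        by (rule prod.mono_neutral_cong_right) auto
      finally show ?thesis by simp
    qed
    moreover have "(\<lambda>n. c ^ (Suc n - m)) \<longlonglongrightarrow> 0"
    proof (rule LIMSEQ_offset[of _ m])
      have "Suc (n + m) - m = Suc n" for n by simp
      then show "(\<lambda>n. c ^ (Suc (n + m) - m)) \<longlonglongrightarrow> 0"
        using LIMSEQ_Suc[OF LIMSEQ_realpow_zero[OF c]] by simp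
    qed
    moreover have "(\<lambda>n. \<Prod>i\<le>n. expo.prob (B i)) \<longlonglongrightarrow> measure expos (Pi UNIV B)"
      by (rule stream.measure_PiM_countable) (rule B)
    ultimately have "measure expos (Pi UNIV B) \<le> 0"
      by (intro LIMSEQ_le[of "\<lambda>n. \<Prod>i\<le>n. expo.prob (B i)" _ "\<lambda>n. c ^ (Suc n - m)"]) auto
    then have "measure expos (Pi UNIV B) = 0" by (simp add: measure_le_0_iff)
    moreover have "Pi UNIV B \<in> sets expos" by (rule stream.infprod_in_sets) (rule B)
    ultimately have "AE e in expos. e \<notin> Pi UNIV B"
      by (intro AE_not_in null_setsI) (auto simp: stream.P.emeasure_eq_measure)
    then show "AE e in expos. \<exists>k\<ge>m. e k > 1"
      by (rule eventually_mono) (auto simp: B_def Pi_iff not_less split: if_splits)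
  qed
  with pos show ?thesis
  proof eventually_elim
    case (elim e)
    have "\<exists>n. real c < (\<Sum>k<n. e k)" for c
    proof (induction c)
      case 0
      have "real 0 < (\<Sum>k<1. e k)" using elim(1) by simp
      then show ?case ..
    next
      case (Suc c)
      then obtain n where n: "real c < (\<Sum>k<n. e k)" ..
      obtain k where k: "k \<ge> n" "e k > 1" using elim(2) by blast
      have "real (Suc c) < (\<Sum>k<n. e k) + e k" using n k(2) by simp
      also have "\<dots> \<le> (\<Sum>k<k. e k) + e k"
        using k(1) elim(1) by (intro add_right_mono sum_mono2) (auto intro: less_imp_le)
      also have "\<dots> = (\<Sum>k<Suc k. e k)" by simp
      finally show ?case ..
    qed
    then have "\<exists>n. C < (\<Sum>k<n. e k)" for C :: real
      by (meson less_trans reals_Archimedean2)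
    with elim(1) show ?case by (simp add: good_def)
  qed
qed

locale jump_chain =
  fixes al :: "bool \<Rightarrow> real"
  assumes al_pos: "al i > 0"
begin

definition jump_time :: "bool \<Rightarrow> (nat \<Rightarrow> real) \<Rightarrow> nat \<Rightarrow> real" where
  "jump_time i e n = (\<Sum>k<n. e k / al ((Not ^^ k) i))"

text \<open>The \<open>LEAST\<close> counts the completed jumps, so on good sequences the paths are
  right-continuous, and negative times yield the starting mode.\<close>

definition state :: "bool \<Rightarrow> real \<Rightarrow> (nat \<Rightarrow> real) \<Rightarrow> bool" where
  "state i t e = (Not ^^ (LEAST n. t < jump_time i e (Suc n))) i"

lemma jump_time_0 [simp]: "jump_time i e 0 = 0"
  by (simp add: jump_time_def)

lemma jump_time_case_nat: "jump_time i (case_nat a e) (Suc n) = a / al i + jump_time (\<not> i) e n"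
  unfolding jump_time_def sum.lessThan_Suc_shift by (simp add: funpow_swap1)

lemma jump_time_strict_mono: "good e \<Longrightarrow> strict_mono (jump_time i e)"
  unfolding strict_mono_Suc_iff by (auto simp: jump_time_def good_def al_pos)

lemma jump_time_unbounded:
  assumes "good e"
  obtains n where "C < jump_time i e n"
proof -
  define a where "a = max (al True) (al False)"
  have a: "a > 0" "al i \<le> a" for i using al_pos[of True] by (cases i; simp add: a_def)+
  obtain n where "a * C < (\<Sum>k<n. e k)" using assms unfolding good_def by blast
  then have "C < (\<Sum>k<n. e k) / a" using a(1) by (simp add: field_simps)
  also have "\<dots> = (\<Sum>k<n. e k / a)" by (simp add: sum_divide_distrib)
  also have "\<dots> \<le> jump_time i e n"
    unfolding jump_time_def using assms a al_pos
    by (intro sum_mono divide_left_mono) (auto simp: good_def intro: less_imp_le)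
  finally show ?thesis by (rule that)
qed

lemma jump_time_interval:
  assumes "good e" "t \<ge> 0"
  obtains n where "jump_time i e n \<le> t" "t < jump_time i e (Suc n)"
proof -
  obtain m where m: "t < jump_time i e m" using jump_time_unbounded[OF assms(1)] by blast
  define k where "k = (LEAST m. t < jump_time i e m)"
  have k: "t < jump_time i e k" unfolding k_def using m by (rule LeastI)
  then obtain n where n: "k = Suc n" using assms(2) by (cases k) auto
  have "\<not> t < jump_time i e n" using not_less_Least[of n "\<lambda>m. t < jump_time i e m"] n by (simp add: k_def)
  with k n that show ?thesis by (simp add: not_less)
qed

lemma state_eq:
  assumes e: "good e" and t: "jump_time i e n \<le> t" "t < jump_time i e (Suc n)"
  shows "state i t e = (Not ^^ n) i"
proof -
  have "(LEAST n. t < jump_time i e (Suc n)) = n"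
  proof (rule Least_equality)
    fix m assume "t < jump_time i e (Suc m)"
    then have "jump_time i e n < jump_time i e (Suc m)" using t by simp
    then show "n \<le> m" using strict_mono_less[OF jump_time_strict_mono[OF e]] by simp
  qed (rule t)
  then show ?thesis by (simp add: state_def)
qed

text \<open>Restart at the first jump: from then on the path is that of the opposite mode driven by
  the shifted sequence. This pathwise identity carries the Markov property into the renewal
  equation.\<close>

lemma state_case_nat:
  assumes "good e"
  shows "state i t (case_nat a e) = (if t < a / al i then i else state (\<not> i) (t - a / al i) e)"
proof (cases "t < a / al i")
  case True
  then have "(LEAST n. t < jump_time i (case_nat a e) (Suc n)) = 0"
    by (intro Least_eq_0) (simp add: jump_time_case_nat)
  then show ?thesis using True by (simp add: state_def)
next
  case False
  obtain m where m: "t - a / al i < jump_time (\<not> i) e m" using jump_time_unbounded[OF assms] by blast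
  have "(LEAST n. t < jump_time i (case_nat a e) (Suc n)) = (LEAST n. t - a / al i < jump_time (\<not> i) e n)"
    by (simp add: jump_time_case_nat algebra_simps)
  \<comment> \<open>The index 0 is excluded because \<open>jump_time\<close> starts at 0 and
    \<open>t - a / al i\<close> is nonnegative.\<close>
  also have "\<dots> = Suc (LEAST n. t - a / al i < jump_time (\<not> i) e (Suc n))"
    by (rule Least_Suc[where P = "\<lambda>n. t - a / al i < jump_time (\<not> i) e n", OF m]) (use False in simp)
  finally show ?thesis using False by (simp add: state_def funpow_swap1)
qed

lemma state_measurable [measurable]:
  assumes [measurable]: "f \<in> borel_measurable M" "g \<in> M \<rightarrow>\<^sub>M expos"
  shows "(\<lambda>x. state i (f x) (g x)) \<in> M \<rightarrow>\<^sub>M count_space UNIV"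
proof -
  have [measurable]: "(\<lambda>e. e k) \<in> expos \<rightarrow>\<^sub>M borel" for k
    using measurable_component_singleton[of k UNIV "\<lambda>_. expo"] by (simp add: measurable_cong_sets[OF refl sets_expo])
  have [measurable]: "(\<lambda>x. jump_time i (g x) n) \<in> borel_measurable M" for n
    unfolding jump_time_def by measurable
  have "(\<lambda>x. LEAST n. f x < jump_time i (g x) (Suc n)) \<in> M \<rightarrow>\<^sub>M count_space UNIV" by measurable
  then show ?thesis unfolding state_def by (rule measurable_compose) simp
qed

lemma state_piecewise_cont:
  assumes e: "good e" and j: "\<And>t. t \<ge> 0 \<Longrightarrow> j t = state i t e"
  shows "piecewise_cont j"
  unfolding piecewise_cont_def
proof (intro allI impI)
  fix C :: real assume "C \<ge> 0"
  obtain N where N: "C < jump_time i e N" using jump_time_unbounded[OF e] by blast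
  show "finite {t \<in> {0..C}. \<not> continuous (at t within {0..}) j}"
  proof (rule finite_subset)
    show "{t \<in> {0..C}. \<not> continuous (at t within {0..}) j} \<subseteq> jump_time i e ` {..N}"
    proof safe
      fix t assume t: "t \<in> {0..C}" "\<not> continuous (at t within {0..}) j"
      obtain n where n: "jump_time i e n \<le> t" "t < jump_time i e (Suc n)"
        using jump_time_interval[OF e] t by (metis atLeastAtMost_iff)
      have "jump_time i e n < jump_time i e N" using n N t by auto
      then have nN: "n \<le> N" using strict_mono_less[OF jump_time_strict_mono[OF e]] by simp
      have "t = jump_time i e n"
      proof (rule ccontr)
        assume "t \<noteq> jump_time i e n"
        then have I: "t \<in> {jump_time i e n<..<jump_time i e (Suc n)}" using n by auto
        have n0: "jump_time i e n \<ge> 0"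
          using strict_mono_less_eq[OF jump_time_strict_mono[OF e], of i 0 n] by simp
        have eq: "j s = (Not ^^ n) i" if "s \<in> {jump_time i e n<..<jump_time i e (Suc n)}" for s
          using that n0 j[of s] state_eq[OF e, of i n s] by auto
        have "\<forall>\<^sub>F s in at t within {0..}. s \<in> {jump_time i e n<..<jump_time i e (Suc n)}"
          using eventually_at_in_open'[of "{jump_time i e n<..<jump_time i e (Suc n)}" t] I
            eventually_filtermap by (auto intro: filter_leD[OF at_le[of "{0..}" UNIV t]])
        then have "\<forall>\<^sub>F s in at t within {0..}. j s = j t"
          by (rule eventually_mono) (use eq eq[OF I] in simp)
        then have "continuous (at t within {0..}) j"
          unfolding continuous_within by (rule tendsto_eventually)
        then show False using t by simp
      qed
      then show "t \<in> jump_time i e ` {..N}" using nN by auto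
    qed
  qed simp
qed

text \<open>Prepending an independent entry reproduces the law of the whole sequence; together with
  \<open>state_case_nat\<close> this allows conditioning on the first jump.\<close>

lemma integral_expos:
  fixes F :: "(nat \<Rightarrow> real) \<Rightarrow> 'b::{banach, second_countable_topology}"
  assumes [measurable]: "F \<in> borel_measurable expos" and B: "\<And>e. norm (F e) \<le> B"
  shows "(\<integral>e. F e \<partial>expos) = (\<integral>a. (\<integral>e. F (case_nat a e) \<partial>expos) \<partial>expo)"
proof -
  interpret P: pair_prob_space expo expos ..
  have m [measurable]: "(\<lambda>(a, e). case_nat a e) \<in> expo \<Otimes>\<^sub>M expos \<rightarrow>\<^sub>M expos" by measurable
  have "(\<integral>e. F e \<partial>expos) = (\<integral>e. F e \<partial>distr (expo \<Otimes>\<^sub>M expos) expos (\<lambda>(a, e). case_nat a e))"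
    by (simp only: stream.PiM_iter)
  also have "\<dots> = (\<integral>(a, e). F (case_nat a e) \<partial>(expo \<Otimes>\<^sub>M expos))"
    by (subst integral_distr) (auto simp: case_prod_unfold)
  also have "\<dots> = (\<integral>a. (\<integral>e. F (case_nat a e) \<partial>expos) \<partial>expo)"
  proof (rule P.integral_fst'[symmetric, where f = "\<lambda>(a, e). F (case_nat a e)", simplified])
    show "integrable (expo \<Otimes>\<^sub>M expos) (\<lambda>(a, e). F (case_nat a e))"
      by (rule P.integrable_const_bound[where B = B]) (auto simp: B)
  qed
  finally show ?thesis .
qed

end

section \<open>Variation of constants along a given mode path\<close>

text \<open>Transport to time \<open>t\<close> cancels the linear part of \<open>y'\<close>, which
  leaves the inhomogeneity alone.\<close>

lemma flow_comp_has_vector_derivative: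
  assumes "(y has_vector_derivative y') (at s within S)"
  shows "((\<lambda>s. flow A (t - s) (y s)) has_vector_derivative flow A (t - s) (y' - A *v y s)) (at s within S)"
proof -
  define B where "B = endo_of_matrix A"
  have "((\<lambda>s. exp ((t - s) *\<^sub>R B)) has_vector_derivative (- 1) *\<^sub>R (exp ((t - s) *\<^sub>R B) * B)) (at s within S)"
  proof -
    have "((\<lambda>s. t - s) has_vector_derivative - 1) (at s within S)" by (auto intro!: derivative_eq_intros)
    from vector_diff_chain_within[OF this exp_scaleR_has_vector_derivative_right[of B]]
    show ?thesis by (simp add: o_def)
  qed
  from bounded_bilinear.has_vector_derivative[OF bounded_bilinear_endo_apply this assms]
  show ?thesis
    by (simp add: flow_def B_def[symmetric] endo_apply_mult endo_apply_of_matrix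
        bounded_bilinear.diff_right[OF bounded_bilinear_endo_apply]
        bounded_bilinear.minus_left[OF bounded_bilinear_endo_apply] scaleR_minus1_left)
      (simp add: B_def endo_apply_of_matrix)
qed

lemma vfield_eq: "vfield A p i x - A *v x = (if i then - (A *v p) else 0)"
proof (cases i)
  case True
  have "A *v (x - p) = A *v x - A *v p" by (rule matrix_vector_mult_diff_distrib)
  then show ?thesis using True by (simp add: vfield_def)
qed (simp add: vfield_def)

text \<open>The finitely many discontinuities of \<open>j\<close> are admissible exceptions in the
  fundamental theorem of calculus. In particular \<open>j\<close> and \<open>x\<close> determine
  \<open>y\<close> on the half-line.\<close>

lemma solves_has_integral:
  assumes j: "piecewise_cont j" and y: "solves A p j x y" and t: "0 \<le> t"
  shows "((\<lambda>s. if j s then flow A (t - s) (- (A *v p)) else 0) has_integral (y t - flow A t x)) {0..t}"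
proof -
  define D where "D = {s \<in> {0..t}. \<not> continuous (at s within {0..}) j}"
  have "((\<lambda>s. flow A (t - s) (vfield A p (j s) (y s) - A *v y s)) has_integral
      (flow A (t - t) (y t) - flow A (t - 0) (y 0))) {0..t}"
  proof (rule fundamental_theorem_of_calculus_interior_strong[where S = D])
    show "finite D" using j t by (auto simp: D_def piecewise_cont_def)
    show "continuous_on {0..t} (\<lambda>s. flow A (t - s) (y s))"
      using y by (intro continuous_intros) (auto simp: solves_def intro: continuous_on_subset)
    fix s assume s: "s \<in> {0<..<t} - D"
    have "(y has_vector_derivative vfield A p (j s) (y s)) (at s within {0..})"
      using y s by (auto simp: solves_def D_def)
    moreover have "at s within {0..} = at s"
      by (rule at_within_interior) (use s in simp)
    ultimately show "((\<lambda>s. flow A (t - s) (y s)) has_vector_derivative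
        flow A (t - s) (vfield A p (j s) (y s) - A *v y s)) (at s)"
      by (intro flow_comp_has_vector_derivative) simp
  qed (rule t)
  moreover have "flow A (t - s) (vfield A p (j s) (y s) - A *v y s) = (if j s then flow A (t - s) (- (A *v p)) else 0)" for s
    unfolding vfield_eq by (simp add: flow_simps)
  ultimately show ?thesis using y by (simp add: solves_def)
qed

locale switching = jump_chain al for al :: "bool \<Rightarrow> real" +
  fixes A :: "real^'d^'d" and p :: "real^'d"
begin

definition b :: "real^'d" where "b = - (A *v p)"

definition noise :: "bool \<Rightarrow> real \<Rightarrow> (nat \<Rightarrow> real) \<Rightarrow> real^'d" where
  "noise i t e = (\<integral>s. indicator {0..t} s *\<^sub>R (if state i s e then flow A (t - s) b else 0) \<partial>lborel)"

lemma noise_measurable [measurable]: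
  assumes [measurable]: "g \<in> M \<rightarrow>\<^sub>M expos"
  shows "(\<lambda>x. noise i t (g x)) \<in> borel_measurable M"
  unfolding noise_def
proof (rule sigma_finite_measure.borel_measurable_lebesgue_integral[OF lborel.sigma_finite_measure_axioms])
  have [measurable]: "Measurable.pred (M \<Otimes>\<^sub>M lborel) (\<lambda>q. state i (snd q) (g (fst q)))"
    by (rule state_measurable) measurable
  have "(\<lambda>q. indicator {0..t} (snd q) *\<^sub>R (if state i (snd q) (g (fst q)) then flow A (t - snd q) b else 0))
      \<in> borel_measurable (M \<Otimes>\<^sub>M lborel)" by measurable
  then show "(\<lambda>(x, s). indicator {0..t} s *\<^sub>R (if state i s (g x) then flow A (t - s) b else 0))
      \<in> borel_measurable (M \<Otimes>\<^sub>M lborel)" by (simp add: case_prod_beta')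
qed

lemma flow_b_integrable:
  assumes [measurable]: "Measurable.pred borel j"
  shows "integrable lborel (\<lambda>s. indicator {0..t} s *\<^sub>R (if j s then flow A (t - s) b else 0))"
proof (rule Bochner_Integration.integrable_bound)
  show "integrable lborel (\<lambda>s. indicator {0..t} s *\<^sub>R flow A (t - s) b)"
  proof -
    have "continuous_on {0..t} (\<lambda>s. flow A (t - s) b)" by (intro continuous_intros)
    from borel_integrable_atLeastAtMost'[OF this] show ?thesis unfolding set_integrable_def .
  qed
  show "(\<lambda>s. indicator {0..t} s *\<^sub>R (if j s then flow A (t - s) b else 0)) \<in> borel_measurable lborel"
  proof -
    have [measurable]: "(\<lambda>s. flow A (t - s) b) \<in> borel_measurable borel"
      by (rule flow_measurable) auto
    show ?thesis by measurable
  qed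
qed (auto simp: indicator_def)

lemma state_solves:
  assumes e: "good e" and j: "\<And>t. t \<ge> 0 \<Longrightarrow> j t = state i t e"
    and y: "solves A p j x y" and t: "t \<ge> 0"
  shows "y t = flow A t x + noise i t e"
proof -
  have e_meas: "e \<in> space expos" by simp
  have [measurable]: "Measurable.pred borel (\<lambda>s. state i s e)"
    by (rule state_measurable) (auto intro: measurable_const)
  have "((\<lambda>s. if j s then flow A (t - s) b else 0) has_integral (y t - flow A t x)) {0..t}"
    unfolding b_def by (rule solves_has_integral[OF state_piecewise_cont[OF e j] y t])
  then have "((\<lambda>s. if state i s e then flow A (t - s) b else 0) has_integral (y t - flow A t x)) {0..t}"
    by (rule has_integral_eq[rotated]) (simp add: j)
  moreover have "set_integrable lborel {0..t} (\<lambda>s. if state i s e then flow A (t - s) b else 0)"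
    unfolding set_integrable_def by (rule flow_b_integrable) measurable
  ultimately have "noise i t e = y t - flow A t x"
    using set_borel_integral_eq_integral(2)[of "{0..t}" "\<lambda>s. if state i s e then flow A (t - s) b else 0"]
      integral_unique[of "\<lambda>s. if state i s e then flow A (t - s) b else 0" "y t - flow A t x" "{0..t}"]
    unfolding noise_def set_lebesgue_integral_def by simp
  then show ?thesis by simp
qed

end

section \<open>Transfer to the canonical space\<close>

text \<open>Multiplying the holding times by their rates gives independent rate-one exponentials,
  whose joint law is \<open>expos\<close>; the chain is then almost surely the canonical path of
  these variables.\<close>

lemma markov_chain_canonical:
  assumes M: "prob_space M" and mc: "markov_chain \<alpha>01 \<alpha>10 M i I" and pos: "\<alpha>01 > 0" "\<alpha>10 > 0"
  shows "\<exists>e. e \<in> M \<rightarrow>\<^sub>M expos \<and> distr M expos e = expos \<and>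
    (AE \<omega> in M. \<forall>t\<ge>0. I t \<omega> = jump_chain.state (leave_rate \<alpha>01 \<alpha>10) i t (e \<omega>))"
proof -
  interpret prob_space M by (rule M)
  define al where "al = leave_rate \<alpha>01 \<alpha>10"
  interpret jump_chain al by standard (simp add: al_def leave_rate_def pos)
  obtain S where S: "indep_vars (\<lambda>_. borel) S UNIV"
    "\<And>n. distributed M lborel (S n) (exponential_density (al ((Not ^^ n) i)))"
    "AE \<omega> in M. \<forall>n. \<forall>t\<in>{(\<Sum>k<n. S k \<omega>)..<(\<Sum>k<Suc n. S k \<omega>)}. I t \<omega> = (Not ^^ n) i"
    using mc unfolding markov_chain_def al_def by blast
  \<comment> \<open>The summand 0 gives the affine shape expected by
    \<open>distributed_affine\<close>.\<close>
  define X where "X n \<omega> = 0 + al ((Not ^^ n) i) * S n \<omega>" for n \<omega>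
  define e where "e \<omega> = (\<lambda>n\<in>UNIV. X n \<omega>)" for \<omega>
  have X_dist: "distr M borel (X n) = expo" for n
  proof -
    define c where "c = al ((Not ^^ n) i)"
    have c: "c > 0" by (simp add: c_def al_pos)
    have "distributed M lborel (X n) (\<lambda>x. ennreal (exponential_density c ((x - 0) / c)) / ennreal \<bar>c\<bar>)"
      unfolding X_def[abs_def] c_def[symmetric]
      by (rule distributed_affine[where f = "\<lambda>x. ennreal (exponential_density c x)"])
        (use S(2)[of n] c in \<open>simp_all add: c_def\<close>)
    moreover have "ennreal (exponential_density c ((x - 0) / c)) / ennreal \<bar>c\<bar> = ennreal (exponential_density 1 x)" for x
      using c by (subst divide_ennreal) (auto simp: exponential_density_def divide_less_0_iff)
    ultimately have "distributed M lborel (X n) (\<lambda>x. ennreal (exponential_density 1 x))" by simp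
    then have "distr M lborel (X n) = expo" unfolding distributed_def expo_def by simp
    moreover have "distr M lborel (X n) = distr M borel (X n)" by (rule distr_cong) auto
    ultimately show ?thesis by simp
  qed
  have X_indep: "indep_vars (\<lambda>_. borel) X UNIV"
    unfolding X_def by (rule indep_vars_compose2[OF S(1)]) simp
  then have X_rv: "X n \<in> borel_measurable M" for n
    unfolding indep_vars_def by auto
  have e_m: "e \<in> M \<rightarrow>\<^sub>M expos"
    unfolding e_def by (rule measurable_restrict) (simp add: X_rv measurable_cong_sets[OF refl sets_expo])
  have "distr M (Pi\<^sub>M UNIV (\<lambda>_. borel)) e = Pi\<^sub>M UNIV (\<lambda>n. distr M borel (X n))"
    unfolding e_def using X_indep indep_vars_iff_distr_eq_PiM[of UNIV X "\<lambda>_. borel"] X_rv by blast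
  then have "distr M (Pi\<^sub>M UNIV (\<lambda>_. borel)) e = expos" by (simp only: X_dist)
  moreover have "distr M expos e = distr M (Pi\<^sub>M UNIV (\<lambda>_. borel)) e"
    by (rule distr_cong) (auto intro!: sets_PiM_cong sets_expo)
  ultimately have e_d: "distr M expos e = expos" by simp
  have "AE \<omega> in M. good (e \<omega>)"
    by (rule AE_distrD[OF e_m]) (simp only: e_d AE_good)
  with S(3) have "AE \<omega> in M. \<forall>t\<ge>0. I t \<omega> = state i t (e \<omega>)"
  proof eventually_elim
    case (elim \<omega>)
    have jt: "jump_time i (e \<omega>) n = (\<Sum>k<n. S k \<omega>)" for n
    proof -
      have "al k \<noteq> 0" for k using al_pos[of k] by simp
      then show ?thesis by (simp add: jump_time_def e_def X_def)
    qed
    show ?case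
    proof (intro allI impI)
      fix t :: real assume "t \<ge> 0"
      then obtain n where n: "jump_time i (e \<omega>) n \<le> t" "t < jump_time i (e \<omega>) (Suc n)"
        using jump_time_interval[OF elim(2)] by metis
      have "I t \<omega> = (Not ^^ n) i" using elim(1) n unfolding jt by auto
      then show "I t \<omega> = state i t (e \<omega>)" using state_eq[OF elim(2) n] by simp
    qed
  qed
  with e_m e_d show ?thesis unfolding al_def by blast
qed

text \<open>The start enters through \<open>flow A t x\<close> and the chain through
  \<open>noise\<close>, so the law of \<open>(X t, I t)\<close> is an explicit image of
  \<open>expos\<close>; afterwards invariance is a statement about canonical paths.\<close>

lemma semigroup_op_canonical:
  fixes A :: "real^'d^'d" and X :: "real \<Rightarrow> 'w \<Rightarrow> real^'d" and f :: "(real^'d) \<times> bool \<Rightarrow> real"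
  assumes sp: "switching_process A p \<alpha>01 \<alpha>10 M X I" and pos: "\<alpha>01 > 0" "\<alpha>10 > 0"
    and t: "t \<ge> 0" and f [measurable]: "f \<in> borel_measurable (borel \<Otimes>\<^sub>M count_space UNIV)"
  shows "semigroup_op M X I t f (x, i) =
    (\<integral>e. f (flow A t x + switching.noise (leave_rate \<alpha>01 \<alpha>10) A p i t e,
             jump_chain.state (leave_rate \<alpha>01 \<alpha>10) i t e) \<partial>expos)"
proof -
  define al where "al = leave_rate \<alpha>01 \<alpha>10"
  interpret switching al A p by standard (simp add: al_def leave_rate_def pos)
  have M: "prob_space (M (x, i))" "markov_chain \<alpha>01 \<alpha>10 (M (x, i)) i I"
    "X t \<in> borel_measurable (M (x, i))" "AE \<omega> in M (x, i). solves A p (\<lambda>t. I t \<omega>) x (\<lambda>t. X t \<omega>)"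
    "I t \<in> M (x, i) \<rightarrow>\<^sub>M count_space UNIV"
    using sp t unfolding switching_process_def markov_chain_def by auto
  note [measurable] = M(3,5)
  obtain e where e: "e \<in> M (x, i) \<rightarrow>\<^sub>M expos" "distr (M (x, i)) expos e = expos"
      "AE \<omega> in M (x, i). \<forall>t\<ge>0. I t \<omega> = state i t (e \<omega>)"
    using markov_chain_canonical[OF M(1,2) pos] unfolding al_def by blast
  note [measurable] = e(1)
  have "AE \<omega> in M (x, i). good (e \<omega>)"
    by (rule AE_distrD[OF e(1)]) (simp only: e(2) AE_good)
  with e(3) M(4) have ae: "AE \<omega> in M (x, i). f (X t \<omega>, I t \<omega>) = f (flow A t x + noise i t (e \<omega>), state i t (e \<omega>))"
  proof eventually_elim
    case (elim \<omega>)
    have "X t \<omega> = flow A t x + noise i t (e \<omega>)"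
      by (rule state_solves[OF elim(3) _ elim(2) t]) (use elim(1) in simp)
    then show ?case using elim(1) t by simp
  qed
  have "semigroup_op M X I t f (x, i) = (\<integral>\<omega>. f (flow A t x + noise i t (e \<omega>), state i t (e \<omega>)) \<partial>M (x, i))"
    unfolding semigroup_op_def by (rule integral_cong_AE[OF _ _ ae]) measurable
  also have "\<dots> = (\<integral>e. f (flow A t x + noise i t e, state i t e) \<partial>distr (M (x, i)) expos e)"
    by (rule integral_distr[symmetric]) measurable
  finally show ?thesis unfolding e(2) al_def .
qed

section \<open>Decay of the transition characteristic functions\<close>

context switching
begin

context
  fixes \<xi> :: "real^'d" and k :: bool
begin

section \<open>The renewal equation for the transition characteristic function\<close>

definition speed :: "real \<Rightarrow> real" where "speed s = \<xi> \<bullet> flow A (1 - s) b"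

text \<open>The phase collected on \<open>[r, 1]\<close> by a chain that is in mode \<open>i\<close>
  at time \<open>r\<close>. The end is fixed and the start varies, so the first jump gives a
  backward equation in \<open>r\<close>.\<close>

definition phase :: "bool \<Rightarrow> real \<Rightarrow> (nat \<Rightarrow> real) \<Rightarrow> real" where
  "phase i r e = (\<integral>s. indicator {r..1} s * speed s * of_bool (state i (s - r) e) \<partial>lborel)"

definition trans_char :: "bool \<Rightarrow> real \<Rightarrow> complex" where
  "trans_char i r = (\<integral>e. iexp (phase i r e) * of_bool (state i (1 - r) e = k) \<partial>expos)"

definition antider :: "real \<Rightarrow> real" where "antider u = integral {0..u} speed"

lemma continuous_on_speed: "continuous_on S speed"
  unfolding speed_def by (intro continuous_intros)

lemma speed_measurable [measurable]: "speed \<in> borel_measurable borel"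
  by (intro borel_measurable_continuous_onI continuous_on_speed)

lemma antider_has_derivative:
  assumes "s \<in> {0..1}"
  shows "(antider has_real_derivative speed s) (at s within {0..1})"
  unfolding antider_def has_real_derivative_iff_has_vector_derivative
  by (rule integral_has_vector_derivative[OF continuous_on_speed assms])

lemma continuous_on_antider: "continuous_on {0..1} antider"
  by (rule DERIV_continuous_on[OF antider_has_derivative])

lemma antider_0 [simp]: "antider 0 = 0"
  by (simp add: antider_def)

lemma integrable_speed_Icc: "integrable lborel (\<lambda>s. indicator {r..u} s * speed s)"
  using borel_integrable_atLeastAtMost'[OF continuous_on_speed, of r u] by (simp add: set_integrable_def)

lemma integral_speed_Icc:
  assumes "0 \<le> r" "r \<le> u"
  shows "(\<integral>s. indicator {r..u} s * speed s \<partial>lborel) = antider u - antider r"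
proof -
  have "(\<integral>s. indicator {r..u} s * speed s \<partial>lborel) = integral {r..u} speed"
    using set_borel_integral_eq_integral(2)[of "{r..u}" speed] integrable_speed_Icc[of r u]
    by (simp add: set_integrable_def set_lebesgue_integral_def)
  also have "integral {0..r} speed + integral {r..u} speed = integral {0..u} speed"
    by (rule Henstock_Kurzweil_Integration.integral_combine) (use assms in \<open>auto intro: integrable_continuous_real continuous_on_speed\<close>)
  then have "integral {r..u} speed = antider u - antider r" by (simp add: antider_def)
  finally show ?thesis .
qed

lemma integrable_speed_state:
  assumes [measurable]: "Measurable.pred borel j"
  shows "integrable lborel (\<lambda>s. indicator {r..u} s * speed s * of_bool (j s))"
proof (rule Bochner_Integration.integrable_bound[OF integrable_speed_Icc[of r u]])
  show "(\<lambda>s. indicator {r..u} s * speed s * of_bool (j s)) \<in> borel_measurable lborel" by measurable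
qed (auto simp: indicator_def of_bool_def)

lemma state_section_measurable [measurable]: "Measurable.pred borel (\<lambda>s. state i (s - r) e)"
  by (rule state_measurable) (auto intro: measurable_const)

lemma phase_case_nat:
  assumes e: "good e" and r: "0 \<le> r" and a: "0 \<le> a" and u: "u = r + a / al i"
  shows "phase i r (case_nat a e) =
    (if u \<le> 1 then of_bool i * (antider u - antider r) + phase (\<not> i) u e
     else of_bool i * (\<integral>s. indicator {r..1} s * speed s \<partial>lborel))"
proof -
  have ru: "r \<le> u" using u a al_pos[of i] by simp
  have st: "state i (s - r) (case_nat a e) = (if s < u then i else state (\<not> i) (s - u) e)" for s
    unfolding state_case_nat[OF e] u by (simp add: algebra_simps less_diff_eq)
  show ?thesis
  proof (cases "u \<le> 1")
    case True
    \<comment> \<open>Both closed intervals contain \<open>u\<close>, so the two sides may differ at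
      this one point.\<close>
    have ae: "AE s in lborel. indicator {r..1} s * speed s * of_bool (state i (s - r) (case_nat a e))
        = of_bool i * (indicator {r..u} s * speed s) + indicator {u..1} s * speed s * of_bool (state (\<not> i) (s - u) e)"
      using AE_lborel_singleton[of u]
    proof eventually_elim
      case (elim s)
      then show ?case unfolding st using ru True by (auto simp: indicator_def of_bool_def)
    qed
    have "phase i r (case_nat a e) = (\<integral>s. of_bool i * (indicator {r..u} s * speed s)
        + indicator {u..1} s * speed s * of_bool (state (\<not> i) (s - u) e) \<partial>lborel)"
      unfolding phase_def by (rule integral_cong_AE[OF _ _ ae]) measurable
    also have "\<dots> = of_bool i * (\<integral>s. indicator {r..u} s * speed s \<partial>lborel) + phase (\<not> i) u e"
      unfolding phase_def
      by (subst Bochner_Integration.integral_add)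
        (auto intro!: integrable_mult_right integrable_speed_Icc integrable_speed_state)
    finally show ?thesis using True r ru by (simp add: integral_speed_Icc)
  next
    case False
    have "phase i r (case_nat a e) = (\<integral>s. of_bool i * (indicator {r..1} s * speed s) \<partial>lborel)"
      unfolding phase_def st
      by (rule Bochner_Integration.integral_cong) (use False in \<open>auto simp: indicator_def of_bool_def\<close>)
    then show ?thesis using False by simp
  qed
qed

lemma phase_measurable [measurable]:
  assumes [measurable]: "f \<in> borel_measurable M" "g \<in> M \<rightarrow>\<^sub>M expos"
  shows "(\<lambda>x. phase i (f x) (g x)) \<in> borel_measurable M"
  unfolding phase_def
proof (rule sigma_finite_measure.borel_measurable_lebesgue_integral[OF lborel.sigma_finite_measure_axioms])
  have [measurable]: "Measurable.pred (M \<Otimes>\<^sub>M lborel) (\<lambda>q. state i (snd q - f (fst q)) (g (fst q)))"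
    by (rule state_measurable) measurable
  have [measurable]: "Measurable.pred (M \<Otimes>\<^sub>M lborel) (\<lambda>q. snd q \<in> {f (fst q)..1})"
    unfolding atLeastAtMost_iff by measurable
  have "(\<lambda>q. of_bool (snd q \<in> {f (fst q)..1}) * speed (snd q) * of_bool (state i (snd q - f (fst q)) (g (fst q))))
      \<in> borel_measurable (M \<Otimes>\<^sub>M lborel)" by measurable
  then show "(\<lambda>(x, s). indicator {f x..1} s * speed s * of_bool (state i (s - f x) (g x)))
      \<in> borel_measurable (M \<Otimes>\<^sub>M lborel)" by (simp add: case_prod_beta' indicator_def of_bool_def)
qed

lemma norm_trans_integrand: "norm (iexp (phase i r e) * of_bool (state i (1 - r) e = k)) \<le> 1"
  by (simp add: norm_mult)

lemma norm_trans_char_le: "norm (trans_char i r) \<le> 1"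
proof -
  have int: "integrable expos (\<lambda>e. iexp (phase i r e) * of_bool (state i (1 - r) e = k))"
    by (rule stream.P.integrable_const_bound[where B = 1]) (auto simp: norm_trans_integrand)
  have "norm (trans_char i r) \<le> (\<integral>e. norm (iexp (phase i r e) * of_bool (state i (1 - r) e = k)) \<partial>expos)"
    unfolding trans_char_def by (rule integral_norm_bound)
  also have "\<dots> \<le> 1"
    by (intro stream.P.integral_le_const integrable_norm int AE_I2 norm_trans_integrand)
  finally show ?thesis .
qed

lemma trans_char_measurable [measurable]: "trans_char i \<in> borel_measurable borel"
proof -
  have [measurable]: "Measurable.pred (borel \<Otimes>\<^sub>M expos) (\<lambda>q. state i (1 - fst q) (snd q) = k)"
  proof -
    have [measurable]: "(\<lambda>q. state i (1 - fst q) (snd q)) \<in> borel \<Otimes>\<^sub>M expos \<rightarrow>\<^sub>M count_space UNIV"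
      by (rule state_measurable) measurable
    show ?thesis by measurable
  qed
  have "(\<lambda>q. iexp (phase i (fst q) (snd q)) * of_bool (state i (1 - fst q) (snd q) = k)) \<in> borel_measurable (borel \<Otimes>\<^sub>M expos)"
    by measurable
  then show ?thesis
    unfolding trans_char_def
    by (intro sigma_finite_measure.borel_measurable_lebesgue_integral stream.P.sigma_finite_measure_axioms)
      (simp add: case_prod_beta')
qed

text \<open>Conditioning on the first jump: it comes after time 1 with probability
  \<open>exp (- al i * (1 - r))\<close>; otherwise it occurs at some \<open>u\<close>, the phase up
  to \<open>u\<close> is deterministic, and the chain restarts in the other mode.\<close>

lemma trans_char_renewal:
  assumes r: "0 \<le> r" "r \<le> 1"
  shows "trans_char i r = of_real (exp (- al i * (1 - r))) * iexp (of_bool i * (antider 1 - antider r)) * of_bool (i = k)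
    + (\<integral>u. indicator {r..1} u *\<^sub>R (of_real (al i * exp (- al i * (u - r))) * iexp (of_bool i * (antider u - antider r)) * trans_char (\<not> i) u) \<partial>lborel)"
proof -
  \<comment> \<open>The rate-one holding time beyond which no jump happens before time 1.\<close>
  define a0 where "a0 = al i * (1 - r)"
  have a0: "a0 \<ge> 0" using r al_pos[of i] by (simp add: a0_def)
  define c where "c = iexp (of_bool i * (antider 1 - antider r)) * of_bool (i = k)"
  \<comment> \<open>Agrees with \<open>antider u - antider r\<close> for \<open>u \<ge> r\<close>,
    but its measurability on the whole line is immediate.\<close>
  define w where "w u = (\<integral>s. indicator {r..u} s * speed s \<partial>lborel)" for u
  have w_eq: "w u = antider u - antider r" if "r \<le> u" for u
    unfolding w_def by (rule integral_speed_Icc) (use r that in auto)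
  have [measurable]: "w \<in> borel_measurable borel"
  proof -
    have "(\<lambda>(u, s). indicator {r..u} s * speed s) \<in> borel_measurable (borel \<Otimes>\<^sub>M lborel)"
    proof -
      have [measurable]: "Measurable.pred (borel \<Otimes>\<^sub>M lborel) (\<lambda>q. snd q \<in> {r..fst q})"
        unfolding atLeastAtMost_iff by measurable
      have "(\<lambda>q. of_bool (snd q \<in> {r..fst q}) * speed (snd q)) \<in> borel_measurable (borel \<Otimes>\<^sub>M lborel)" by measurable
      then show ?thesis by (simp add: case_prod_beta' indicator_def of_bool_def)
    qed
    then show ?thesis unfolding w_def
      by (intro sigma_finite_measure.borel_measurable_lebesgue_integral lborel.sigma_finite_measure_axioms)
  qed
  define f where "f a = iexp (of_bool i * w (r + a / al i)) * trans_char (\<not> i) (r + a / al i)" for a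
  have [measurable]: "f \<in> borel_measurable borel" unfolding f_def by measurable
  have f_le: "norm (f a) \<le> 1" for a
    unfolding f_def norm_mult using norm_trans_char_le by (simp add: norm_mult)
  have inner: "(\<integral>e. iexp (phase i r (case_nat a e)) * of_bool (state i (1 - r) (case_nat a e) = k) \<partial>expos)
      = indicator {a0<..} a *\<^sub>R c + indicator {0..a0} a *\<^sub>R f a" if a: "a > 0" for a
  proof -
    define u where "u = r + a / al i"
    have u1: "u \<le> 1 \<longleftrightarrow> a \<le> a0" using al_pos[of i] by (simp add: u_def a0_def field_simps)
    have ru: "r \<le> u" using a al_pos[of i] by (simp add: u_def)
    have [measurable]: "(\<lambda>e. case_nat a e) \<in> expos \<rightarrow>\<^sub>M expos" by measurable
    have "AE e in expos. iexp (phase i r (case_nat a e)) * of_bool (state i (1 - r) (case_nat a e) = k)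
        = (if u \<le> 1 then iexp (of_bool i * w u) * (iexp (phase (\<not> i) u e) * of_bool (state (\<not> i) (1 - u) e = k)) else c)"
      using AE_good
    proof eventually_elim
      case (elim e)
      have lt: "1 - r < a / al i \<longleftrightarrow> \<not> u \<le> 1" by (auto simp: u_def)
      have diff: "1 - r - a / al i = 1 - u" by (simp add: u_def)
      have full: "(\<integral>s. indicator {r..1} s * speed s \<partial>lborel) = antider 1 - antider r"
        by (rule integral_speed_Icc) (use r in auto)
      have ph: "phase i r (case_nat a e) = (if u \<le> 1 then of_bool i * w u + phase (\<not> i) u e
          else of_bool i * (antider 1 - antider r))"
        using phase_case_nat[OF elim r(1) _ u_def] a w_eq[OF ru] full by simp
      have st: "state i (1 - r) (case_nat a e) = (if u \<le> 1 then state (\<not> i) (1 - u) e else i)"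
        unfolding state_case_nat[OF elim] lt diff by simp
      have iexp_add: "iexp (x + y) = iexp x * iexp y" for x y
        by (simp add: exp_add distrib_left)
      show ?case
      proof (cases "u \<le> 1")
        case True
        then have "phase i r (case_nat a e) = of_bool i * w u + phase (\<not> i) u e"
          "state i (1 - r) (case_nat a e) = state (\<not> i) (1 - u) e" using ph st by simp_all
        then show ?thesis using True by (simp only: iexp_add if_True mult.assoc)
      next
        case False
        then have "phase i r (case_nat a e) = of_bool i * (antider 1 - antider r)"
          "state i (1 - r) (case_nat a e) = i" using ph st by simp_all
        then show ?thesis using False by (simp only: if_False c_def)
      qed
    qed
    then have "(\<integral>e. iexp (phase i r (case_nat a e)) * of_bool (state i (1 - r) (case_nat a e) = k) \<partial>expos)
      = (\<integral>e. (if u \<le> 1 then iexp (of_bool i * w u) * (iexp (phase (\<not> i) u e) * of_bool (state (\<not> i) (1 - u) e = k)) else c) \<partial>expos)"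
      by (intro integral_cong_AE) measurable
    also have "\<dots> = (if u \<le> 1 then iexp (of_bool i * w u) * trans_char (\<not> i) u else c)"
      using stream.P.prob_space by (simp add: trans_char_def)
    also have "\<dots> = indicator {a0<..} a *\<^sub>R c + indicator {0..a0} a *\<^sub>R f a"
      using a by (auto simp: u1 f_def u_def[symmetric] indicator_def)
    finally show ?thesis .
  qed
  have [measurable]: "{0..a0} \<in> sets expo" "{a0<..} \<in> sets expo" by (simp_all add: sets_expo)
  have i1: "integrable expo (\<lambda>a. indicator {a0<..} a *\<^sub>R c)" "integrable expo (\<lambda>a. indicator {0..a0} a *\<^sub>R f a)"
    by (rule expo.integrable_const_bound[where B = "norm c"]; auto simp: indicator_def)
      (rule expo.integrable_const_bound[where B = 1]; auto simp: indicator_def f_le)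
  have "trans_char i r = (\<integral>a. (\<integral>e. iexp (phase i r (case_nat a e)) * of_bool (state i (1 - r) (case_nat a e) = k) \<partial>expos) \<partial>expo)"
    unfolding trans_char_def by (rule integral_expos[where B = 1]) (auto simp: norm_trans_integrand)
  also have "\<dots> = (\<integral>a. indicator {a0<..} a *\<^sub>R c + indicator {0..a0} a *\<^sub>R f a \<partial>expo)"
  proof (rule integral_cong_AE)
    show "AE a in expo. (\<integral>e. iexp (phase i r (case_nat a e)) * of_bool (state i (1 - r) (case_nat a e) = k) \<partial>expos)
      = indicator {a0<..} a *\<^sub>R c + indicator {0..a0} a *\<^sub>R f a"
      using AE_expo_pos by (rule eventually_mono) (rule inner)
  qed measurable
  also have "\<dots> = (\<integral>a. indicator {a0<..} a *\<^sub>R c \<partial>expo) + (\<integral>a. indicator {0..a0} a *\<^sub>R f a \<partial>expo)"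
    by (rule Bochner_Integration.integral_add[OF i1])
  also have "(\<integral>a. indicator {a0<..} a *\<^sub>R c \<partial>expo) = of_real (exp (- a0)) * c"
  proof -
    have "integrable expo (indicator {a0<..} :: real \<Rightarrow> real)"
      by (rule expo.integrable_const_bound[where B = 1]) auto
    then show ?thesis
      by (simp add: prob_expo_greater[OF a0] scaleR_conv_of_real)
  qed
  also have "(\<integral>a. indicator {0..a0} a *\<^sub>R f a \<partial>expo) = (\<integral>a. indicator {0..a0} a *\<^sub>R (exp (- a) *\<^sub>R f a) \<partial>lborel)"
    unfolding expo_def
    by (subst integral_density) (auto simp: exponential_density_def indicator_def intro!: Bochner_Integration.integral_cong)
  \<comment> \<open>Substitution \<open>a = al i * (u - r)\<close>, from the rate-one holding time
    to the jump time.\<close>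
  also have "\<dots> = \<bar>al i\<bar> *\<^sub>R (\<integral>u. indicator {0..a0} (- al i * r + al i * u) *\<^sub>R (exp (- (- al i * r + al i * u)) *\<^sub>R f (- al i * r + al i * u)) \<partial>lborel)"
    by (rule lborel_integral_real_affine) (use al_pos[of i] in auto)
  also have "\<dots> = (\<integral>u. al i *\<^sub>R (indicator {0..a0} (- al i * r + al i * u) *\<^sub>R (exp (- (- al i * r + al i * u)) *\<^sub>R f (- al i * r + al i * u))) \<partial>lborel)"
    using al_pos[of i] by (simp only: integral_scaleR_right abs_of_pos)
  also have "\<dots> = (\<integral>u. indicator {r..1} u *\<^sub>R (of_real (al i * exp (- al i * (u - r))) * iexp (of_bool i * (antider u - antider r)) * trans_char (\<not> i) u) \<partial>lborel)"
  proof (rule Bochner_Integration.integral_cong[OF refl])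
    fix u
    have al0: "al i > 0" by (rule al_pos)
    have eq: "- al i * r + al i * u = al i * (u - r)" by (simp add: algebra_simps)
    have "r + al i * (u - r) / al i = u" using al0 by simp
    moreover have "(indicator {0..a0} (al i * (u - r)) :: real) = indicator {r..1} u"
      using al0 by (auto simp: indicator_def a0_def zero_le_mult_iff)
    ultimately have ind: "(indicator {0..a0} (al i * (u - r)) :: real) = indicator {r..1} u"
      and f: "f (al i * (u - r)) = iexp (of_bool i * w u) * trans_char (\<not> i) u"
      by (simp_all only: f_def)
    show "al i *\<^sub>R (indicator {0..a0} (- al i * r + al i * u) *\<^sub>R (exp (- (- al i * r + al i * u)) *\<^sub>R f (- al i * r + al i * u)))
      = indicator {r..1} u *\<^sub>R (of_real (al i * exp (- al i * (u - r))) * iexp (of_bool i * (antider u - antider r)) * trans_char (\<not> i) u)"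
    proof (cases "u \<in> {r..1}")
      case True
      then show ?thesis
        unfolding eq ind f using w_eq[of u]
        by (simp add: scaleR_conv_of_real mult.assoc del: of_real_mult) (simp add: mult.assoc)
    next
      case False
      then show ?thesis unfolding eq ind by simp
    qed
  qed
  finally show ?thesis by (simp add: c_def a0_def mult.assoc)
qed

text \<open>
  In the interaction picture \<open>weighted_char\<close> the renewal equation has no oscillating factor left on the
  diagonal, so that its solution is Lipschitz uniformly in the frequency.
\<close>

definition weight :: "bool \<Rightarrow> real \<Rightarrow> complex" where
  "weight i r = of_real (exp (- al i * r)) * iexp (of_bool i * antider r)"

definition weighted_char :: "bool \<Rightarrow> real \<Rightarrow> complex" where
  "weighted_char i r = weight i r * trans_char i r"

lemma norm_weight: "norm (weight i r) = exp (- al i * r)"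
  unfolding weight_def norm_mult norm_of_real by simp

lemma weight_nz: "weight i r \<noteq> 0"
  by (simp add: weight_def)

lemma continuous_on_weight: "continuous_on {0..1} (weight i)"
  unfolding weight_def by (intro continuous_intros continuous_on_antider)

text \<open>The factor that the renewal equation carries from \<open>r\<close> to \<open>u\<close>
  is the quotient of the weights at \<open>u\<close> and \<open>r\<close>, so multiplication by
  \<open>weight i r\<close> removes \<open>r\<close> from under the integral.\<close>

lemma weight_mult:
  "weight i r * (of_real (exp (- al i * (u - r))) * iexp (of_bool i * (antider u - antider r))) = weight i u"
proof -
  have 1: "exp (- al i * r) * exp (- al i * (u - r)) = exp (- al i * u)"
    by (simp add: algebra_simps flip: exp_add)
  have 2: "iexp (of_bool i * antider r) * iexp (of_bool i * (antider u - antider r)) = iexp (of_bool i * antider u)"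
    by (cases i) (simp_all add: algebra_simps flip: exp_add)
  have "weight i r * (of_real (exp (- al i * (u - r))) * iexp (of_bool i * (antider u - antider r)))
      = of_real (exp (- al i * r) * exp (- al i * (u - r))) * (iexp (of_bool i * antider r) * iexp (of_bool i * (antider u - antider r)))"
    unfolding weight_def of_real_mult by (simp only: mult.assoc mult.left_commute)
  then show ?thesis unfolding 1 2 weight_def .
qed

lemma weighted_char_renewal:
  assumes r: "r \<in> {0..1}"
  shows "(\<lambda>u. al i * weight i u * trans_char (\<not> i) u) integrable_on {0..1}"
    and "weighted_char i r = weight i 1 * of_bool (i = k)
      + integral {r..1} (\<lambda>u. al i * weight i u * trans_char (\<not> i) u)"
proof -
  define h where "h u = al i * weight i u * trans_char (\<not> i) u" for u
  have hs: "set_integrable lborel {s..1} h" if s: "s \<in> {0..1}" for s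
    unfolding set_integrable_def
  proof (rule Bochner_Integration.integrable_bound)
    show "integrable lborel (\<lambda>u. indicator {s..1} u *\<^sub>R (al i * norm (weight i u)))"
    proof -
      have "continuous_on {s..1} (\<lambda>u. al i * norm (weight i u))"
        using continuous_on_subset[OF continuous_on_weight, of "{s..1}" i] s by (intro continuous_intros) auto
      from borel_integrable_atLeastAtMost'[OF this] show ?thesis unfolding set_integrable_def .
    qed
    have w: "(\<lambda>u. indicator {s..1} u *\<^sub>R weight i u) \<in> borel_measurable borel"
      by (rule borel_measurable_continuous_on_indicator)
        (use continuous_on_subset[OF continuous_on_weight, of "{s..1}" i] s in auto)
    have "(\<lambda>u. (indicator {s..1} u *\<^sub>R weight i u) * (al i * trans_char (\<not> i) u)) \<in> borel_measurable borel"
      using w by measurable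
    then show "(\<lambda>u. indicator {s..1} u *\<^sub>R h u) \<in> borel_measurable lborel"
      by (simp add: h_def mult_ac)
    show "AE u in lborel. norm (indicator {s..1} u *\<^sub>R h u) \<le> norm (indicator {s..1} u *\<^sub>R (al i * norm (weight i u)))"
    proof (rule AE_I2)
      fix u
      have "norm (h u) \<le> al i * norm (weight i u) * 1"
        unfolding h_def norm_mult using norm_trans_char_le[of "\<not> i" u] al_pos[of i] by (intro mult_mono) auto
      then show "norm (indicator {s..1} u *\<^sub>R h u) \<le> norm (indicator {s..1} u *\<^sub>R (al i * norm (weight i u)))"
        using al_pos[of i] by (auto simp: indicator_def abs_mult)
    qed
  qed
  show "h integrable_on {0..1}"
    using set_borel_integral_eq_integral(1)[OF hs[of 0]] by simp
  have r01: "0 \<le> r" "r \<le> 1" using r by auto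
  have "weight i r * (of_real (exp (- al i * (1 - r))) * iexp (of_bool i * (antider 1 - antider r)) * of_bool (i = k))
      = weight i 1 * of_bool (i = k)"
    by (simp only: mult.assoc[symmetric] weight_mult[of i r 1, unfolded mult.assoc[symmetric]])
  moreover have "weight i r * (\<integral>u. indicator {r..1} u *\<^sub>R (of_real (al i * exp (- al i * (u - r))) * iexp (of_bool i * (antider u - antider r)) * trans_char (\<not> i) u) \<partial>lborel)
      = (\<integral>u. indicator {r..1} u *\<^sub>R h u \<partial>lborel)"
  proof -
    have "weight i r * (of_real (al i * exp (- al i * (u - r))) * iexp (of_bool i * (antider u - antider r)) * trans_char (\<not> i) u) = h u" for u
      unfolding h_def weight_mult[of i r u, symmetric] of_real_mult by (simp only: mult.assoc mult.left_commute)
    then show ?thesis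
      by (subst integral_mult_right_zero[symmetric]) (simp only: mult_scaleR_right)
  qed
  moreover have "(\<integral>u. indicator {r..1} u *\<^sub>R h u \<partial>lborel) = integral {r..1} h"
    using set_borel_integral_eq_integral(2)[OF hs[OF r]] by (simp add: set_lebesgue_integral_def)
  ultimately show "weighted_char i r = weight i 1 * of_bool (i = k) + integral {r..1} h"
    unfolding weighted_char_def trans_char_renewal[OF r01] by (simp only: distrib_left)
qed

text \<open>Bootstrap: by the renewal equation \<open>weighted_char\<close> is an indefinite
  integral up to a constant, hence continuous. This makes the integrand continuous and prepares the
  differentiability in the next lemma.\<close>

lemma continuous_on_trans_char: "continuous_on {0..1} (trans_char i)"
proof -
  have "continuous_on {0..1} (\<lambda>r. weight i 1 * of_bool (i = k)
      + integral {r..1} (\<lambda>u. al i * weight i u * trans_char (\<not> i) u))"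
    by (intro continuous_intros indefinite_integral_continuous_1' weighted_char_renewal(1)[of 0]) simp
  then have "continuous_on {0..1} (weighted_char i)"
    by (rule continuous_on_eq) (simp add: weighted_char_renewal(2))
  then have "continuous_on {0..1} (\<lambda>r. weighted_char i r / weight i r)"
    by (intro continuous_intros continuous_on_weight) (auto simp: weight_nz)
  then show ?thesis by (simp add: weighted_char_def weight_nz)
qed

lemma weighted_char_has_derivative:
  assumes r: "r \<in> {0..1}"
  shows "(weighted_char i has_vector_derivative - (al i * weight i r * trans_char (\<not> i) r)) (at r within {0..1})"
proof -
  define h where "h u = al i * weight i u * trans_char (\<not> i) u" for u
  have h: "continuous_on {0..1} h"
    unfolding h_def by (intro continuous_intros continuous_on_weight continuous_on_trans_char)
  have der: "((\<lambda>r. weight i 1 * of_bool (i = k) + (integral {0..1} h - integral {0..r} h)) has_vector_derivative 0 + (0 - h r)) (at r within {0..1})"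
    by (intro has_vector_derivative_add has_vector_derivative_diff has_vector_derivative_const
        integral_has_vector_derivative[OF h r])
  have eq: "weighted_char i r' = weight i 1 * of_bool (i = k) + (integral {0..1} h - integral {0..r'} h)" if "r' \<in> {0..1}" for r'
    using weighted_char_renewal(2)[OF that, of i] Henstock_Kurzweil_Integration.integral_combine[of 0 r' 1 h]
      integrable_continuous_real[OF h] that unfolding h_def[symmetric] by (simp add: algebra_simps)
  have "(weighted_char i has_vector_derivative 0 + (0 - h r)) (at r within {0..1})"
    by (rule has_vector_derivative_transform[OF r eq der])
  then show ?thesis by (simp add: h_def)
qed

lemma norm_weighted_char_le:
  assumes "0 \<le> r" shows "norm (weighted_char i r) \<le> 1"
proof -
  have "norm (weighted_char i r) \<le> 1 * 1"
    unfolding weighted_char_def norm_mult norm_weight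
    using norm_trans_char_le[of i r] al_pos[of i] assms by (intro mult_mono) (auto simp: mult_nonneg_nonneg)
  then show ?thesis by simp
qed

text \<open>Writing \<open>trans_char (\<not> i)\<close> as \<open>weighted_char\<close> over
  \<open>weight\<close> leaves the quotient of the two weights. Exactly one mode carries a phase, so
  the quotient oscillates with phase \<open>\<plusminus> antider\<close>, and the remaining
  amplitude is Lipschitz uniformly in \<open>\<xi>\<close>.\<close>

lemma trans_char_0:
  "trans_char i 0 = weight i 1 * of_bool (i = k)
    + integral {0..1} (\<lambda>u. iexp ((if i then 1 else - 1) * antider u)
        * (of_real (al i * exp ((al (\<not> i) - al i) * u)) * weighted_char (\<not> i) u))"
proof -
  have "trans_char i 0 = weighted_char i 0" by (simp add: weighted_char_def weight_def)
  also have "\<dots> = weight i 1 * of_bool (i = k) + integral {0..1} (\<lambda>u. al i * weight i u * trans_char (\<not> i) u)"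
    by (rule weighted_char_renewal(2)) simp
  also have "(\<lambda>u. al i * weight i u * trans_char (\<not> i) u) = (\<lambda>u. iexp ((if i then 1 else - 1) * antider u)
        * (of_real (al i * exp ((al (\<not> i) - al i) * u)) * weighted_char (\<not> i) u))"
  proof
    fix u
    have 1: "exp (- al i * u) = exp ((al (\<not> i) - al i) * u) * exp (- al (\<not> i) * u)"
      by (simp add: algebra_simps flip: exp_add)
    have 2: "iexp (of_bool i * antider u) = iexp ((if i then 1 else - 1) * antider u) * iexp (of_bool (\<not> i) * antider u)"
      by (cases i) (simp_all flip: exp_add)
    have "weight i u = iexp ((if i then 1 else - 1) * antider u) * (of_real (exp ((al (\<not> i) - al i) * u)) * weight (\<not> i) u)"
      unfolding weight_def arg_cong[OF 1, of complex_of_real, unfolded of_real_mult] 2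
      by (simp only: mult.assoc mult.left_commute)
    then show "al i * weight i u * trans_char (\<not> i) u = iexp ((if i then 1 else - 1) * antider u)
        * (of_real (al i * exp ((al (\<not> i) - al i) * u)) * weighted_char (\<not> i) u)"
      by (simp only: weighted_char_def of_real_mult mult.assoc mult.left_commute)
  qed
  finally show ?thesis .
qed

lemma inner_noise: "\<xi> \<bullet> noise i 1 e = phase i 0 e"
proof -
  have int: "integrable lborel (\<lambda>s. indicator {0..1} s *\<^sub>R (if state i s e then flow A (1 - s) b else 0))"
    by (rule flow_b_integrable) (use state_section_measurable[of i 0 e] in simp)
  have "\<xi> \<bullet> noise i 1 e = (\<integral>s. \<xi> \<bullet> (indicator {0..1} s *\<^sub>R (if state i s e then flow A (1 - s) b else 0)) \<partial>lborel)"
    unfolding noise_def by (rule integral_inner_right[symmetric]) (rule int)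
  also have "\<dots> = phase i 0 e"
    unfolding phase_def by (rule Bochner_Integration.integral_cong) (auto simp: speed_def of_bool_def)
  finally show ?thesis .
qed

end

end

section \<open>Smallness of the contribution of paths with a jump\<close>

context switching begin
text \<open>The diagonal term of \<open>trans_char_0\<close> belongs to the paths without a jump.
  The integral is small by \<open>oscillatory_integral_small\<close>, because the derivative of
  \<open>weighted_char\<close> contains no factor of the size of \<open>norm \<xi>\<close>.\<close>

theorem transition_char_small:
  assumes zeros: "\<And>\<theta>. \<theta> \<noteq> 0 \<Longrightarrow> countable {s. \<theta> \<bullet> flow A s b = 0}" and "\<epsilon> > 0"
  obtains R where "R > 0" "\<And>\<xi> i k. norm \<xi> \<ge> R \<Longrightarrow>
    norm (\<integral>e. iexp (\<xi> \<bullet> noise i 1 e) * of_bool (state i 1 e = k) \<partial>expos) \<le> exp (- al i) * of_bool (i = k) + \<epsilon>"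
proof -
  define a where "a = max (al True) (al False)"
  have a: "al i \<le> a" for i by (cases i) (simp_all add: a_def)
  have a0: "a > 0" using al_pos[of True] a[of True] by linarith
  \<comment> \<open>Common bound for the amplitude and its derivative:
    \<open>al i * exp (c * u)\<close> is at most \<open>a * exp a\<close>, \<open>Y\<close> is at
    most 1 and \<open>c * Y + Y'\<close> at most \<open>2 * a\<close>.\<close>
  define K where "K = a * exp a * (1 + 2 * a)"
  have K0: "K > 0" using a0 by (simp add: K_def add_pos_pos)
  define v where "v s = flow A (1 - s) b" for s
  define v' where "v' s = - flow A (1 - s) (A *v b)" for s
  have v: "(v has_vector_derivative v' s) (at s within {0..1})" for s
  proof -
    have "((\<lambda>s. flow A (1 - s) b) has_vector_derivative flow A (1 - s) (0 - A *v b)) (at s within {0..1})"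
      by (rule flow_comp_has_vector_derivative) (rule has_vector_derivative_const)
    then show ?thesis by (simp add: v_def[abs_def] v'_def flow_simps)
  qed
  have neg: "negligible {s \<in> {0..1}. \<theta> \<bullet> v s = 0}" if "\<theta> \<noteq> 0" for \<theta>
  proof -
    have "{s \<in> {0..1}. \<theta> \<bullet> v s = 0} \<subseteq> (\<lambda>s. 1 - s) ` {s. \<theta> \<bullet> flow A s b = 0}"
    proof
      fix s assume "s \<in> {s \<in> {0..1}. \<theta> \<bullet> v s = 0}"
      then have "1 - s \<in> {s. \<theta> \<bullet> flow A s b = 0}" by (simp add: v_def)
      from imageI[OF this, of "\<lambda>s. 1 - s"] show "s \<in> (\<lambda>s. 1 - s) ` {s. \<theta> \<bullet> flow A s b = 0}" by simp
    qed
    then have "countable {s \<in> {0..1}. \<theta> \<bullet> v s = 0}"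
      using zeros[OF that] countable_subset countable_image by meson
    then show ?thesis
      by (simp only: negligible_iff_null_sets null_sets_completionI countable_imp_null_set_lborel)
  qed
  define V where "V = exp (norm (endo_of_matrix A)) * norm (A *v b)"
  have V: "norm (v' s) \<le> V" if "s \<in> {0..1}" for s
  proof -
    have "norm (v' s) \<le> exp (\<bar>1 - s\<bar> * norm (endo_of_matrix A)) * norm (A *v b)"
      unfolding v'_def norm_minus_cancel by (rule norm_flow_le)
    also have "\<dots> \<le> V" unfolding V_def
      using that by (intro mult_right_mono) (auto intro!: mult_left_le_one_le)
    finally show ?thesis .
  qed
  show ?thesis
  proof (rule oscillatory_integral_small[of v v' V \<epsilon> K])
    show "(v has_vector_derivative v' s) (at s within {0..1})" for s by (rule v)
    show "norm (v' s) \<le> V" if "s \<in> {0..1}" for s using that by (rule V)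
    show "negligible {s \<in> {0..1}. \<theta> \<bullet> v s = 0}" if "\<theta> \<noteq> 0" for \<theta> using that by (rule neg)
    fix R :: real assume R: "R > 0" "\<And>\<xi> \<Phi> g g'. \<lbrakk>norm \<xi> \<ge> R;
       \<And>s. s \<in> {0..1} \<Longrightarrow> (\<Phi> has_real_derivative \<xi> \<bullet> v s) (at s within {0..1});
       \<And>s. s \<in> {0..1} \<Longrightarrow> (g has_vector_derivative g' s) (at s within {0..1});
       \<And>s. s \<in> {0..1} \<Longrightarrow> norm (g s) \<le> K; \<And>s. s \<in> {0..1} \<Longrightarrow> norm (g' s) \<le> K\<rbrakk>
     \<Longrightarrow> norm (integral {0..1} (\<lambda>s. iexp (\<Phi> s) * g s)) \<le> \<epsilon>"
    show thesis
  proof (rule that[OF R(1)])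
    fix \<xi> :: "real^'d" and i k assume \<xi>: "norm \<xi> \<ge> R"
    define Y where "Y = weighted_char \<xi> k (\<not> i)"
    define Y' where "Y' r = - (al (\<not> i) * weight \<xi> (\<not> i) r * trans_char \<xi> k i r)" for r
    define c where "c = al (\<not> i) - al i"
    have c: "\<bar>c\<bar> \<le> a" using a[of i] a[of "\<not> i"] al_pos[of i] al_pos[of "\<not> i"] by (simp add: c_def)
    define \<Phi> where "\<Phi> u = (if i then 1 else - 1) * antider \<xi> u" for u
    define g where "g u = of_real (al i * exp (c * u)) * Y u" for u
    define g' where "g' u = of_real (al i * exp (c * u)) * (c * Y u + Y' u)" for u
    have Y: "(Y has_vector_derivative Y' r) (at r within {0..1})" if "r \<in> {0..1}" for r
      using weighted_char_has_derivative[OF that, of \<xi> k "\<not> i"] by (simp add: Y_def Y'_def)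
    have Yn: "norm (Y r) \<le> 1" if "r \<in> {0..1}" for r
      using norm_weighted_char_le[of r \<xi> k "\<not> i"] that by (simp add: Y_def)
    have Y'n: "norm (Y' r) \<le> a" if "r \<in> {0..1}" for r
    proof -
      have "norm (Y' r) = al (\<not> i) * exp (- al (\<not> i) * r) * norm (trans_char \<xi> k i r)"
        using al_pos[of "\<not> i"] by (simp add: Y'_def norm_mult norm_weight)
      also have "\<dots> \<le> a * 1 * 1"
        using norm_trans_char_le[of \<xi> k i r] al_pos[of "\<not> i"] a[of "\<not> i"] that a0
        by (intro mult_mono) (auto simp: mult_nonneg_nonneg)
      finally show ?thesis by simp
    qed
    have ex: "exp (c * u) \<le> exp a" if "u \<in> {0..1}" for u
    proof -
      have "c * u \<le> \<bar>c\<bar> * 1" using that by (intro mult_mono) auto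
      then show ?thesis using c by simp
    qed
    have g: "(g has_vector_derivative g' s) (at s within {0..1})" if s: "s \<in> {0..1}" for s
    proof -
      have "((\<lambda>u. complex_of_real (al i * exp (c * u))) has_vector_derivative of_real (al i * exp (c * s) * c)) (at s within {0..1})"
      proof (rule bounded_linear.has_vector_derivative[OF bounded_linear_of_real])
        have "((\<lambda>u. al i * exp (c * u)) has_real_derivative al i * exp (c * s) * c) (at s within {0..1})"
          by (auto intro!: derivative_eq_intros)
        then show "((\<lambda>u. al i * exp (c * u)) has_vector_derivative al i * exp (c * s) * c) (at s within {0..1})"
          by (simp add: has_real_derivative_iff_has_vector_derivative)
      qed
      from has_vector_derivative_mult[OF this Y[OF s]] show ?thesis
        by (simp add: g_def[abs_def] g'_def algebra_simps)
    qed
    have gn: "norm (g s) \<le> K" if s: "s \<in> {0..1}" for s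
    proof -
      have "norm (g s) = al i * exp (c * s) * norm (Y s)"
        using al_pos[of i] by (simp add: g_def norm_mult)
      also have "\<dots> \<le> a * exp a * (1 + 2 * a)"
      proof (intro mult_mono)
        show "norm (Y s) \<le> 1 + 2 * a" using Yn[OF s] a0 by simp
      qed (use ex[OF s] a[of i] al_pos[of i] a0 in \<open>auto simp: less_imp_le\<close>)
      finally show ?thesis by (simp add: K_def)
    qed
    have g'n: "norm (g' s) \<le> K" if s: "s \<in> {0..1}" for s
    proof -
      have "norm (g' s) = al i * exp (c * s) * norm (c * Y s + Y' s)"
        using al_pos[of i] by (simp add: g'_def norm_mult)
      also have "\<dots> \<le> a * exp a * (1 + 2 * a)"
      proof (intro mult_mono)
        have "norm (c * Y s + Y' s) \<le> norm (c * Y s) + norm (Y' s)" by (rule norm_triangle_ineq)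
        also have "norm (c * Y s) \<le> a * 1" unfolding norm_mult norm_of_real
          using c Yn[OF s] by (intro mult_mono) auto
        finally show "norm (c * Y s + Y' s) \<le> 1 + 2 * a" using Y'n[OF s] by simp
      qed (use ex[OF s] a[of i] al_pos[of i] a0 in \<open>auto simp: less_imp_le\<close>)
      finally show ?thesis by (simp add: K_def)
    qed
    \<comment> \<open>In mode \<open>False\<close> the phase is negated, which amounts to the
      frequency \<open>- \<xi>\<close> of the same norm.\<close>
    have \<Phi>: "(\<Phi> has_real_derivative (if i then \<xi> else - \<xi>) \<bullet> v s) (at s within {0..1})" if "s \<in> {0..1}" for s
      using DERIV_cmult[OF antider_has_derivative[OF that, of \<xi>], of "if i then 1 else - 1"]
      by (cases i) (simp_all add: \<Phi>_def[abs_def] speed_def v_def)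
    have small: "norm (integral {0..1} (\<lambda>s. iexp (\<Phi> s) * g s)) \<le> \<epsilon>"
      by (rule R(2)[OF _ \<Phi> g gn g'n]) (use \<xi> in auto)
    have "(\<integral>e. iexp (\<xi> \<bullet> noise i 1 e) * of_bool (state i 1 e = k) \<partial>expos) = trans_char \<xi> k i 0"
      by (simp add: trans_char_def inner_noise)
    also have "\<dots> = weight \<xi> i 1 * of_bool (i = k) + integral {0..1} (\<lambda>s. iexp (\<Phi> s) * g s)"
      unfolding trans_char_0 \<Phi>_def g_def c_def Y_def by simp
    also have "norm \<dots> \<le> norm (weight \<xi> i 1 * of_bool (i = k)) + \<epsilon>"
      by (rule norm_triangle_le) (use small in simp)
    also have "norm (weight \<xi> i 1 * of_bool (i = k)) = exp (- al i) * of_bool (i = k)"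
      by (simp add: norm_mult norm_weight)
    finally show "norm (\<integral>e. iexp (\<xi> \<bullet> noise i 1 e) * of_bool (state i 1 e = k) \<partial>expos)
        \<le> exp (- al i) * of_bool (i = k) + \<epsilon>" .
  qed
  qed (use \<open>\<epsilon> > 0\<close> K0 in auto)
qed

end

section \<open>Integrability of the stationary characteristic functions\<close>

typedef 'a wellordered = "UNIV :: 'a set" by simp

instance wellordered :: (finite) finite
proof
  have "(UNIV :: 'a wellordered set) = Abs_wellordered ` UNIV"
    by (metis Abs_wellordered_cases UNIV_eq_I rangeI)
  then show "finite (UNIV :: 'a wellordered set)"
    using finite_imageI[OF finite[of "UNIV :: 'a set"], of Abs_wellordered] by metis
qed

instantiation wellordered :: (finite) wellorder
begin
definition less_eq_wellordered :: "'a wellordered \<Rightarrow> 'a wellordered \<Rightarrow> bool" where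
  "x \<le> y \<longleftrightarrow> to_nat (Rep_wellordered x) \<le> to_nat (Rep_wellordered y)"
definition less_wellordered :: "'a wellordered \<Rightarrow> 'a wellordered \<Rightarrow> bool" where
  "x < y \<longleftrightarrow> to_nat (Rep_wellordered x) < to_nat (Rep_wellordered y)"
instance
proof
  fix P :: "'a wellordered \<Rightarrow> bool" and a :: "'a wellordered"
  assume IH: "\<And>x. (\<And>y. y < x \<Longrightarrow> P y) \<Longrightarrow> P x"
  show "P a"
  proof (induction "to_nat (Rep_wellordered a)" arbitrary: a rule: less_induct)
    case less
    show ?case by (rule IH, rule less) (simp add: less_wellordered_def)
  qed
qed (auto simp: less_eq_wellordered_def less_wellordered_def Rep_wellordered_inject)
end

lemma bij_Rep_wellordered: "bij Rep_wellordered"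
proof (rule bijI)
  show "inj Rep_wellordered" by (simp add: inj_def Rep_wellordered_inject)
  show "surj Rep_wellordered" by (rule surjI[where f = Abs_wellordered]) (simp add: Abs_wellordered_inverse)
qed

lemma swapidseq_conj:
  assumes "swapidseq n p" "bij f"
  shows "swapidseq n (inv f \<circ> p \<circ> f)"
  using assms(1)
proof induction
  case id
  have eq: "inv f \<circ> id \<circ> f = id" using assms(2) by (simp add: fun_eq_iff bij_is_inj)
  show ?case unfolding eq by (rule swapidseq.id)
next
  case (comp_Suc n p a b)
  have eq: "inv f \<circ> (Transposition.transpose a b \<circ> p) \<circ> f = Transposition.transpose (inv f a) (inv f b) \<circ> (inv f \<circ> p \<circ> f)"
    using assms(2) by (auto simp: fun_eq_iff Transposition.transpose_def bij_is_surj surj_f_inv_f bij_is_inj inv_f_eq)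
      (metis bij_inv_eq_iff)+
  have ne: "inv f a \<noteq> inv f b" using comp_Suc.hyps assms(2) by (metis bij_is_surj surj_f_inv_f)
  show ?case unfolding eq by (rule swapidseq.comp_Suc[OF comp_Suc.IH ne])
qed

lemma sign_conj:
  fixes p :: "'a::finite \<Rightarrow> 'a" and f :: "'b::finite \<Rightarrow> 'a"
  assumes "p permutes UNIV" "bij f"
  shows "sign (inv f \<circ> p \<circ> f) = sign p"
proof -
  have "permutation p" using assms(1) by (auto simp: permutation_permutes)
  then obtain n where n: "swapidseq n p" unfolding permutation_def by blast
  have "evenperm (inv f \<circ> p \<circ> f) = even n"
    by (rule evenperm_unique[OF swapidseq_conj[OF n assms(2)] refl])
  moreover have "evenperm p = even n" by (rule evenperm_unique[OF n refl])
  ultimately show ?thesis by (simp add: sign_def)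
qed

text \<open>Conjugation by \<open>f\<close> matches the permutations of the two index types and
  preserves signs.\<close>

lemma det_reindex:
  fixes B :: "'r::comm_ring_1^'a^'a" and f :: "'b::finite \<Rightarrow> 'a"
  assumes f: "bij f"
  shows "det (\<chi> i j. B $ f i $ f j) = det B"
proof -
  define g where "g p = inv f \<circ> p \<circ> f" for p :: "'a \<Rightarrow> 'a"
  have fi: "f (inv f x) = x" "inv f (f y) = y" for x y
    using f by (simp_all add: bij_is_surj surj_f_inv_f bij_is_inj)
  have perm: "p permutes UNIV \<longleftrightarrow> bij p" for p :: "'c::finite \<Rightarrow> 'c"
    by (simp add: permutes_univ bij_iff) 
  have bg: "bij_betw g {p. p permutes UNIV} {p. p permutes UNIV}"
  proof (rule bij_betwI[where g = "\<lambda>q. f \<circ> q \<circ> inv f"])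
    show "g \<in> {p. p permutes UNIV} \<rightarrow> {p. p permutes UNIV}"
      using f by (auto simp: g_def perm intro!: bij_comp bij_imp_bij_inv)
    show "(\<lambda>q. f \<circ> q \<circ> inv f) \<in> {p. p permutes UNIV} \<rightarrow> {p. p permutes UNIV}"
      using f by (auto simp: perm intro!: bij_comp bij_imp_bij_inv)
  qed (auto simp: g_def fun_eq_iff fi)
  have "det (\<chi> i j. B $ f i $ f j) = (\<Sum>q | q permutes UNIV. of_int (sign q) * (\<Prod>i\<in>UNIV. B $ f i $ f (q i)))"
    by (simp add: det_def)
  also have "\<dots> = (\<Sum>p | p permutes UNIV. of_int (sign (g p)) * (\<Prod>i\<in>UNIV. B $ f i $ f (g p i)))"
    by (rule sum.reindex_bij_betw[OF bg, symmetric])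
  also have "\<dots> = (\<Sum>p | p permutes UNIV. of_int (sign p) * (\<Prod>i\<in>UNIV. B $ i $ p i))"
  proof (rule sum.cong[OF refl])
    fix p :: "'a \<Rightarrow> 'a" assume "p \<in> {p. p permutes UNIV}"
    then have "sign (g p) = sign p" unfolding g_def using sign_conj[OF _ f] by blast
    moreover have "(\<Prod>i\<in>UNIV. B $ f i $ f (g p i)) = (\<Prod>i\<in>UNIV. B $ i $ p i)"
      using prod.reindex_bij_betw[OF f, of "\<lambda>i. B $ i $ p i"] by (simp add: g_def fi)
    ultimately show "of_int (sign (g p)) * (\<Prod>i\<in>UNIV. B $ f i $ f (g p i)) = of_int (sign p) * (\<Prod>i\<in>UNIV. B $ i $ p i)"
      by simp
  qed
  finally show ?thesis by (simp add: det_def)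
qed

lemma prod_Basis_cart: "(\<Prod>b\<in>Basis. (x :: real^'n) \<bullet> b) = (\<Prod>i\<in>UNIV. x $ i)"
proof -
  have B: "(Basis :: (real^'n) set) = range (\<lambda>i. axis i 1)" by (auto simp: Basis_vec_def)
  have inj: "inj (\<lambda>i::'n. axis i (1::real))" by (auto simp: inj_def axis_eq_axis)
  have "(\<Prod>b\<in>Basis. x \<bullet> b) = (\<Prod>b\<in>range (\<lambda>i. axis i 1). x \<bullet> b)" by (simp only: B)
  also have "\<dots> = (\<Prod>i\<in>UNIV. x \<bullet> axis i 1)" by (rule prod.reindex_cong[OF inj]) auto
  finally show ?thesis by (simp add: inner_axis)
qed

lemma distr_reindex_lborel:
  fixes f :: "'b::finite \<Rightarrow> 'a::finite"
  assumes f: "bij f"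
  shows "distr lborel borel (\<lambda>x::real^'a. \<chi> i. x $ f i) = (lborel :: (real^'b) measure)"
proof (rule lborel_eqI[symmetric])
  fix l u :: "real^'b" assume lu: "\<And>b. b \<in> Basis \<Longrightarrow> l \<bullet> b \<le> u \<bullet> b"
  have fi: "f (inv f x) = x" "inv f (f y) = y" for x y
    using f by (simp_all add: bij_is_surj surj_f_inv_f bij_is_inj)
  define L U where "L = (\<chi> i. l $ inv f i)" and "U = (\<chi> i. u $ inv f i)"
  have "l $ i \<le> u $ i" for i using lu[of "axis i 1"] by (simp add: inner_axis axis_in_Basis_iff)
  then have LU: "b \<in> Basis \<Longrightarrow> L \<bullet> b \<le> U \<bullet> b" for b by (auto simp: Basis_vec_def inner_axis L_def U_def)
  have [measurable]: "(\<lambda>x::real^'a. (\<chi> i. x $ f i) :: real^'b) \<in> borel_measurable borel"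
    by (intro borel_measurable_continuous_onI continuous_on_vec_lambda continuous_intros)
  have "(\<lambda>x::real^'a. \<chi> i. x $ f i) -` box l u = box L U"
  proof (intro set_eqI iffI)
    fix x assume "x \<in> box L U"
    then have "l $ inv f i < x $ i" "x $ i < u $ inv f i" for i by (auto simp: mem_box_cart L_def U_def)
    from this[of "f _"] show "x \<in> (\<lambda>x::real^'a. \<chi> i. x $ f i) -` box l u" by (auto simp: mem_box_cart fi)
  next
    fix x assume "x \<in> (\<lambda>x::real^'a. \<chi> i. x $ f i) -` box l u"
    then have "l $ i < x $ f i" "x $ f i < u $ i" for i by (auto simp: mem_box_cart)
    from this[of "inv f _"] show "x \<in> box L U" by (auto simp: mem_box_cart fi L_def U_def)
  qed
  then have "emeasure (distr lborel borel (\<lambda>x::real^'a. \<chi> i. x $ f i)) (box l u) = emeasure lborel (box L U)"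
    by (simp add: emeasure_distr)
  also have "\<dots> = (\<Prod>b\<in>Basis. (U - L) \<bullet> b)"
    using LU by (simp add: emeasure_lborel_box)
  also have "(\<Prod>b\<in>Basis. (U - L) \<bullet> b) = (\<Prod>b\<in>Basis. (u - l) \<bullet> b)"
    unfolding prod_Basis_cart
    using prod.reindex_bij_betw[OF f, of "\<lambda>i. (U - L) $ i"] by (simp add: U_def L_def fi)
  finally show "emeasure (distr lborel borel (\<lambda>x::real^'a. \<chi> i. x $ f i)) (box l u) = (\<Prod>b\<in>Basis. (u - l) \<bullet> b)" .
qed simp

text \<open>
  The change of variables formula of the library asks for a well-ordered index type. Any finite index type
  can be replaced by a well-ordered copy of it.
\<close>

lemma emeasure_linear_image:
  fixes f :: "real^'d \<Rightarrow> real^'d"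
  assumes f: "linear f" and S: "bounded S" "S \<in> sets borel" and fS: "f ` S \<in> sets borel"
  shows "emeasure lborel (f ` S) = ennreal (\<bar>det (matrix f)\<bar> * measure lborel S)"
proof -
  define P :: "real^'d \<Rightarrow> real^'d wellordered" where "P x = (\<chi> i. x $ Rep_wellordered i)" for x
  define Q :: "real^'d wellordered \<Rightarrow> real^'d" where "Q y = (\<chi> i. y $ Abs_wellordered i)" for y
  have PQ: "P (Q y) = y" "Q (P x) = x" for x y
    by (simp_all add: P_def Q_def Rep_wellordered_inverse Abs_wellordered_inverse vec_eq_iff)
  have linP: "linear P" and linQ: "linear Q" by (auto intro!: linearI simp: P_def Q_def vec_eq_iff)
  have Pm [measurable]: "P \<in> borel_measurable borel" and Qm [measurable]: "Q \<in> borel_measurable borel"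
    using linP linQ by (auto intro!: borel_measurable_continuous_onI linear_continuous_on simp: linear_conv_bounded_linear)
  have em: "emeasure lborel (P ` E) = emeasure lborel E" and Pb: "P ` E \<in> sets borel" if E: "E \<in> sets borel" for E
  proof -
    have PE: "P ` E = Q -` E" using PQ by (auto simp: image_iff) (metis PQ(1))
    show Pb: "P ` E \<in> sets borel" using measurable_sets[OF Qm E] by (simp add: PE)
    have "distr lborel borel P = lborel"
      unfolding P_def[abs_def] by (rule distr_reindex_lborel[OF bij_Rep_wellordered])
    then have "emeasure lborel (P ` E) = emeasure (distr lborel borel P) (P ` E)" by (simp only:)
    also have "\<dots> = emeasure lborel (P -` (P ` E))" using Pb by (simp add: emeasure_distr)
    also have "P -` (P ` E) = E" using PQ by (auto simp: image_iff) (metis PQ(2))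
    finally show "emeasure lborel (P ` E) = emeasure lborel E" .
  qed
  define f' where "f' = P \<circ> f \<circ> Q"
  have lf': "linear f'" unfolding f'_def by (intro linear_compose linP linQ f)
  have img: "f' ` (P ` S) = P ` (f ` S)" by (auto simp: f'_def PQ image_image)
  have det: "det (matrix f') = det (matrix f)"
  proof -
    have Qa: "Q (axis j 1) = axis (Rep_wellordered j) 1" for j
      by (auto simp: Q_def vec_eq_iff axis_def Abs_wellordered_inverse Rep_wellordered_inverse)
    have "matrix f' = (\<chi> i j. matrix f $ Rep_wellordered i $ Rep_wellordered j)"
      unfolding matrix_def f'_def o_def Qa P_def by (simp add: vec_eq_iff)
    then show ?thesis by (simp only: det_reindex[OF bij_Rep_wellordered])
  qed
  have PS: "P ` S \<in> lmeasurable"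
  proof (rule bounded_set_imp_lmeasurable)
    show "bounded (P ` S)" using S(1) linP by (simp add: bounded_linear_image linear_conv_bounded_linear)
    show "P ` S \<in> sets lebesgue" using Pb[OF S(2)] by simp
  qed
  have "emeasure lborel (f ` S) = emeasure lborel (f' ` (P ` S))" using em[OF fS] img by simp
  also have "\<dots> = emeasure lebesgue (f' ` (P ` S))" using Pb[OF fS] img by simp
  also have "\<dots> = ennreal (measure lebesgue (f' ` (P ` S)))"
    using measurable_linear_image[OF lf' PS] by (simp add: emeasure_eq_measure2)
  also have "measure lebesgue (f' ` (P ` S)) = \<bar>det (matrix f)\<bar> * measure lebesgue (P ` S)"
    using measure_linear_image[OF lf' PS] by (simp add: det)
  also have "measure lebesgue (P ` S) = measure lborel S"
    using Pb[OF S(2)] em[OF S(2)] by (simp add: measure_def)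
  finally show ?thesis .
qed

section \<open>Summation over frequency ellipsoids\<close>

text \<open>The square of \<open>norm (adjoint f y)\<close> is
  \<open>f (adjoint f y) \<bullet> y\<close>, so bounds for the flow pass to its transpose with the
  same constant.\<close>

lemma norm_adjoint_le:
  fixes f :: "'a::euclidean_space \<Rightarrow> 'a"
  assumes f: "linear f" and K: "\<And>x. norm (f x) \<le> K * norm x"
  shows "norm (adjoint f y) \<le> K * norm y"
proof (cases "adjoint f y = 0")
  case True
  have "0 \<le> K * norm y" using order_trans[OF norm_ge_zero K] .
  then show ?thesis using True by simp
next
  case False
  have "norm (adjoint f y) * norm (adjoint f y) = adjoint f y \<bullet> adjoint f y"
    by (simp add: power2_norm_eq_inner[symmetric] power2_eq_square)
  also have "\<dots> = f (adjoint f y) \<bullet> y" by (rule adjoint_works[OF f])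
  also have "\<dots> \<le> norm (f (adjoint f y)) * norm y" by (rule norm_cauchy_schwarz)
  also have "\<dots> \<le> (K * norm (adjoint f y)) * norm y" by (intro mult_right_mono K) auto
  finally have "norm (adjoint f y) * norm (adjoint f y) \<le> (K * norm y) * norm (adjoint f y)" by (simp add: mult_ac)
  then show ?thesis using False by simp
qed

text \<open>
  Decomposition of frequency space according to the number of steps of \<open>T = e\<^bsup>A\<^esup>\<close> (transposed) needed to
  enter the ball of radius \<open>R\<close>.
\<close>

lemma integrable_geometric_decay:
  fixes T S :: "nat \<Rightarrow> real^'d \<Rightarrow> real^'d" and g :: "real^'d \<Rightarrow> real"
  assumes g [measurable]: "g \<in> borel_measurable borel" and g01: "\<And>\<xi>. 0 \<le> g \<xi>" "\<And>\<xi>. g \<xi> \<le> 1"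
    and S: "\<And>n. linear (S n)" "\<And>n. linear (T n)" and ST: "\<And>n \<xi>. S n (T n \<xi>) = \<xi>" "\<And>n \<xi>. T n (S n \<xi>) = \<xi>"
    and T0: "\<And>\<xi>. (\<lambda>n. T n \<xi>) \<longlonglongrightarrow> 0"
    and T_0: "\<And>\<xi>. T 0 \<xi> = \<xi>"
    and decay: "\<And>n \<xi>. norm (T n \<xi>) \<ge> R \<Longrightarrow> g (T n \<xi>) \<le> \<kappa> * g (T (Suc n) \<xi>)"
    and S_le: "\<And>n \<xi>. norm (S n \<xi>) \<le> C * \<rho> ^ n * norm \<xi>"
    and det: "\<And>n. \<bar>det (matrix (S n))\<bar> = \<delta> ^ n"
    and pos: "R > 0" "\<kappa> \<ge> 0" "\<rho> \<ge> 1" "C \<ge> 0" "\<delta> \<ge> 0" and small: "\<kappa> * \<rho> ^ r * \<delta> < 1"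
  shows "integrable lborel (\<lambda>\<xi>. (1 + norm \<xi>) ^ r * g \<xi>)"
proof -
  \<comment> \<open>The full ellipsoid rather than the shell of first entrance: overlaps merely
    enlarge the upper bound, and the volume is explicit.\<close>
  define B where "B n = S n ` ball 0 R" for n
  have B_eq: "B n = T n -` ball 0 R" for n
    using ST by (auto simp: B_def image_iff) (metis mem_ball_0 ST(1))
  have B_open: "open (B n)" for n
    unfolding B_eq by (rule open_vimage) (auto intro!: linear_continuous_on linear_conv_bounded_linear[THEN iffD1] S)
  have [measurable]: "B n \<in> sets borel" for n using B_open by simp
  define V where "V = measure lborel (ball (0::real^'d) R)"
  have emB: "emeasure lborel (B n) = ennreal (\<delta> ^ n * V)" for n
    unfolding B_def V_def
    using emeasure_linear_image[OF S(1), of "ball 0 R" n] det[of n] B_open[of n] by (simp add: B_def)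
  \<comment> \<open>Bound for the integrand where \<open>T n \<xi>\<close> is the first iterate in
    the ball: there \<open>g \<xi> \<le> \<kappa> ^ n\<close> and
    \<open>1 + norm \<xi> \<le> (1 + C * R) * \<rho> ^ n\<close>.\<close>
  define w where "w n = \<kappa> ^ n * ((1 + C * R) * \<rho> ^ n) ^ r" for n
  have w0: "w n \<ge> 0" for n using pos by (simp add: w_def)
  have le: "ennreal ((1 + norm \<xi>) ^ r * g \<xi>) \<le> (\<Sum>n. ennreal (w n) * indicator (B n) \<xi>)" for \<xi>
  proof -
    have "\<exists>n. norm (T n \<xi>) < R"
    proof -
      have "(\<lambda>n. norm (T n \<xi>)) \<longlonglongrightarrow> 0" using tendsto_norm[OF T0[of \<xi>]] by simp
      then have "\<forall>\<^sub>F n in sequentially. norm (T n \<xi>) < R" using pos(1) by (rule order_tendstoD)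
      then show ?thesis by (auto simp: eventually_sequentially)
    qed
    then obtain n where n: "norm (T n \<xi>) < R" "\<And>m. m < n \<Longrightarrow> R \<le> norm (T m \<xi>)"
      using exists_least_iff[of "\<lambda>n. norm (T n \<xi>) < R"] by (auto simp: not_less)
    have "g \<xi> \<le> \<kappa> ^ m * g (T m \<xi>)" if "m \<le> n" for m
      using that
    proof (induction m)
      case (Suc m)
      then have "g \<xi> \<le> \<kappa> ^ m * g (T m \<xi>)" by simp
      also have "\<dots> \<le> \<kappa> ^ m * (\<kappa> * g (T (Suc m) \<xi>))"
        using Suc.prems n(2) pos(2) by (intro mult_left_mono decay) auto
      finally show ?case by (simp add: mult_ac)
    qed (simp add: T_0)
    from this[of n] have "g \<xi> \<le> \<kappa> ^ n * g (T n \<xi>)" by simp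
    also have "\<dots> \<le> \<kappa> ^ n * 1" using g01 pos(2) by (intro mult_left_mono) auto
    finally have g_le: "g \<xi> \<le> \<kappa> ^ n" by simp
    have "norm \<xi> \<le> C * \<rho> ^ n * norm (T n \<xi>)" using S_le[of n "T n \<xi>"] by (simp add: ST)
    also have "\<dots> \<le> C * \<rho> ^ n * R" using n(1) pos by (intro mult_left_mono) auto
    finally have "1 + norm \<xi> \<le> \<rho> ^ n + C * \<rho> ^ n * R" using one_le_power[OF pos(3), of n] by linarith
    then have "1 + norm \<xi> \<le> (1 + C * R) * \<rho> ^ n" by (simp add: algebra_simps)
    then have "(1 + norm \<xi>) ^ r * g \<xi> \<le> ((1 + C * R) * \<rho> ^ n) ^ r * \<kappa> ^ n"
      using g_le g01 pos by (intro mult_mono power_mono) auto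
    also have "\<dots> = w n" by (simp add: w_def mult.commute)
    finally have "ennreal ((1 + norm \<xi>) ^ r * g \<xi>) \<le> ennreal (w n) * indicator (B n) \<xi>"
      using n(1) by (simp add: B_eq ennreal_leI)
    also have "\<dots> = sum (\<lambda>k. ennreal (w k) * indicator (B k) \<xi>) {n}"
      by (simp only: sum.insert finite.emptyI empty_iff not_False_eq_True sum.empty add_0_right)
    also have "\<dots> \<le> (\<Sum>n. ennreal (w n) * indicator (B n) \<xi>)" by (rule sum_le_suminf) auto
    finally show ?thesis .
  qed
  \<comment> \<open>Ratio of the dominating geometric series: decay, weight and volume gained per
    step.\<close>
  define q where "q = \<kappa> * \<rho> ^ r * \<delta>"
  have q: "0 \<le> q" "q < 1" using small pos by (simp_all add: q_def)
  have "(\<integral>\<^sup>+\<xi>. ennreal ((1 + norm \<xi>) ^ r * g \<xi>) \<partial>lborel) \<le> (\<integral>\<^sup>+\<xi>. (\<Sum>n. ennreal (w n) * indicator (B n) \<xi>) \<partial>lborel)"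
    by (intro nn_integral_mono le)
  also have "\<dots> = (\<Sum>n. \<integral>\<^sup>+\<xi>. ennreal (w n) * indicator (B n) \<xi> \<partial>lborel)"
    by (rule nn_integral_suminf) measurable
  also have "\<dots> = (\<Sum>n. ennreal ((1 + C * R) ^ r * V * q ^ n))"
  proof (rule suminf_cong)
    fix n
    have "(\<integral>\<^sup>+\<xi>. ennreal (w n) * indicator (B n) \<xi> \<partial>lborel) = ennreal (w n) * ennreal (\<delta> ^ n * V)"
      by (simp add: nn_integral_cmult emB)
    also have "\<dots> = ennreal (w n * (\<delta> ^ n * V))" using w0 pos by (simp add: ennreal_mult V_def)
    also have "w n * (\<delta> ^ n * V) = (1 + C * R) ^ r * V * q ^ n"
      by (simp add: w_def q_def power_mult_distrib power_mult[symmetric] mult_ac)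
    finally show "(\<integral>\<^sup>+\<xi>. ennreal (w n) * indicator (B n) \<xi> \<partial>lborel) = ennreal ((1 + C * R) ^ r * V * q ^ n)" .
  qed
  also have "\<dots> < \<infinity>"
  proof -
    have "summable (\<lambda>n. (1 + C * R) ^ r * V * q ^ n)"
      using q by (intro summable_mult summable_geometric) simp
    then have "(\<Sum>n. ennreal ((1 + C * R) ^ r * V * q ^ n)) = ennreal (\<Sum>n. (1 + C * R) ^ r * V * q ^ n)"
      using q pos by (intro suminf_ennreal2) (auto simp: V_def)
    then show ?thesis by simp
  qed
  finally have "(\<integral>\<^sup>+\<xi>. ennreal (norm ((1 + norm \<xi>) ^ r * g \<xi>)) \<partial>lborel) < \<infinity>"
    using g01 by simp
  then show ?thesis by (intro integrableI_bounded) auto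
qed

section \<open>Stationary measures and their characteristic functions\<close>

locale stationary = switching al A p
  for al :: "bool \<Rightarrow> real" and A :: "real^'d^'d" and p :: "real^'d" +
  fixes \<mu> :: "((real^'d) \<times> bool) measure"
  assumes \<mu>_prob: "prob_space \<mu>"
    and \<mu>_sets [measurable_cong]: "sets \<mu> = sets (borel \<Otimes>\<^sub>M count_space UNIV)"
    and invariance: "\<And>t f. t \<ge> 0 \<Longrightarrow> f \<in> borel_measurable (borel \<Otimes>\<^sub>M count_space UNIV) \<Longrightarrow> bounded (range f) \<Longrightarrow>
      (\<integral>z. (\<integral>e. f (flow A t (fst z) + noise (snd z) t e, state (snd z) t e) \<partial>expos) \<partial>\<mu>) = (\<integral>z. f z \<partial>\<mu> :: real)"
begin

sublocale \<mu>: prob_space \<mu> by (rule \<mu>_prob)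

lemma space_\<mu> [simp]: "space \<mu> = UNIV"
  using sets_eq_imp_space_eq[OF \<mu>_sets] by (simp add: space_pair_measure)

lemma fst_measurable [measurable]: "fst \<in> borel_measurable \<mu>"
  and snd_measurable [measurable]: "snd \<in> \<mu> \<rightarrow>\<^sub>M count_space UNIV"
  unfolding measurable_cong_sets[OF \<mu>_sets refl] by auto

definition marg :: "bool \<Rightarrow> (real^'d) measure" where
  "marg j = distr (density \<mu> (\<lambda>z. indicator {z. snd z = j} z)) borel fst"

lemma snd_set [measurable]: "{z. snd z = j} \<in> sets \<mu>"
  using measurable_sets[OF snd_measurable, of "{j}"] by (simp add: vimage_def)

lemma emeasure_marg:
  assumes [measurable]: "B \<in> sets borel"
  shows "emeasure (marg j) B = emeasure \<mu> (B \<times> {j})"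
proof -
  have fm: "fst -` B \<in> sets \<mu>" using measurable_sets[OF fst_measurable assms] by simp
  have "emeasure (marg j) B = (\<integral>\<^sup>+z. indicator {z. snd z = j} z * indicator (fst -` B) z \<partial>\<mu>)"
    unfolding marg_def using fm by (simp add: emeasure_distr emeasure_density)
  also have "\<dots> = (\<integral>\<^sup>+z. indicator (B \<times> {j}) z \<partial>\<mu>)"
    by (rule nn_integral_cong) (auto simp: indicator_def)
  also have "\<dots> = emeasure \<mu> (B \<times> {j})"
  proof (rule nn_integral_indicator)
    have "B \<times> {j} = fst -` B \<inter> {z. snd z = j}" by auto
    then show "B \<times> {j} \<in> sets \<mu>" using fm by auto
  qed
  finally show ?thesis .
qed

sublocale marg: finite_borel "marg j" for j
proof (intro finite_borel.intro finite_borel_axioms.intro finite_measureI)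
  show "emeasure (marg j) (space (marg j)) \<noteq> \<infinity>"
    using emeasure_marg[of UNIV j] by (simp add: marg_def \<mu>.emeasure_eq_measure)
  show "sets (marg j) = sets borel" by (simp add: marg_def)
qed

lemma integral_marg:
  fixes f :: "real^'d \<Rightarrow> 'b::{banach, second_countable_topology}"
  assumes [measurable]: "f \<in> borel_measurable borel"
  shows "(\<integral>x. f x \<partial>marg j) = (\<integral>z. of_bool (snd z = j) *\<^sub>R f (fst z) \<partial>\<mu>)"
proof -
  have "(\<integral>x. f x \<partial>marg j) = (\<integral>z. f (fst z) \<partial>density \<mu> (\<lambda>z. ennreal (indicator {z. snd z = j} z)))"
    unfolding marg_def by (subst integral_distr) (auto simp: ennreal_indicator)
  also have "\<dots> = (\<integral>z. indicator {z. snd z = j} z *\<^sub>R f (fst z) \<partial>\<mu>)"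
    by (rule integral_density) (auto simp: measurable_compose[OF fst_measurable])
  also have "\<dots> = (\<integral>z. of_bool (snd z = j) *\<^sub>R f (fst z) \<partial>\<mu>)"
    by (intro Bochner_Integration.integral_cong) (auto simp: indicator_def)
  finally show ?thesis .
qed

lemma noise_state_measurable [measurable]:
  fixes f :: "(real^'d) \<times> bool \<Rightarrow> 'b::{banach, second_countable_topology}"
  assumes [measurable]: "f \<in> borel_measurable (borel \<Otimes>\<^sub>M count_space UNIV)"
  shows "(\<lambda>q. f (flow A t (fst (fst q)) + noise (snd (fst q)) t (snd q), state (snd (fst q)) t (snd q)))
    \<in> borel_measurable (\<mu> \<Otimes>\<^sub>M expos)"
proof -
  have [measurable]: "(\<lambda>q. snd (fst q)) \<in> \<mu> \<Otimes>\<^sub>M expos \<rightarrow>\<^sub>M count_space UNIV"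
    "(\<lambda>q. fst (fst q)) \<in> borel_measurable (\<mu> \<Otimes>\<^sub>M expos)"
    by (rule measurable_compose[OF measurable_fst snd_measurable], rule measurable_compose[OF measurable_fst fst_measurable])
  \<comment> \<open>\<open>noise\<close> and \<open>state\<close> are measurable for each fixed
    mode; the case distinction makes them jointly measurable in the mode as well.\<close>
  have [measurable]: "(\<lambda>q. if snd (fst q) then noise True t (snd q) else noise False t (snd q)) \<in> borel_measurable (\<mu> \<Otimes>\<^sub>M expos)"
    "(\<lambda>q. if snd (fst q) then state True t (snd q) else state False t (snd q)) \<in> \<mu> \<Otimes>\<^sub>M expos \<rightarrow>\<^sub>M count_space UNIV"
    by measurable
  have "(\<lambda>q. f (flow A t (fst (fst q)) + (if snd (fst q) then noise True t (snd q) else noise False t (snd q)),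
      if snd (fst q) then state True t (snd q) else state False t (snd q))) \<in> borel_measurable (\<mu> \<Otimes>\<^sub>M expos)"
    by measurable
  moreover have "(if i then noise True t e else noise False t e) = noise i t e"
    "(if i then state True t e else state False t e) = state i t e" for i e
    by (cases i; simp)+
  ultimately show ?thesis by simp
qed

lemma invariance_complex:
  fixes f :: "(real^'d) \<times> bool \<Rightarrow> complex"
  assumes t: "t \<ge> 0" and f [measurable]: "f \<in> borel_measurable (borel \<Otimes>\<^sub>M count_space UNIV)" and B: "\<And>z. norm (f z) \<le> B"
  shows "(\<integral>z. (\<integral>e. f (flow A t (fst z) + noise (snd z) t e, state (snd z) t e) \<partial>expos) \<partial>\<mu>) = (\<integral>z. f z \<partial>\<mu>)"
proof -
  define F where "F z e = f (flow A t (fst z) + noise (snd z) t e, state (snd z) t e)" for z e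
  have Fm: "(\<lambda>(z, e). F z e) \<in> borel_measurable (\<mu> \<Otimes>\<^sub>M expos)"
    using noise_state_measurable[OF f] by (simp add: F_def case_prod_beta')
  have Fz: "integrable expos (F z)" for z
  proof (rule stream.P.integrable_const_bound[where B = B])
    show "F z \<in> borel_measurable expos" using measurable_Pair2[OF Fm, of z] by simp
  qed (simp add: F_def B)
  have FF: "integrable \<mu> (\<lambda>z. \<integral>e. F z e \<partial>expos)"
  proof (rule \<mu>.integrable_const_bound[where B = B])
    show "AE z in \<mu>. norm (\<integral>e. F z e \<partial>expos) \<le> B"
    proof (rule AE_I2)
      fix z
      have "norm (\<integral>e. F z e \<partial>expos) \<le> (\<integral>e. norm (F z e) \<partial>expos)" by (rule integral_norm_bound)
      also have "\<dots> \<le> B" by (intro stream.P.integral_le_const integrable_norm Fz AE_I2) (simp add: F_def B)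
      finally show "norm (\<integral>e. F z e \<partial>expos) \<le> B" .
    qed
    show "(\<lambda>z. \<integral>e. F z e \<partial>expos) \<in> borel_measurable \<mu>"
      by (rule stream.P.borel_measurable_lebesgue_integral[OF Fm])
  qed
  have fi: "integrable \<mu> f"
    by (rule \<mu>.integrable_const_bound[where B = B]) (use f in \<open>auto simp: B measurable_cong_sets[OF \<mu>_sets refl]\<close>)
  have bRe: "bounded (range (\<lambda>z. Re (f z)))" and bIm: "bounded (range (\<lambda>z. Im (f z)))"
    by (auto simp: bounded_iff intro!: exI[of _ B] order_trans[OF abs_Re_le_cmod B] order_trans[OF abs_Im_le_cmod B])
  have "(\<integral>z. (\<integral>e. Re (F z e) \<partial>expos) \<partial>\<mu>) = (\<integral>z. Re (f z) \<partial>\<mu>)"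
    unfolding F_def by (rule invariance[OF t _ bRe]) measurable
  moreover have "(\<integral>z. (\<integral>e. Im (F z e) \<partial>expos) \<partial>\<mu>) = (\<integral>z. Im (f z) \<partial>\<mu>)"
    unfolding F_def by (rule invariance[OF t _ bIm]) measurable
  ultimately have "(\<integral>z. (\<integral>e. F z e \<partial>expos) \<partial>\<mu>) = (\<integral>z. f z \<partial>\<mu>)"
    by (simp add: complex_eq_iff integral_Re[OF Fz] integral_Im[OF Fz] integral_Re[OF FF, symmetric]
        integral_Im[OF FF, symmetric] integral_Re[OF fi, symmetric] integral_Im[OF fi, symmetric])
  then show ?thesis by (simp add: F_def)
qed

text \<open>Invariance at time 1, tested on the plane wave with frequency \<open>\<xi>\<close>
  restricted to mode \<open>k\<close>. The noise depends on the starting mode but not on the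
  position, so the exponential factorises.\<close>

lemma cfun_marg_transition:
  "cfun (marg k) \<xi> = (\<Sum>i\<in>UNIV. (\<integral>e. iexp (\<xi> \<bullet> noise i 1 e) * of_bool (state i 1 e = k) \<partial>expos)
     * cfun (marg i) (adjoint (flow A 1) \<xi>))"
proof -
  define u where "u i = (\<integral>e. iexp (\<xi> \<bullet> noise i 1 e) * of_bool (state i 1 e = k) \<partial>expos)" for i
  define T where "T = adjoint (flow A 1) \<xi>"
  have T: "\<xi> \<bullet> flow A 1 x = T \<bullet> x" for x
    using adjoint_works[OF linear_flow, of x A 1 \<xi>] by (simp add: T_def inner_commute)
  define f where "f z = of_bool (snd z = k) *\<^sub>R iexp (\<xi> \<bullet> fst z)" for z :: "(real^'d) \<times> bool"
  have f: "f \<in> borel_measurable (borel \<Otimes>\<^sub>M count_space UNIV)" unfolding f_def by measurable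
  have "cfun (marg k) \<xi> = (\<integral>z. f z \<partial>\<mu>)"
    unfolding cfun_def f_def by (rule integral_marg) measurable
  also have "\<dots> = (\<integral>z. (\<integral>e. f (flow A 1 (fst z) + noise (snd z) 1 e, state (snd z) 1 e) \<partial>expos) \<partial>\<mu>)"
    by (rule invariance_complex[symmetric, where B = 1]) (use f in \<open>auto simp: f_def\<close>)
  also have "\<dots> = (\<integral>z. (\<Sum>i\<in>UNIV. u i * (of_bool (snd z = i) *\<^sub>R iexp (T \<bullet> fst z))) \<partial>\<mu>)"
  proof (rule Bochner_Integration.integral_cong[OF refl])
    fix z
    have "(\<integral>e. f (flow A 1 (fst z) + noise (snd z) 1 e, state (snd z) 1 e) \<partial>expos)
        = (\<integral>e. iexp (T \<bullet> fst z) * (iexp (\<xi> \<bullet> noise (snd z) 1 e) * of_bool (state (snd z) 1 e = k)) \<partial>expos)"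
      by (rule Bochner_Integration.integral_cong[OF refl])
        (simp add: f_def inner_add_right T distrib_left exp_add scaleR_conv_of_real)
    also have "\<dots> = iexp (T \<bullet> fst z) * u (snd z)" by (simp add: u_def)
    also have "\<dots> = (\<Sum>i\<in>UNIV. u i * (of_bool (snd z = i) *\<^sub>R iexp (T \<bullet> fst z)))"
      by (cases "snd z") (simp_all add: UNIV_bool mult.commute)
    finally show "(\<integral>e. f (flow A 1 (fst z) + noise (snd z) 1 e, state (snd z) 1 e) \<partial>expos)
        = (\<Sum>i\<in>UNIV. u i * (of_bool (snd z = i) *\<^sub>R iexp (T \<bullet> fst z)))" .
  qed
  also have "\<dots> = (\<Sum>i\<in>UNIV. (\<integral>z. u i * (of_bool (snd z = i) *\<^sub>R iexp (T \<bullet> fst z)) \<partial>\<mu>))"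
  proof (rule Bochner_Integration.integral_sum)
    fix i :: bool
    have m: "(\<lambda>z. of_bool (snd z = i) *\<^sub>R iexp (T \<bullet> fst z)) \<in> borel_measurable (borel \<Otimes>\<^sub>M count_space UNIV)" by measurable
    show "integrable \<mu> (\<lambda>z. u i * (of_bool (snd z = i) *\<^sub>R iexp (T \<bullet> fst z)))"
      by (intro integrable_mult_right \<mu>.integrable_const_bound[where B = 1])
        (use m in \<open>auto simp: measurable_cong_sets[OF \<mu>_sets refl]\<close>)
  qed
  also have "\<dots> = (\<Sum>i\<in>UNIV. u i * cfun (marg i) T)"
  proof -
    have "cfun (marg i) T = (\<integral>z. of_bool (snd z = i) *\<^sub>R iexp (T \<bullet> fst z) \<partial>\<mu>)" for i
      unfolding cfun_def by (rule integral_marg) measurable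
    then show ?thesis by (simp only: integral_mult_right_zero)
  qed
  finally show ?thesis by (simp add: u_def T_def)
qed

end

lemma adjoint_flow_inner: "adjoint (flow A t) \<xi> \<bullet> x = \<xi> \<bullet> flow A t x"
  using adjoint_works[OF linear_flow, of x A t \<xi>] by (simp add: inner_commute)

lemma adjoint_flow_add: "adjoint (flow A s) (adjoint (flow A t) \<xi>) = adjoint (flow A (s + t)) \<xi>"
proof -
  have "adjoint (flow A s) (adjoint (flow A t) \<xi>) \<bullet> x = adjoint (flow A (s + t)) \<xi> \<bullet> x" for x
    by (simp add: adjoint_flow_inner add.commute[of s t] flow_add)
  then show ?thesis using vector_eq_rdot by blast
qed

lemma adjoint_flow_0 [simp]: "adjoint (flow A 0) \<xi> = \<xi>"
proof -
  have "adjoint (flow A 0) \<xi> \<bullet> x = \<xi> \<bullet> x" for x by (simp add: adjoint_flow_inner)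
  then show ?thesis using vector_eq_rdot by blast
qed

lemma flow_uminus: "flow (- A) t = flow A (- t)"
  using flow_mult_left[of "- 1" A t] by simp

lemma (in stationary) measure_marg_le_1: "measure (marg j) B \<le> 1"
proof -
  have "measure (marg j) B \<le> measure (marg j) UNIV"
    using marg.bounded_measure[of j B] by simp
  also have "\<dots> = measure \<mu> (UNIV \<times> {j})" by (simp add: measure_def emeasure_marg)
  also have "\<dots> \<le> 1" by (rule \<mu>.prob_le_1)
  finally show ?thesis .
qed

text \<open>\<open>cfun_marg_transition\<close> and \<open>transition_char_small\<close> give the
  decay \<open>\<kappa>\<close> per step, the spectrum gives the expansion \<open>\<rho>\<close> and
  the volume factor, and the assumption on \<open>m\<close> makes the product in
  \<open>integrable_geometric_decay\<close> less than 1.\<close>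

lemma (in stationary) integrable_cfun_weighted:
  fixes \<Lambda> :: "nat \<Rightarrow> real"
  assumes spec: "spectrum A \<Lambda>" and mono: "mono_on {1..CARD('d)} \<Lambda>" and neg: "\<Lambda> CARD('d) < 0"
    and zeros: "\<And>\<theta>. \<theta> \<noteq> 0 \<Longrightarrow> countable {s. \<theta> \<bullet> flow A s b = 0}"
    and m: "\<And>i. m \<le> al i" "m > - ((\<Sum>i=1..CARD('d). \<Lambda> i) + real r * \<Lambda> 1)"
  shows "integrable lborel (\<lambda>\<xi>. (1 + norm \<xi>) ^ r * norm (cfun (marg k) \<xi>))"
proof -
  interpret spectrum A \<Lambda> by (rule spec)
  have d1: "1 \<le> CARD('d)" by (simp add: Suc_leI)
  have \<Lambda>_le: "\<Lambda> k \<le> \<Lambda> CARD('d)" "\<Lambda> 1 \<le> \<Lambda> k" if "k \<in> {1..CARD('d)}" for k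
    using that d1 by (auto intro!: mono_onD[OF mono])
  define \<tau> where "\<tau> = (\<Sum>i=1..CARD('d). \<Lambda> i)"
  \<comment> \<open>Half the gap \<open>m + \<tau> + real r * \<Lambda> 1\<close>, divided by the
    number of times that \<open>\<eta>\<close> is spent: once in \<open>\<kappa>\<close> and once
    for each of the \<open>r\<close> powers of \<open>\<rho>\<close>.\<close>
  define \<eta> where "\<eta> = (m + \<tau> + real r * \<Lambda> 1) / (2 * (1 + real r))"
  have \<eta>: "\<eta> > 0" using m(2) by (simp add: \<eta>_def \<tau>_def)
  have \<eta>2: "\<eta> * (1 + real r) = (m + \<tau> + real r * \<Lambda> 1) / 2"
    by (simp add: \<eta>_def field_simps)
  define \<kappa> where "\<kappa> = exp (- m + \<eta>)"
  \<comment> \<open>Chosen so that \<open>exp (- m) + 2 * \<epsilon> = \<kappa>\<close>: for fixed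
    \<open>k\<close> the sum over the two starting modes has one diagonal term and two
    errors.\<close>
  define \<epsilon> where "\<epsilon> = (exp (- m + \<eta>) - exp (- m)) / 2"
  have \<epsilon>: "\<epsilon> > 0" using \<eta> by (simp add: \<epsilon>_def)
  obtain R where R: "R > 0" "\<And>\<xi> i k. norm \<xi> \<ge> R \<Longrightarrow>
      norm (\<integral>e. iexp (\<xi> \<bullet> noise i 1 e) * of_bool (state i 1 e = k) \<partial>expos) \<le> exp (- al i) * of_bool (i = k) + \<epsilon>"
    using transition_char_small[OF zeros \<epsilon>] by blast
  \<comment> \<open>The maximum over both modes turns the two-by-two system into a scalar
    inequality.\<close>
  define g where "g \<xi> = max (norm (cfun (marg False) \<xi>)) (norm (cfun (marg True) \<xi>))" for \<xi>
  have g_ge: "norm (cfun (marg j) \<xi>) \<le> g \<xi>" for j \<xi> by (cases j) (simp_all add: g_def)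
  have g0: "0 \<le> g \<xi>" for \<xi> using order_trans[OF norm_ge_zero g_ge] .
  have "norm (cfun (marg j) \<xi>) \<le> 1" for j \<xi>
    using marg.norm_cfun_le[of j \<xi>] measure_marg_le_1[of j UNIV] by linarith
  then have g1: "g \<xi> \<le> 1" for \<xi> by (simp add: g_def)
  have [measurable]: "g \<in> borel_measurable borel" unfolding g_def by measurable
  have decay: "g \<xi> \<le> \<kappa> * g (adjoint (flow A 1) \<xi>)" if \<xi>: "norm \<xi> \<ge> R" for \<xi>
  proof -
    have "norm (cfun (marg k) \<xi>) \<le> \<kappa> * g (adjoint (flow A 1) \<xi>)" for k
    proof -
      define u where "u i = (\<integral>e. iexp (\<xi> \<bullet> noise i 1 e) * of_bool (state i 1 e = k) \<partial>expos)" for i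
      have "norm (cfun (marg k) \<xi>) = norm (\<Sum>i\<in>UNIV. u i * cfun (marg i) (adjoint (flow A 1) \<xi>))"
        unfolding u_def by (subst cfun_marg_transition) simp
      also have "\<dots> \<le> (\<Sum>i\<in>UNIV. (exp (- m) * of_bool (i = k) + \<epsilon>) * g (adjoint (flow A 1) \<xi>))"
      proof (rule sum_norm_le)
        fix i :: bool
        have "norm (u i) \<le> exp (- al i) * of_bool (i = k) + \<epsilon>" unfolding u_def by (rule R(2)[OF \<xi>])
        also have "\<dots> \<le> exp (- m) * of_bool (i = k) + \<epsilon>" using m(1)[of i] m(1)[of k] by (simp add: of_bool_def)
        finally show "norm (u i * cfun (marg i) (adjoint (flow A 1) \<xi>))
            \<le> (exp (- m) * of_bool (i = k) + \<epsilon>) * g (adjoint (flow A 1) \<xi>)"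
          unfolding norm_mult using g_ge \<epsilon> by (intro mult_mono) auto
      qed
      also have "\<dots> = \<kappa> * g (adjoint (flow A 1) \<xi>)"
        unfolding sum_distrib_right[symmetric] by (cases k) (simp_all add: UNIV_bool \<kappa>_def \<epsilon>_def field_simps)
      finally show ?thesis .
    qed
    then show ?thesis by (simp add: g_def)
  qed
  define T where "T n = adjoint (flow A (real n))" for n
  define S where "S n = adjoint (flow A (- real n))" for n
  have lin: "linear (S n)" "linear (T n)" for n
    unfolding S_def T_def by (intro adjoint_linear linear_flow)+
  \<comment> \<open>Any negative rate above the spectrum serves here, as the iterates only have to
    tend to 0.\<close>
  have "\<And>m. det (mat m - cmat A) = 0 \<Longrightarrow> Re m < \<Lambda> CARD('d) / 2"
    using eigenvalue_Re \<Lambda>_le neg by (smt (verit) field_sum_of_halves)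
  then obtain C0 where C0: "C0 > 0" "\<And>t x. t \<ge> 0 \<Longrightarrow> norm (flow A t x) \<le> C0 * exp (\<Lambda> CARD('d) / 2 * t) * norm x"
    by (rule flow_growth) auto
  have T0: "(\<lambda>n. T n \<xi>) \<longlonglongrightarrow> 0" for \<xi>
  proof (rule Lim_null_comparison)
    show "\<forall>\<^sub>F n in sequentially. norm (T n \<xi>) \<le> C0 * norm \<xi> * exp (\<Lambda> CARD('d) / 2) ^ n"
    proof (rule always_eventually, rule allI)
      fix n
      have "norm (T n \<xi>) \<le> C0 * exp (\<Lambda> CARD('d) / 2 * real n) * norm \<xi>"
        unfolding T_def by (rule norm_adjoint_le[OF linear_flow]) (rule C0(2), simp)
      then show "norm (T n \<xi>) \<le> C0 * norm \<xi> * exp (\<Lambda> CARD('d) / 2) ^ n"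
        by (simp add: exp_of_nat_mult[symmetric] mult_ac)
    qed
    have "(\<lambda>n. exp (\<Lambda> CARD('d) / 2) ^ n) \<longlonglongrightarrow> 0" using neg by (intro LIMSEQ_realpow_zero) auto
    then show "(\<lambda>n. C0 * norm \<xi> * exp (\<Lambda> CARD('d) / 2) ^ n) \<longlonglongrightarrow> 0" by (rule tendsto_mult_right_zero)
  qed
  \<comment> \<open>The backward flow belongs to \<open>- A\<close>, whose largest real part is
    \<open>- \<Lambda> 1\<close>; the extra \<open>\<eta>\<close> provides the strict gap required
    by \<open>flow_growth\<close>.\<close>
  have "\<And>m. det (mat m - cmat (- A)) = 0 \<Longrightarrow> Re m < - \<Lambda> 1 + \<eta>"
    using eigenvalue_Re_neg \<Lambda>_le \<eta> by (smt (verit))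
  then obtain C where C: "C > 0" "\<And>t x. t \<ge> 0 \<Longrightarrow> norm (flow (- A) t x) \<le> C * exp ((- \<Lambda> 1 + \<eta>) * t) * norm x"
    by (rule flow_growth) auto
  define \<rho> where "\<rho> = exp (- \<Lambda> 1 + \<eta>)"
  have \<Lambda>1: "\<Lambda> 1 < 0" using \<Lambda>_le(1)[of 1] d1 neg by auto
  have "integrable lborel (\<lambda>\<xi>. (1 + norm \<xi>) ^ r * g \<xi>)"
  proof (rule integrable_geometric_decay[where T = T and S = S and R = R and \<kappa> = \<kappa> and C = C and \<rho> = \<rho> and \<delta> = "exp (- \<tau>)"])
    show "S n (T n \<xi>) = \<xi>" "T n (S n \<xi>) = \<xi>" for n \<xi> by (simp_all add: S_def T_def adjoint_flow_add)
    show "T 0 \<xi> = \<xi>" for \<xi> by (simp add: T_def)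
    show "g (T n \<xi>) \<le> \<kappa> * g (T (Suc n) \<xi>)" if "R \<le> norm (T n \<xi>)" for n \<xi>
      using decay[OF that] by (simp add: T_def adjoint_flow_add add.commute)
    show "norm (S n \<xi>) \<le> C * \<rho> ^ n * norm \<xi>" for n \<xi>
    proof -
      have "norm (S n \<xi>) \<le> C * exp ((- \<Lambda> 1 + \<eta>) * real n) * norm \<xi>"
        unfolding S_def by (rule norm_adjoint_le[OF linear_flow]) (use C(2)[of "real n"] in \<open>simp add: flow_uminus\<close>)
      then show ?thesis by (simp add: \<rho>_def exp_of_nat_mult[symmetric] mult.commute)
    qed
    show "\<bar>det (matrix (S n))\<bar> = exp (- \<tau>) ^ n" for n
    proof -
      have "det (matrix (S n)) = det (matrix (flow A (- real n)))"
        unfolding S_def by (simp add: matrix_adjoint[OF linear_flow] det_transpose)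
      also have "\<dots> = exp (- real n * \<tau>)" unfolding \<tau>_def by (rule det_flow)
      finally show ?thesis by (simp add: exp_of_nat_mult[symmetric])
    qed
    show "1 \<le> \<rho>" using \<Lambda>1 \<eta> by (simp add: \<rho>_def)
    have "\<kappa> * \<rho> ^ r * exp (- \<tau>) = exp (- m + \<eta>) * exp (real r * (- \<Lambda> 1 + \<eta>)) * exp (- \<tau>)"
      by (simp only: \<kappa>_def \<rho>_def exp_of_nat_mult)
    also have "\<dots> = exp ((- m + \<eta>) + real r * (- \<Lambda> 1 + \<eta>) + (- \<tau>))"
      by (rule exp_add[THEN trans, symmetric]) (simp only: exp_add)
    also have "(- m + \<eta>) + real r * (- \<Lambda> 1 + \<eta>) + (- \<tau>) = - (m + \<tau> + real r * \<Lambda> 1) + \<eta> * (1 + real r)"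
      by (simp add: algebra_simps)
    also have "exp \<dots> < 1"
    proof -
      have "m + \<tau> + real r * \<Lambda> 1 > 0" using m(2) unfolding \<tau>_def by linarith
      moreover have "- D + D / 2 < 0" if "D > 0" for D :: real using that by simp
      ultimately show ?thesis unfolding \<eta>2 exp_less_one_iff by blast
    qed
    finally show "\<kappa> * \<rho> ^ r * exp (- \<tau>) < 1" .
  qed (use g0 g1 lin T0 R(1) C(1) in \<open>auto simp: \<kappa>_def\<close>)
  then show ?thesis
  proof (rule Bochner_Integration.integrable_bound)
    show "AE \<xi> in lborel. norm ((1 + norm \<xi>) ^ r * norm (cfun (marg k) \<xi>)) \<le> norm ((1 + norm \<xi>) ^ r * g \<xi>)"
      using g_ge g0 by (intro AE_I2) (auto simp: abs_mult intro!: mult_left_mono)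
  qed measurable
qed

lemma (in stationary) \<mu>_eq_density:
  assumes \<rho>: "\<And>i. marg i = density lborel (\<lambda>x. ennreal (\<rho> i x))" and [measurable]: "\<And>i. \<rho> i \<in> borel_measurable borel"
  shows "\<mu> = density ref_measure (\<lambda>(x, i). ennreal (\<rho> i x))"
proof (rule measure_eqI)
  have rs: "sets (ref_measure :: ((real^'d) \<times> bool) measure) = sets (borel \<Otimes>\<^sub>M count_space UNIV)"
    unfolding ref_measure_def by (rule sets_pair_measure_cong) auto
  show "sets \<mu> = sets (density ref_measure (\<lambda>(x, i). ennreal (\<rho> i x)))" by (simp add: rs \<mu>_sets)
  fix E assume "E \<in> sets \<mu>"
  then have E [measurable]: "E \<in> sets (borel \<Otimes>\<^sub>M count_space UNIV)" by (simp add: \<mu>_sets)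
  define Es where "Es j = {x. (x, j) \<in> E}" for j
  have Es [measurable]: "Es j \<in> sets borel" for j
  proof -
    have "(\<lambda>x. (x, j)) -` E \<inter> space borel \<in> sets borel"
      by (rule measurable_sets[OF _ E]) measurable
    then show ?thesis by (simp add: Es_def vimage_def)
  qed
  interpret P: pair_sigma_finite "lborel :: (real^'d) measure" "count_space (UNIV :: bool set)"
    by (intro pair_sigma_finite.intro lborel.sigma_finite_measure_axioms sigma_finite_measure_count_space_finite) simp
  have [measurable]: "(\<lambda>(x, i). ennreal (\<rho> i x)) \<in> borel_measurable (borel \<Otimes>\<^sub>M count_space UNIV)"
  proof -
    have "(\<lambda>q. ennreal (if snd q then \<rho> True (fst q) else \<rho> False (fst q))) \<in> borel_measurable (borel \<Otimes>\<^sub>M count_space UNIV)"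
      by measurable
    moreover have "(if i then \<rho> True x else \<rho> False x) = \<rho> i x" for i x by (cases i) auto
    ultimately show ?thesis by (simp add: case_prod_beta')
  qed
  have m: "(\<lambda>(x, i). ennreal (\<rho> i x) * indicator E (x, i)) \<in> borel_measurable (lborel \<Otimes>\<^sub>M count_space UNIV)"
  proof -
    have "(\<lambda>q. (case q of (x, i) \<Rightarrow> ennreal (\<rho> i x)) * indicator E q) \<in> borel_measurable (borel \<Otimes>\<^sub>M count_space UNIV)"
      by measurable
    then show ?thesis using rs by (simp add: case_prod_beta' ref_measure_def measurable_cong_sets[OF rs[unfolded ref_measure_def] refl])
  qed
  have "emeasure (density ref_measure (\<lambda>(x, i). ennreal (\<rho> i x))) E = (\<integral>\<^sup>+q. (case q of (x, i) \<Rightarrow> ennreal (\<rho> i x)) * indicator E q \<partial>ref_measure)"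
    by (rule emeasure_density) (auto simp: rs measurable_cong_sets[OF rs refl])
  also have "\<dots> = (\<integral>\<^sup>+q. (\<lambda>(x, i). ennreal (\<rho> i x) * indicator E (x, i)) q \<partial>(lborel \<Otimes>\<^sub>M count_space UNIV))"
    by (simp add: ref_measure_def case_prod_beta')
  also have "\<dots> = (\<integral>\<^sup>+i. (\<integral>\<^sup>+x. ennreal (\<rho> i x) * indicator E (x, i) \<partial>lborel) \<partial>count_space UNIV)"
    using P.nn_integral_snd[OF m] by simp
  also have "\<dots> = (\<Sum>i\<in>UNIV. (\<integral>\<^sup>+x. ennreal (\<rho> i x) * indicator E (x, i) \<partial>lborel))"
    by (rule nn_integral_count_space_finite) simp
  also have "\<dots> = (\<Sum>i\<in>UNIV. emeasure (marg i) (Es i))"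
    by (intro sum.cong refl) (simp add: \<rho> emeasure_density Es_def indicator_def)
  also have "\<dots> = (\<Sum>i\<in>UNIV. emeasure \<mu> (Es i \<times> {i}))" by (simp add: emeasure_marg)
  also have "\<dots> = emeasure \<mu> (\<Union>i\<in>UNIV. Es i \<times> {i})"
    by (intro sum_emeasure) (auto simp: disjoint_family_on_def \<mu>_sets intro!: pair_measureI)
  also have "(\<Union>i\<in>UNIV. Es i \<times> {i}) = E" by (auto simp: Es_def)
  finally show "emeasure \<mu> E = emeasure (density ref_measure (\<lambda>(x, i). ennreal (\<rho> i x))) E" ..
qed

section \<open>The support of the density\<close>

definition center :: "real^'d \<Rightarrow> bool \<Rightarrow> real^'d" where "center p i = (if i then p else 0)"

definition mode_flow :: "real^'d^'d \<Rightarrow> real^'d \<Rightarrow> bool \<Rightarrow> real \<Rightarrow> real^'d \<Rightarrow> real^('d::finite)" where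
  "mode_flow A p i t x = center p i + flow A t (x - center p i)"

lemma vfield_center: "vfield A p i x = A *v (x - center p i)"
  by (simp add: vfield_def center_def)

lemma mode_flow_0 [simp]: "mode_flow A p i 0 x = x"
  by (simp add: mode_flow_def)

lemma mode_flow_minus [simp]: "mode_flow A p i t (mode_flow A p i (- t) x) = x"
  by (simp add: mode_flow_def)

text \<open>The curve \<open>flow A (t - u) (y u - center p i)\<close> is constant. The mode is
  prescribed on the open interval, so \<open>s\<close> and \<open>t\<close> may be switching times
  at which \<open>j\<close> takes the other value.\<close>

lemma solves_constant_mode:
  assumes y: "solves A p j x y" and st: "0 \<le> s" "s \<le> t" and j: "\<And>u. u \<in> {s<..<t} \<Longrightarrow> j u = i"
  shows "y t = mode_flow A p i (t - s) (y s)"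
proof -
  have "((\<lambda>u. 0) has_integral (flow A (t - t) (y t - center p i) - flow A (t - s) (y s - center p i))) {s..t}"
  proof (rule fundamental_theorem_of_calculus_interior_strong[where S = "{}"])
    show "continuous_on {s..t} (\<lambda>u. flow A (t - u) (y u - center p i))"
      using y st by (intro continuous_intros) (auto simp: solves_def intro: continuous_on_subset)
    fix u assume u: "u \<in> {s<..<t} - {}"
    have at: "at u within {0..} = at u" by (rule at_within_interior) (use u st in simp)
    have "\<forall>\<^sub>F v in at u. j v = j u"
      using eventually_at_in_open'[of "{s<..<t}" u] u j by (auto elim!: eventually_mono)
    then have "continuous (at u) j" unfolding continuous_within by (rule tendsto_eventually)
    then have "(y has_vector_derivative vfield A p i (y u)) (at u)"
    proof -
      assume c: "continuous (at u) j"
      have u0: "0 \<le> u" using u st by simp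
      have "(y has_vector_derivative vfield A p (j u) (y u)) (at u within {0..})"
        using y u0 c unfolding solves_def at by (metis at)
      then show ?thesis using j[of u] u by (simp add: at)
    qed
    then have "((\<lambda>u. y u - center p i) has_vector_derivative vfield A p i (y u)) (at u)"
      using has_vector_derivative_diff[OF _ has_vector_derivative_const] by fastforce
    from flow_comp_has_vector_derivative[OF this, of A t]
    show "((\<lambda>u. flow A (t - u) (y u - center p i)) has_vector_derivative 0) (at u)"
      by (simp add: vfield_center flow_simps)
  qed (use st in auto)
  then have "flow A (t - t) (y t - center p i) - flow A (t - s) (y s - center p i) = 0"
    by (rule has_integral_unique) simp
  then show ?thesis by (simp add: mode_flow_def algebra_simps)
qed

context switching
begin

lemma integral_flow_b:
  assumes "0 \<le> t"
  shows "(\<integral>s. indicator {0..t} s *\<^sub>R flow A (t - s) b \<partial>lborel) = p - flow A t p"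
proof -
  have c: "continuous_on {0..t} (\<lambda>s. flow A (t - s) b)" by (intro continuous_intros)
  have "((\<lambda>s. flow A (t - s) p) has_vector_derivative flow A (t - s) (0 - A *v p)) (at s within {0..t})" for s
    by (rule flow_comp_has_vector_derivative) (rule has_vector_derivative_const)
  then have "((\<lambda>s. flow A (t - s) (0 - A *v p)) has_integral (flow A (t - t) p - flow A (t - 0) p)) {0..t}"
    using assms by (intro fundamental_theorem_of_calculus) auto
  then have "integral {0..t} (\<lambda>s. flow A (t - s) b) = p - flow A t p"
    by (simp add: b_def integral_unique)
  then show ?thesis
    using set_borel_integral_eq_integral(2)[OF borel_integrable_atLeastAtMost'[OF c]]
    by (simp add: set_lebesgue_integral_def)
qed

text \<open>The value of \<open>noise\<close> on paths that do not jump before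
  \<open>t\<close>.\<close>

definition drift :: "bool \<Rightarrow> real \<Rightarrow> real^'d" where
  "drift i t = center p i - flow A t (center p i)"

lemma mode_flow_drift: "mode_flow A p i t x = flow A t x + drift i t"
  by (simp add: mode_flow_def drift_def flow_simps)

lemma drift_eq:
  assumes "0 \<le> t"
  shows "drift i t = (\<integral>s. indicator {0..t} s *\<^sub>R (if i then flow A (t - s) b else 0) \<partial>lborel)"
  using integral_flow_b[OF assms] by (cases i) (simp_all add: drift_def center_def flow_simps)

text \<open>Before \<open>T1\<close> the two integrands coincide; afterwards they differ by at most
  the norm of \<open>flow A (t - s) b\<close>.\<close>

lemma noise_minus_drift_le:
  assumes t: "0 \<le> t" and st: "\<And>s. s \<in> {0..<T1} \<Longrightarrow> state i s e = i" and T1: "0 \<le> T1" "T1 \<le> t"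
  shows "norm (noise i t e - drift i t) \<le> (t - T1) * (exp (t * norm (endo_of_matrix A)) * norm b)"
proof -
  define h where "h j s = indicator {0..t} s *\<^sub>R (if j s then flow A (t - s) b else 0)" for j :: "real \<Rightarrow> bool" and s
  have [measurable]: "Measurable.pred borel (\<lambda>s. state i s e)"
    by (rule state_measurable) (auto intro: measurable_const)
  have i1: "integrable lborel (h (\<lambda>s. state i s e))" and i2: "integrable lborel (h (\<lambda>s. i))"
    unfolding h_def by (rule flow_b_integrable, measurable)+
  define K where "K = exp (t * norm (endo_of_matrix A)) * norm b"
  have "noise i t e - drift i t = (\<integral>s. h (\<lambda>s. state i s e) s - h (\<lambda>s. i) s \<partial>lborel)"
    unfolding noise_def drift_eq[OF t] using Bochner_Integration.integral_diff[OF i1 i2]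
    by (simp only: h_def[abs_def])
  also have "norm \<dots> \<le> (\<integral>s. K * indicator {T1..t} s \<partial>lborel)"
  proof (rule Bochner_Integration.integral_norm_bound_integral)
    show "integrable lborel (\<lambda>s. h (\<lambda>s. state i s e) s - h (\<lambda>s. i) s)" using i1 i2 by simp
    show "integrable lborel (\<lambda>s. K * indicator {T1..t} s :: real)"
      by (intro integrable_mult_right integrable_real_indicator) (use T1 in auto)
    fix s :: real
    show "norm (h (\<lambda>s. state i s e) s - h (\<lambda>s. i) s) \<le> K * indicator {T1..t} s"
    proof (cases "s \<in> {T1..t}")
      case True
      have "norm (h (\<lambda>s. state i s e) s - h (\<lambda>s. i) s) \<le> norm (flow A (t - s) b)"
        by (auto simp: h_def indicator_def)
      also have "\<dots> \<le> exp (\<bar>t - s\<bar> * norm (endo_of_matrix A)) * norm b" by (rule norm_flow_le)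
      also have "\<dots> \<le> K" unfolding K_def using True T1
        by (intro mult_right_mono) (auto intro!: mult_right_mono)
      finally show ?thesis using True by simp
    next
      case False
      then show ?thesis using st[of s] by (cases "s \<in> {0..t}") (auto simp: h_def)
    qed
  qed
  also have "\<dots> = (t - T1) * K" using T1 by simp
  finally show ?thesis unfolding K_def .
qed

lemma prob_expo_Ioc_pos: "0 \<le> x \<Longrightarrow> x < y \<Longrightarrow> expo.prob {x<..y} > 0"
proof -
  assume xy: "0 \<le> x" "x < y"
  have "{x<..y} = {x<..} - {y<..}" by auto
  then have "expo.prob {x<..y} = expo.prob {x<..} - expo.prob {y<..}"
    using xy expo.finite_measure_Diff[of "{x<..}" "{y<..}"] by (simp add: sets_expo)
  then show ?thesis using xy by (simp add: prob_expo_greater)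
qed

text \<open>To end in mode \<open>k\<close> close to the drift, either let the first holding time
  exceed \<open>t\<close>, or jump once just before \<open>t\<close> and then wait longer than
  \<open>t\<close>. Both events contain one that confines the first two entries of the sequence to
  intervals.\<close>

lemma noise_near_drift_pos:
  assumes t: "0 < t" and \<epsilon>: "0 < \<epsilon>"
  shows "measure expos {e. norm (noise i t e - drift i t) < \<epsilon> \<and> state i t e = k} > 0"
proof -
  define G where "G = {e. norm (noise i t e - drift i t) < \<epsilon> \<and> state i t e = k}"
  have G: "G \<in> sets expos"
  proof -
    have "{e \<in> space expos. norm (noise i t e - drift i t) < \<epsilon> \<and> state i t e = k} \<in> sets expos"
      by measurable
    then show ?thesis by (simp add: G_def)
  qed
  define K where "K = exp (t * norm (endo_of_matrix A)) * norm b"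
  have K: "K \<ge> 0" by (simp add: K_def)
  \<comment> \<open>Length of the final window that may contain the jump: the deviation is then at
    most \<open>\<eta> * K < \<epsilon>\<close>.\<close>
  define \<eta> where "\<eta> = min t (\<epsilon> / (K + 1))"
  have \<eta>: "0 < \<eta>" "\<eta> \<le> t" "\<eta> * K < \<epsilon>"
  proof -
    show "0 < \<eta>" "\<eta> \<le> t" using t \<epsilon> K by (auto simp: \<eta>_def)
    have "\<eta> * K \<le> \<epsilon> / (K + 1) * K" using K by (intro mult_right_mono) (auto simp: \<eta>_def)
    also have "\<dots> < \<epsilon>" using K \<epsilon> by (simp add: field_simps)
    finally show "\<eta> * K < \<epsilon>" .
  qed
  define B where "B n = (if n = (0::nat) then (if k = i then {al i * t<..al i * t + 1} else {al i * (t - \<eta>)<..al i * t})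
     else {al (\<not> i) * t<..al (\<not> i) * t + 1})" for n
  have B_pos: "expo.prob (B n) > 0" for n
    unfolding B_def using al_pos[of i] al_pos[of "\<not> i"] t \<eta>
    by (auto intro!: prob_expo_Ioc_pos mult_nonneg_nonneg simp: less_imp_le)
  have "emeasure expos {e \<in> space expos. \<forall>n\<in>{0, 1}. e n \<in> B n} = (\<Prod>n\<in>{0,1::nat}. emeasure expo (B n))"
    by (rule stream.emeasure_PiM_Collect) (auto simp: B_def sets_expo)
  also have "\<dots> > 0"
    using B_pos by (simp add: expo.emeasure_eq_measure ennreal_mult[symmetric] ennreal_zero_less_mult_iff)
  finally have pos: "emeasure expos {e. \<forall>n\<in>{0, 1}. e n \<in> B n} > 0" by simp
  have "AE e in expos. (\<forall>n\<in>{0, 1}. e n \<in> B n) \<longrightarrow> e \<in> G"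
    using AE_good
  proof eventually_elim
    case (elim e)
    show ?case
    proof
      assume e: "\<forall>n\<in>{0, 1}. e n \<in> B n"
      have j1: "jump_time i e (Suc 0) = e 0 / al i" by (simp add: jump_time_def)
      have j2: "jump_time i e (Suc (Suc 0)) = e 0 / al i + e 1 / al (\<not> i)" by (simp add: jump_time_def)
      have st0: "state i s e = i" if "0 \<le> s" "s < e 0 / al i" for s
        using state_eq[OF elim, of i 0 s] that j1 by simp
      show "e \<in> G"
      proof (cases "k = i")
        case True
        have "al i * t < e 0" using e True by (simp add: B_def)
        then have lt: "t < e 0 / al i" using al_pos[of i] by (simp add: field_simps)
        have "norm (noise i t e - drift i t) \<le> (t - t) * (exp (t * norm (endo_of_matrix A)) * norm b)"
          by (rule noise_minus_drift_le) (use t lt st0 in auto)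
        then show ?thesis using st0[of t] lt t \<epsilon> True by (simp add: G_def)
      next
        case False
        have e0: "al i * (t - \<eta>) < e 0" "e 0 \<le> al i * t" and e1: "al (\<not> i) * t < e 1"
          using e False by (auto simp: B_def)
        define T1 where "T1 = e 0 / al i"
        have T1: "t - \<eta> < T1" "T1 \<le> t" and T2: "t < e 1 / al (\<not> i)"
          using e0 e1 al_pos[of i] al_pos[of "\<not> i"] by (auto simp: T1_def field_simps)
        have T10: "0 \<le> T1" using T1 \<eta> by simp
        have "norm (noise i t e - drift i t) \<le> (t - T1) * (exp (t * norm (endo_of_matrix A)) * norm b)"
          by (rule noise_minus_drift_le) (use t T1 T10 st0 in \<open>auto simp: T1_def\<close>)
        also have "\<dots> \<le> \<eta> * K" unfolding K_def using T1 by (intro mult_right_mono) auto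
        finally have "norm (noise i t e - drift i t) < \<epsilon>" using \<eta>(3) by simp
        moreover have "state i t e = (Not ^^ Suc 0) i"
          by (rule state_eq[OF elim]) (use T1 T2 T10 in \<open>simp_all add: j1 j2[unfolded One_nat_def] T1_def\<close>)
        ultimately show ?thesis using False by (auto simp: G_def)
      qed
    qed
  qed
  then have "emeasure expos {e. \<forall>n\<in>{0, 1}. e n \<in> B n} \<le> emeasure expos G"
    by (intro emeasure_mono_AE G) auto
  then show ?thesis using pos unfolding G_def[symmetric] by (simp add: stream.P.emeasure_eq_measure)
qed

end

lemma det_flow_nz: "det (matrix (flow A t)) \<noteq> 0"
proof -
  have "flow A (- t) \<circ> flow A t = id" by (simp add: fun_eq_iff)
  then have "matrix (flow A (- t)) ** matrix (flow A t) = mat 1"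
    by (metis matrix_compose[OF linear_flow linear_flow] matrix_id_mat_1)
  then have "det (matrix (flow A (- t))) * det (matrix (flow A t)) = 1"
    by (metis det_mul det_I)
  then show ?thesis by auto
qed

lemma emeasure_lborel_open_pos:
  fixes S :: "'a::euclidean_space set"
  assumes "open S" "x \<in> S"
  shows "emeasure lborel S > 0"
proof -
  obtain r where r: "r > 0" "ball x r \<subseteq> S" using assms open_contains_ball by blast
  have "0 < unit_ball_vol (real DIM('a)) * r ^ DIM('a)" using r by simp
  then have "0 < emeasure lborel (ball x r)" using r by (simp add: emeasure_ball)
  also have "\<dots> \<le> emeasure lborel S" by (rule emeasure_mono) (use r assms in auto)
  finally show ?thesis .
qed

lemma emeasure_flow_preimage:
  fixes A :: "real^'d^'d"
  assumes E: "E \<in> sets borel" "bounded E"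
  shows "emeasure lborel {y. flow A t y + n \<in> E} = ennreal \<bar>det (matrix (flow A (- t)))\<bar> * emeasure lborel E"
proof -
  define S where "S = (\<lambda>w. n + w) -` E"
  have S: "S \<in> sets borel" unfolding S_def using measurable_sets[of "\<lambda>w. n + w" borel borel E] E by simp
  have Sim: "S = (\<lambda>w. w - n) ` E" by (force simp: S_def image_iff)
  have Sb: "bounded S" unfolding Sim using bounded_translation[OF E(2), of "- n"] by (simp add: add.commute)
  have eq: "flow A (- t) ` S = {y. flow A t y + n \<in> E}"
  proof (intro set_eqI iffI)
    fix y assume "y \<in> {y. flow A t y + n \<in> E}"
    then have "flow A t y \<in> S" by (simp add: S_def add.commute)
    from imageI[OF this, of "flow A (- t)"] show "y \<in> flow A (- t) ` S" by simp
  qed (auto simp: S_def add.commute)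
  have meas: "{y. flow A t y + n \<in> E} \<in> sets borel"
    using measurable_sets[of "\<lambda>y. flow A t y + n" borel borel E] E by (simp add: vimage_def)
  have emS: "emeasure lborel S = emeasure lborel E"
    using emeasure_distr[of "(+) n" lborel borel E] E by (simp add: lborel_distr_plus S_def)
  have "emeasure lborel (flow A (- t) ` S) = ennreal (\<bar>det (matrix (flow A (- t)))\<bar> * measure lborel S)"
    by (rule emeasure_linear_image[OF linear_flow Sb S]) (simp add: eq meas)
  also have "\<dots> = ennreal \<bar>det (matrix (flow A (- t)))\<bar> * emeasure lborel S"
    using emeasure_bounded_finite[OF Sb] by (simp add: ennreal_mult emeasure_eq_ennreal_measure)
  finally show ?thesis by (simp add: eq emS)
qed

locale stationary_density = stationary al A p \<mu>
  for al :: "bool \<Rightarrow> real" and A :: "real^'d^'d" and p :: "real^'d" and \<mu> :: "((real^'d) \<times> bool) measure" +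
  fixes \<rho> :: "bool \<Rightarrow> real^'d \<Rightarrow> real"
  assumes \<rho>_nonneg: "\<rho> i x \<ge> 0"
    and \<rho>_cont: "continuous_on UNIV (\<rho> i)"
    and marg_eq: "marg i = density lborel (\<lambda>x. ennreal (\<rho> i x))"

context stationary
begin

lemma invariance_emeasure:
  assumes t: "t \<ge> 0" and S [measurable]: "S \<in> sets (borel \<Otimes>\<^sub>M count_space UNIV)"
  shows "emeasure \<mu> S = (\<integral>\<^sup>+z. emeasure expos {e. (flow A t (fst z) + noise (snd z) t e, state (snd z) t e) \<in> S} \<partial>\<mu>)"
proof -
  define H where "H z = {e. (flow A t (fst z) + noise (snd z) t e, state (snd z) t e) \<in> S}" for z
  have ind: "(indicator S :: (real^'d) \<times> bool \<Rightarrow> real) \<in> borel_measurable (borel \<Otimes>\<^sub>M count_space UNIV)" by simp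
  have Fm: "(\<lambda>(z, e). indicator S (flow A t (fst z) + noise (snd z) t e, state (snd z) t e) :: real) \<in> borel_measurable (\<mu> \<Otimes>\<^sub>M expos)"
    using noise_state_measurable[OF ind] by (simp add: case_prod_beta')
  have Hm: "H z \<in> sets expos" for z
  proof -
    have "(\<lambda>e. indicator S (flow A t (fst z) + noise (snd z) t e, state (snd z) t e) :: real) \<in> borel_measurable expos"
      using measurable_Pair2[OF Fm, of z] by simp
    from measurable_sets[OF this, of "{1}"] show ?thesis
      by (simp add: H_def vimage_def indicator_eq_1_iff)
  qed
  have inner: "(\<integral>e. indicator S (flow A t (fst z) + noise (snd z) t e, state (snd z) t e) \<partial>expos) = measure expos (H z)" for z
  proof -
    have "(\<integral>e. indicator S (flow A t (fst z) + noise (snd z) t e, state (snd z) t e) \<partial>expos) = (\<integral>e. indicator (H z) e \<partial>expos :: real)"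
      by (rule Bochner_Integration.integral_cong) (auto simp: H_def indicator_def)
    then show ?thesis using Hm[of z] by simp
  qed
  have int: "integrable \<mu> (\<lambda>z. measure expos (H z))"
  proof (rule \<mu>.integrable_const_bound[where B = 1])
    show "(\<lambda>z. measure expos (H z)) \<in> borel_measurable \<mu>"
      unfolding inner[symmetric] by (rule stream.P.borel_measurable_lebesgue_integral[OF Fm])
  qed simp
  have "measure \<mu> S = (\<integral>z. indicator S z \<partial>\<mu>)" using S by (simp add: \<mu>_sets)
  also have "\<dots> = (\<integral>z. measure expos (H z) \<partial>\<mu>)"
    unfolding inner[symmetric]
    by (rule invariance[symmetric, OF t ind]) (auto simp: bounded_iff indicator_def intro!: exI[of _ 1])
  finally have "emeasure \<mu> S = ennreal (\<integral>z. measure expos (H z) \<partial>\<mu>)"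
    by (simp add: \<mu>.emeasure_eq_measure)
  also have "\<dots> = (\<integral>\<^sup>+z. ennreal (measure expos (H z)) \<partial>\<mu>)"
    by (rule nn_integral_eq_integral[symmetric, OF int]) simp
  finally show ?thesis by (simp add: H_def stream.P.emeasure_eq_measure)
qed

lemma nn_integral_marg:
  assumes [measurable]: "q \<in> borel_measurable borel"
  shows "(\<integral>\<^sup>+x. q x \<partial>marg i) = (\<integral>\<^sup>+z. indicator {z. snd z = i} z * q (fst z) \<partial>\<mu>)"
proof -
  have m: "(\<lambda>z. q (fst z)) \<in> borel_measurable \<mu>" by (rule measurable_compose[OF fst_measurable assms])
  have i: "(\<lambda>z. indicator {z. snd z = i} z) \<in> borel_measurable \<mu>" by (rule borel_measurable_indicator[OF snd_set])
  have "(\<integral>\<^sup>+x. q x \<partial>marg i) = (\<integral>\<^sup>+z. q (fst z) \<partial>density \<mu> (\<lambda>z. indicator {z. snd z = i} z))"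
    unfolding marg_def by (rule nn_integral_distr) (use assms in \<open>simp_all cong: measurable_cong_sets\<close>)
  also have "\<dots> = (\<integral>\<^sup>+z. indicator {z. snd z = i} z * q (fst z) \<partial>\<mu>)" by (rule nn_integral_density[OF i m])
  finally show ?thesis .
qed

end

section \<open>Propagation of positivity\<close>

context stationary_density
begin

lemma \<rho>_measurable [measurable]: "\<rho> i \<in> borel_measurable borel"
  using \<rho>_cont by (rule borel_measurable_continuous_onI)

text \<open>Near \<open>x\<close> the density is at least \<open>c\<close>. On an event
  \<open>G\<close> of positive probability the noise is almost deterministic, so invariance gives
  sets \<open>E\<close> near \<open>y0\<close> a mass of at least a positive constant times their
  volume. By continuity this excludes \<open>\<rho> k y0 = 0\<close>.\<close>

lemma \<rho>_pos_step:
  assumes x: "\<rho> i x > 0" and t: "t > 0"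
  shows "\<rho> k (mode_flow A p i t x) > 0"
proof -
  define y0 where "y0 = mode_flow A p i t x"
  define c where "c = \<rho> i x / 2"
  have c: "c > 0" using x by (simp add: c_def)
  have "isCont (\<rho> i) x" using \<rho>_cont by (simp add: continuous_on_eq_continuous_at)
  then have "\<forall>\<^sub>F y in nhds x. \<rho> i y > c"
    unfolding isCont_def tendsto_at_iff_tendsto_nhds using x by (intro order_tendstoD(1)) (auto simp: c_def)
  then obtain \<delta> where \<delta>: "\<delta> > 0" "\<And>y. y \<in> ball x \<delta> \<Longrightarrow> \<rho> i y \<ge> c"
    unfolding eventually_nhds_metric by (fastforce simp: dist_commute less_imp_le)
  define L where "L = exp (t * norm (endo_of_matrix A))"
  have L: "L > 0" by (simp add: L_def)
  \<comment> \<open>The backward flow expands by at most \<open>L\<close>, and two errors of size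
    \<open>\<epsilon>\<close> occur, so the starting points that hit \<open>E\<close> stay within
    \<open>\<delta> / 2\<close> of \<open>x\<close>.\<close>
  define \<epsilon> where "\<epsilon> = \<delta> / (4 * L)"
  have \<epsilon>: "\<epsilon> > 0" using \<delta> L by (simp add: \<epsilon>_def)
  define G where "G = {e. norm (noise i t e - drift i t) < \<epsilon> \<and> state i t e = k}"
  have G [measurable]: "G \<in> sets expos"
  proof -
    have "{e \<in> space expos. norm (noise i t e - drift i t) < \<epsilon> \<and> state i t e = k} \<in> sets expos" by measurable
    then show ?thesis by (simp add: G_def)
  qed
  have GP: "measure expos G > 0" unfolding G_def by (rule noise_near_drift_pos[OF t \<epsilon>])
  define D where "D = \<bar>det (matrix (flow A (- t)))\<bar>"
  have D: "D > 0" using det_flow_nz[of A "- t"] by (simp add: D_def)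
  have lower: "ennreal (c * D * measure expos G) * emeasure lborel E \<le> emeasure (marg k) E"
    if E [measurable]: "E \<in> sets borel" and Es: "E \<subseteq> ball y0 \<epsilon>" for E
  proof -
    have Eb: "bounded E" using Es bounded_ball bounded_subset by blast
    define W where "W y = {e \<in> G. flow A t y + noise i t e \<in> E}" for y
    have Wm: "(\<lambda>(y, e). indicator G e * indicator E (flow A t y + noise i t e) :: ennreal) \<in> borel_measurable (borel \<Otimes>\<^sub>M expos)"
    proof -
      have "(\<lambda>q. indicator G (snd q) * indicator E (flow A t (fst q) + noise i t (snd q)) :: ennreal) \<in> borel_measurable (borel \<Otimes>\<^sub>M expos)"
        by measurable
      then show ?thesis by (simp add: case_prod_beta')
    qed
    have Ws: "W y \<in> sets expos" for y
    proof -
      have "{e \<in> space expos. e \<in> G \<and> flow A t y + noise i t e \<in> E} \<in> sets expos" by measurable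
      then show ?thesis by (simp add: W_def)
    qed
    define q where "q y = emeasure expos (W y)" for y
    have q_eq: "q y = (\<integral>\<^sup>+e. indicator G e * indicator E (flow A t y + noise i t e) \<partial>expos)" for y
    proof -
      have "q y = (\<integral>\<^sup>+e. indicator (W y) e \<partial>expos)" using Ws by (simp add: q_def)
      also have "\<dots> = (\<integral>\<^sup>+e. indicator G e * indicator E (flow A t y + noise i t e) \<partial>expos)"
        by (rule nn_integral_cong) (auto simp: W_def indicator_def)
      finally show ?thesis .
    qed
    have qm [measurable]: "q \<in> borel_measurable borel"
      unfolding q_eq by (rule stream.P.borel_measurable_nn_integral[OF Wm])
    have "ennreal (c * D * measure expos G) * emeasure lborel E = (\<integral>\<^sup>+e. ennreal c * (indicator G e * (ennreal D * emeasure lborel E)) \<partial>expos)"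
    proof -
      have "(\<integral>\<^sup>+e. ennreal c * (indicator G e * (ennreal D * emeasure lborel E)) \<partial>expos) = ennreal c * (emeasure expos G * (ennreal D * emeasure lborel E))"
        by (simp add: nn_integral_cmult nn_integral_multc)
      then show ?thesis using c D by (simp add: stream.P.emeasure_eq_measure ennreal_mult mult_ac)
    qed
    \<comment> \<open>For a frozen \<open>e\<close> in \<open>G\<close>, the affine map
      \<open>y \<mapsto> flow A t y + noise i t e\<close> pulls \<open>E\<close> back into
      \<open>ball x \<delta>\<close>, and the preimage has \<open>D\<close> times the volume of
      \<open>E\<close>.\<close>
    also have "\<dots> \<le> (\<integral>\<^sup>+e. (\<integral>\<^sup>+y. ennreal c * (indicator (ball x \<delta>) y * (indicator G e * indicator E (flow A t y + noise i t e))) \<partial>lborel) \<partial>expos)"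
    proof (rule nn_integral_mono)
      fix e
      show "ennreal c * (indicator G e * (ennreal D * emeasure lborel E))
        \<le> (\<integral>\<^sup>+y. ennreal c * (indicator (ball x \<delta>) y * (indicator G e * indicator E (flow A t y + noise i t e))) \<partial>lborel)"
      proof (cases "e \<in> G")
        case True
        have sub: "y \<in> ball x \<delta>" if y: "flow A t y + noise i t e \<in> E" for y
        proof -
          define w where "w = flow A t y + noise i t e"
          have w: "norm (w - y0) < \<epsilon>" using Es y by (auto simp: w_def dist_norm norm_minus_commute)
          have n: "norm (noise i t e - drift i t) < \<epsilon>" using True by (simp add: G_def)
          have "flow A t (y - x) = (w - y0) - (noise i t e - drift i t)"
            by (simp add: w_def y0_def mode_flow_drift flow_simps)
          then have "y - x = flow A (- t) ((w - y0) - (noise i t e - drift i t))"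
            by (metis flow_minus(1))
          then have "norm (y - x) \<le> L * norm ((w - y0) - (noise i t e - drift i t))"
            using norm_flow_le[of A "- t" "(w - y0) - (noise i t e - drift i t)"] t by (simp add: L_def)
          also have "\<dots> \<le> L * (\<epsilon> + \<epsilon>)"
            using norm_triangle_ineq4[of "w - y0" "noise i t e - drift i t"] w n L by (intro mult_left_mono) auto
          also have "\<dots> < \<delta>" using L \<delta> by (simp add: \<epsilon>_def field_simps)
          finally show ?thesis by (simp add: dist_norm norm_minus_commute)
        qed
        have "(\<integral>\<^sup>+y. ennreal c * (indicator (ball x \<delta>) y * (indicator G e * indicator E (flow A t y + noise i t e))) \<partial>lborel)
          = (\<integral>\<^sup>+y. ennreal c * indicator {y. flow A t y + noise i t e \<in> E} y \<partial>lborel)"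
          by (rule nn_integral_cong) (use True sub in \<open>auto simp: indicator_def\<close>)
        also have "\<dots> = ennreal c * emeasure lborel {y. flow A t y + noise i t e \<in> E}"
        proof (rule nn_integral_cmult_indicator)
          show "{y. flow A t y + noise i t e \<in> E} \<in> sets lborel"
            using measurable_sets[of "\<lambda>y. flow A t y + noise i t e" borel borel E] E by (simp add: vimage_def)
        qed
        finally show ?thesis using True by (simp add: emeasure_flow_preimage[OF E Eb] D_def)
      qed simp
    qed
    also have "\<dots> = (\<integral>\<^sup>+y. (\<integral>\<^sup>+e. ennreal c * (indicator (ball x \<delta>) y * (indicator G e * indicator E (flow A t y + noise i t e))) \<partial>expos) \<partial>lborel)"
    proof -
      interpret P: pair_sigma_finite lborel expos
        by (rule pair_sigma_finite.intro[OF lborel.sigma_finite_measure_axioms stream.P.sigma_finite_measure_axioms])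
      have W': "(\<lambda>(y, e). indicator G e * indicator E (flow A t y + noise i t e) :: ennreal) \<in> borel_measurable (lborel \<Otimes>\<^sub>M expos)"
        using Wm by (simp cong: measurable_cong_sets sets_pair_measure_cong)
      have "(\<lambda>q. ennreal c * (indicator (ball x \<delta>) (fst q) * (case q of (y, e) \<Rightarrow> indicator G e * indicator E (flow A t y + noise i t e)))) \<in> borel_measurable (lborel \<Otimes>\<^sub>M expos)"
        by (intro borel_measurable_times_ennreal W' measurable_compose[OF measurable_fst] borel_measurable_indicator measurable_const) auto
      then have "(\<lambda>(y, e). ennreal c * (indicator (ball x \<delta>) y * (indicator G e * indicator E (flow A t y + noise i t e)))) \<in> borel_measurable (lborel \<Otimes>\<^sub>M expos)"
        by (simp only: case_prod_beta' fst_conv snd_conv)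
      from P.Fubini'[OF this] show ?thesis .
    qed
    also have "\<dots> = (\<integral>\<^sup>+y. ennreal c * indicator (ball x \<delta>) y * q y \<partial>lborel)"
    proof (rule nn_integral_cong)
      fix y
      have m: "(\<lambda>e. indicator G e * indicator E (flow A t y + noise i t e) :: ennreal) \<in> borel_measurable expos"
        using measurable_Pair2[OF Wm, of y] by simp
      show "(\<integral>\<^sup>+e. ennreal c * (indicator (ball x \<delta>) y * (indicator G e * indicator E (flow A t y + noise i t e))) \<partial>expos) = ennreal c * indicator (ball x \<delta>) y * q y"
        unfolding q_eq mult.assoc[symmetric, of "ennreal c"] by (rule nn_integral_cmult[OF m])
    qed
    also have "\<dots> \<le> (\<integral>\<^sup>+y. ennreal (\<rho> i y) * q y \<partial>lborel)"
    proof (rule nn_integral_mono)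
      fix y
      have "ennreal c * indicator (ball x \<delta>) y \<le> ennreal (\<rho> i y)"
        using \<delta>(2)[of y] by (cases "y \<in> ball x \<delta>") (simp_all add: ennreal_leI)
      then show "ennreal c * indicator (ball x \<delta>) y * q y \<le> ennreal (\<rho> i y) * q y" by (rule mult_right_mono) simp
    qed
    also have "\<dots> = (\<integral>\<^sup>+y. q y \<partial>marg i)"
      unfolding marg_eq by (rule nn_integral_density[symmetric]) auto
    also have "\<dots> = (\<integral>\<^sup>+z. indicator {z. snd z = i} z * q (fst z) \<partial>\<mu>)" by (rule nn_integral_marg[OF qm])
    also have "\<dots> \<le> (\<integral>\<^sup>+z. emeasure expos {e. (flow A t (fst z) + noise (snd z) t e, state (snd z) t e) \<in> E \<times> {k}} \<partial>\<mu>)"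
    proof (rule nn_integral_mono)
      fix z :: "(real^'d) \<times> bool"
      have "emeasure expos (W (fst z)) \<le> emeasure expos {e. (flow A t (fst z) + noise (snd z) t e, state (snd z) t e) \<in> E \<times> {k}}" if "snd z = i"
      proof (rule emeasure_mono)
        have "{e \<in> space expos. flow A t (fst z) + noise (snd z) t e \<in> E \<and> state (snd z) t e = k} \<in> sets expos" by measurable
        then show "{e. (flow A t (fst z) + noise (snd z) t e, state (snd z) t e) \<in> E \<times> {k}} \<in> sets expos" by simp
      qed (use that in \<open>auto simp: W_def G_def\<close>)
      then show "indicator {z. snd z = i} z * q (fst z) \<le> emeasure expos {e. (flow A t (fst z) + noise (snd z) t e, state (snd z) t e) \<in> E \<times> {k}}"
        by (auto simp: q_def indicator_def)
    qed
    also have "\<dots> = emeasure \<mu> (E \<times> {k})"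
      by (rule invariance_emeasure[symmetric]) (use t in auto)
    finally show ?thesis by (simp add: emeasure_marg)
  qed
  show ?thesis
  proof (rule ccontr)
    assume "\<not> 0 < \<rho> k (mode_flow A p i t x)"
    then have z: "\<rho> k y0 = 0" using \<rho>_nonneg[of k y0] by (simp add: y0_def)
    define c' where "c' = c * D * measure expos G"
    have c': "c' > 0" using c D GP by (simp add: c'_def)
    have "isCont (\<rho> k) y0" using \<rho>_cont by (simp add: continuous_on_eq_continuous_at)
    then have "\<forall>\<^sub>F y in nhds y0. \<rho> k y < c' / 2"
      unfolding isCont_def tendsto_at_iff_tendsto_nhds using c' z by (intro order_tendstoD(2)) auto
    then obtain s where s: "s > 0" "\<And>y. dist y y0 < s \<Longrightarrow> \<rho> k y < c' / 2"
      unfolding eventually_nhds_metric by auto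
    \<comment> \<open>Small enough for both estimates: its mass is at least \<open>c'\<close> times
      its volume by \<open>lower\<close>, but at most \<open>c' / 2\<close> times by continuity at a
      zero of the density.\<close>
    define E where "E = ball y0 (min s \<epsilon>)"
    have E: "E \<in> sets borel" "E \<subseteq> ball y0 \<epsilon>" by (auto simp: E_def)
    have finE: "emeasure lborel E < \<infinity>" unfolding E_def by (rule emeasure_bounded_finite) simp
    have posE: "emeasure lborel E > 0"
      using emeasure_lborel_open_pos[of E y0] s \<epsilon> by (simp add: E_def)
    have "ennreal c' * emeasure lborel E \<le> emeasure (marg k) E" unfolding c'_def by (rule lower[OF E])
    also have "\<dots> = (\<integral>\<^sup>+y. ennreal (\<rho> k y) * indicator E y \<partial>lborel)"
      unfolding marg_eq using E(1) by (simp add: emeasure_density)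
    also have "\<dots> \<le> (\<integral>\<^sup>+y. ennreal (c' / 2) * indicator E y \<partial>lborel)"
    proof (rule nn_integral_mono)
      fix y
      show "ennreal (\<rho> k y) * indicator E y \<le> ennreal (c' / 2) * indicator E y"
        using s(2)[of y] by (auto simp: E_def indicator_def dist_commute intro!: ennreal_leI)
    qed
    also have "\<dots> = ennreal (c' / 2) * emeasure lborel E" using E(1) by (simp add: nn_integral_cmult_indicator)
    finally have le: "ennreal c' * emeasure lborel E \<le> ennreal (c' / 2) * emeasure lborel E" .
    obtain m where m: "emeasure lborel E = ennreal m" "m > 0"
      using finE posE by (cases "emeasure lborel E") auto
    have "c' * m \<le> c' / 2 * m" using le c' m by (simp add: ennreal_mult[symmetric] ennreal_le_iff)
    then show False using c' m by simp
  qed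
qed

end

section \<open>Controlled trajectories\<close>

context switching
begin

text \<open>Variation of constants with the flow factored out: in
  \<open>y t = flow A t (G t)\<close> the integrand of \<open>G\<close> does not involve
  \<open>t\<close>, so one indefinite integral defines the solution for all times.\<close>

lemma solution_exists:
  assumes j: "piecewise_cont j" and jm: "Measurable.pred borel j"
  obtains y where "solves A p j x y"
proof
  define h where "h s = (if j s then flow A (- s) b else 0)" for s
  define G where "G t = x + integral {0..t} h" for t
  have hint: "h integrable_on {0..T}" for T
  proof -
    have "set_integrable lborel {0..T} (\<lambda>s. if j s then flow A (T - s) b else 0)"
      unfolding set_integrable_def by (rule flow_b_integrable[OF jm])
    from integrable_linear[OF set_borel_integral_eq_integral(1)[OF this] bounded_linear_flow, of A "- T"]
    have "(\<lambda>s. flow A (- T) (if j s then flow A (T - s) b else 0)) integrable_on {0..T}" by (simp add: o_def)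
    moreover have "(\<lambda>s. flow A (- T) (if j s then flow A (T - s) b else 0)) = h"
      by (auto simp: h_def fun_eq_iff flow_simps flow_add[symmetric])
    ultimately show ?thesis by simp
  qed
  \<comment> \<open>Continuity and derivatives within the half-line are local, so statements about
    compact intervals apply.\<close>
  have nhd: "at t within {0..} = at t within {0..t + 1}" for t :: real
    by (rule at_within_nhd[of t "{..<t + 1}"]) auto
  have Gc: "continuous_on {0..} G"
    unfolding continuous_on_eq_continuous_within
  proof
    fix t :: real assume t: "t \<in> {0..}"
    have "continuous_on {0..t + 1} G"
      unfolding G_def by (intro continuous_intros indefinite_integral_continuous_1 hint)
    then show "continuous (at t within {0..}) G"
      using t by (simp add: nhd continuous_on_eq_continuous_within)
  qed
  define y where "y t = flow A t (G t)" for t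
  show "solves A p j x y"
    unfolding solves_def
  proof (intro conjI allI impI)
    show "y 0 = x" by (simp add: y_def G_def)
    show "continuous_on {0..} y" unfolding y_def by (intro continuous_intros Gc)
    fix t :: real assume t: "0 \<le> t" and jc: "continuous (at t within {0..}) j"
    have "\<forall>\<^sub>F s in at t within {0..}. j s = j t"
      using topological_tendstoD[OF jc[unfolded continuous_within], OF Topological_Spaces.open_discrete[of "{j t}"]] by simp
    then have ev: "\<forall>\<^sub>F s in at t within {0..}. h s = (if j t then flow A (- s) b else 0)"
      by (auto simp: h_def elim!: eventually_mono)
    have "((\<lambda>s. if j t then flow A (- s) b else 0) \<longlongrightarrow> h t) (at t within {0..})"
    proof (cases "j t")
      case True
      have "continuous_on UNIV (\<lambda>s. flow A (- s) b)" by (intro continuous_intros)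
      then have "continuous (at t within {0..}) (\<lambda>s. flow A (- s) b)"
        by (simp add: continuous_on_eq_continuous_at continuous_at_imp_continuous_at_within)
      then show ?thesis using True by (simp add: continuous_within h_def)
    qed (simp add: h_def)
    then have "(h \<longlongrightarrow> h t) (at t within {0..})" using tendsto_cong[OF ev] by simp
    then have hc: "continuous (at t within {0..t + 1} - {}) h" by (simp add: continuous_within nhd)
    have minus_mv: "(- A) *v v = - (A *v v)" for v
      by (simp add: matrix_vector_mult_def vec_eq_iff sum_negf)
    have "((\<lambda>u. integral {0..u} h) has_vector_derivative h t) (at t within {0..t + 1} - {})"
      by (rule integral_has_vector_derivative_continuous_at[OF hint _ _ hc]) (use t in auto)
    then have "((\<lambda>u. integral {0..u} h) has_vector_derivative h t) (at t within {0..})" by (simp add: nhd)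
    from has_vector_derivative_add[OF has_vector_derivative_const[of x] this]
    have "(G has_vector_derivative h t) (at t within {0..})" by (simp add: G_def[abs_def])
    from flow_comp_has_vector_derivative[OF this, of "- A" 0]
    have "(y has_vector_derivative flow A t (h t - (- A) *v G t)) (at t within {0..})"
      by (simp add: flow_uminus y_def[abs_def])
    moreover have "flow A t (h t - (- A) *v G t) = vfield A p (j t) (y t)"
      by (simp add: h_def vfield_def y_def flow_simps b_def flow_commute matrix_vector_mult_diff_distrib minus_mv)
    ultimately show "(y has_vector_derivative vfield A p (j t) (y t)) (at t within {0..})" by simp
  qed
qed

end

text \<open>Induction on the number of switches before \<open>t\<close>: the hypothesis covers the
  time up to the last switch, and after it the mode is constant, so one application of
  \<open>step\<close> remains.\<close>

lemma mode_invariant_imp_solution_invariant: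
  assumes step: "\<And>i t z. z \<in> U \<Longrightarrow> t > 0 \<Longrightarrow> mode_flow A p i t z \<in> U"
    and j: "piecewise_cont j" and y: "solves A p j x y" and x: "x \<in> U" and t: "t \<ge> 0"
  shows "y t \<in> U"
proof -
  \<comment> \<open>The open interval excludes its right end, so passing from \<open>t\<close> to
    \<open>s = Max (D t)\<close> drops \<open>s\<close> and the cardinality decreases.\<close>
  define D where "D t = {u \<in> {0<..<t}. \<not> continuous (at u within {0..}) j}" for t
  have finD: "finite (D t)" if "t \<ge> 0" for t
    by (rule finite_subset[of _ "{u \<in> {0..t}. \<not> continuous (at u within {0..}) j}"])
       (use j that in \<open>auto simp: D_def piecewise_cont_def\<close>)
  have const: "\<exists>i. \<forall>u\<in>{s<..<t}. j u = i" if "0 \<le> s" "\<And>u. u \<in> {s<..<t} \<Longrightarrow> u \<notin> D t" for s t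
  proof -
    have "continuous_on {s<..<t} j"
      unfolding continuous_on_eq_continuous_within
    proof
      fix u assume u: "u \<in> {s<..<t}"
      then have "continuous (at u within {0..}) j" using that u by (auto simp: D_def)
      then show "continuous (at u within {s<..<t}) j"
        by (rule continuous_within_subset) (use that in auto)
    qed
    then show ?thesis using connected_iff_const[of "{s<..<t}"] connected_Ioo by blast
  qed
  have jump: "y t \<in> U" if s: "0 \<le> s" "s < t" "y s \<in> U" "\<And>u. u \<in> {s<..<t} \<Longrightarrow> u \<notin> D t" for s t
  proof -
    obtain i where "\<forall>u\<in>{s<..<t}. j u = i" using const[OF s(1,4)] by blast
    then have "y t = mode_flow A p i (t - s) (y s)" using solves_constant_mode[OF y s(1)] s(2) by auto
    then show ?thesis using step[OF s(3)] s(2) by simp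
  qed
  show ?thesis
    using t
  proof (induction "card (D t)" arbitrary: t rule: less_induct)
    case less
    have y0: "y 0 \<in> U" using y x by (simp add: solves_def)
    consider "t = 0" | "t > 0" "D t = {}" | "t > 0" "D t \<noteq> {}" using less.prems by linarith
    then show ?case
    proof cases
      case 1 then show ?thesis using y0 by simp
    next
      case 2 then show ?thesis using jump[of 0 t] y0 by simp
    next
      case 3
      define s where "s = Max (D t)"
      have fin: "finite (D t)" using finD[OF less.prems] .
      have sD: "s \<in> D t" unfolding s_def by (rule Max_in[OF fin 3(2)])
      then have s: "0 < s" "s < t" by (auto simp: D_def)
      have "D s \<subset> D t" using sD s by (auto simp: D_def)
      then have "y s \<in> U" using less.hyps[of s] psubset_card_mono[OF fin] s by simp
      moreover have "u \<notin> D t" if "u \<in> {s<..<t}" for u using Max_ge[OF fin, of u] that by (auto simp: s_def)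
      ultimately show ?thesis using jump[of s t] s by auto
    qed
  qed
qed

context stationary_density
begin

text \<open>Go back a short time along mode \<open>i\<close>, where the density is still positive by
  continuity; on the way forward to \<open>x\<close>, \<open>\<rho>_pos_step\<close> may end in mode
  \<open>k\<close>.\<close>

lemma \<rho>_pos_all:
  assumes "\<rho> i x > 0"
  shows "\<rho> k x > 0"
proof -
  have "continuous_on UNIV (\<lambda>t. \<rho> i (mode_flow A p i (- t) x))"
    unfolding mode_flow_def by (intro continuous_on_compose2[OF \<rho>_cont] continuous_intros) auto
  then have "isCont (\<lambda>t. \<rho> i (mode_flow A p i (- t) x)) 0" by (simp add: continuous_on_eq_continuous_at)
  then have "((\<lambda>t. \<rho> i (mode_flow A p i (- t) x)) \<longlongrightarrow> \<rho> i x) (at 0)"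
    unfolding isCont_def by simp
  then have "((\<lambda>t. \<rho> i (mode_flow A p i (- t) x)) \<longlongrightarrow> \<rho> i x) (at_right 0)"
    by (rule filterlim_mono[OF _ order_refl at_le]) simp
  then have "\<forall>\<^sub>F t in at_right 0. \<rho> i (mode_flow A p i (- t) x) > 0"
    using assms by (rule order_tendstoD(1))
  moreover have "\<forall>\<^sub>F t::real in at_right 0. t > 0" by (rule eventually_at_right_less)
  ultimately have "\<forall>\<^sub>F t in at_right 0. \<rho> i (mode_flow A p i (- t) x) > 0 \<and> t > 0" by eventually_elim simp
  from eventually_happens'[OF trivial_limit_at_right_real this]
  obtain t where "\<rho> i (mode_flow A p i (- t) x) > 0" "t > 0" by blast
  then show ?thesis using \<rho>_pos_step[of i "mode_flow A p i (- t) x" t k] by simp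
qed

lemma \<rho>_pos_reachable:
  assumes "\<rho> i x > 0" "piecewise_cont j" "solves A p j x y" "t \<ge> 0"
  shows "\<rho> i (y t) > 0"
proof -
  have "mode_flow A p m s z \<in> {x. \<rho> i x > 0}" if "z \<in> {x. \<rho> i x > 0}" "s > 0" for m s z
    using \<rho>_pos_step[of m z s i] \<rho>_pos_all[of i z m] that by simp
  from mode_invariant_imp_solution_invariant[of "{x. \<rho> i x > 0}", OF this assms(2,3) _ assms(4)]
  show ?thesis using assms(1) by simp
qed

lemma open_\<rho>_pos: "open {x. \<rho> i x > 0}"
  using \<rho>_cont by (intro open_Collect_less continuous_intros)

lemma emeasure_pos_ball:
  assumes "\<rho> k x > 0" "\<epsilon> > 0"
  shows "emeasure \<mu> (ball x \<epsilon> \<times> {k}) > 0"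
proof (rule ccontr)
  define V where "V = ball x \<epsilon> \<inter> {x. \<rho> k x > 0}"
  have V: "open V" "x \<in> V" using assms open_\<rho>_pos by (auto simp: V_def)
  assume "\<not> ?thesis"
  then have "emeasure (marg k) (ball x \<epsilon>) = 0" by (simp add: emeasure_marg)
  then have "(\<integral>\<^sup>+y. ennreal (\<rho> k y) * indicator (ball x \<epsilon>) y \<partial>lborel) = 0"
    unfolding marg_eq by (simp add: emeasure_density)
  then have "emeasure lborel {y \<in> space lborel. ennreal (\<rho> k y) * indicator (ball x \<epsilon>) y \<noteq> 0} = 0"
    by (subst (asm) nn_integral_0_iff) (auto intro!: borel_measurable_times_ennreal borel_measurable_indicator)
  moreover have "{y \<in> space lborel. ennreal (\<rho> k y) * indicator (ball x \<epsilon>) y \<noteq> 0} = V"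
    by (auto simp: V_def indicator_def ennreal_eq_0_iff not_le)
  ultimately show False using emeasure_lborel_open_pos[OF V] by simp
qed

text \<open>If the density of one mode vanished everywhere, so would the other by
  \<open>\<rho>_pos_all\<close>, and no mass would be left.\<close>

lemma \<rho>_pos_exists: "\<exists>x. \<rho> i x > 0"
proof (rule ccontr)
  assume "\<not> ?thesis"
  then have "\<rho> k x = 0" for k x using \<rho>_pos_all[of k x i] \<rho>_nonneg[of k x] by (metis order_le_less)
  then have "emeasure (marg k) UNIV = 0" for k unfolding marg_eq by (simp add: emeasure_density)
  then have z: "emeasure \<mu> (UNIV \<times> {k}) = 0" for k by (simp add: emeasure_marg)
  have "(UNIV :: ((real^'d) \<times> bool) set) = UNIV \<times> {False} \<union> UNIV \<times> {True}" by auto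
  then have "emeasure \<mu> UNIV \<le> emeasure \<mu> (UNIV \<times> {False}) + emeasure \<mu> (UNIV \<times> {True})"
    using emeasure_subadditive[of "UNIV \<times> {False}" \<mu> "UNIV \<times> {True}"] by (simp add: \<mu>_sets)
  moreover have "space \<mu> = UNIV" using sets_eq_imp_space_eq[OF \<mu>_sets] by (simp add: space_pair_measure)
  ultimately show False using z \<mu>.emeasure_space_1 by simp
qed

end

context stationary_density
begin

text \<open>If no start of norm at most \<open>n\<close> could hit \<open>B\<close> in mode
  \<open>k\<close>, invariance would bound the mass of \<open>B \<times> {k}\<close> by that of the
  remaining starts, contrary to the mass assumption. That assumption does not involve
  \<open>t\<close>, so the radius can be fixed before the time.\<close>

lemma invariance_sample:
  assumes t: "t \<ge> 0" and B: "B \<in> sets borel" and pos: "emeasure \<mu> (B \<times> {k}) > 0"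
    and n: "emeasure \<mu> {z. norm (fst z) \<le> n} + emeasure \<mu> (B \<times> {k}) > 1"
  obtains z i e where "norm z \<le> n" "good e" "flow A t z + noise i t e \<in> B"
proof -
  define Q where "Q z = {e. (flow A t (fst z) + noise (snd z) t e, state (snd z) t e) \<in> B \<times> {k}}" for z
  define N where "N = {z :: (real^'d) \<times> bool. norm (fst z) \<le> n}"
  have Qm: "Q z \<in> sets expos" for z
  proof -
    note [measurable] = B
    have "{e \<in> space expos. flow A t (fst z) + noise (snd z) t e \<in> B \<and> state (snd z) t e = k} \<in> sets expos" by measurable
    then show ?thesis by (simp add: Q_def)
  qed
  have N: "N \<in> sets \<mu>"
  proof -
    have "{z \<in> space \<mu>. norm (fst z) \<le> n} \<in> sets \<mu>" by measurable
    moreover have "space \<mu> = UNIV" using sets_eq_imp_space_eq[OF \<mu>_sets] by (simp add: space_pair_measure)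
    ultimately show ?thesis by (simp add: N_def)
  qed
  have "\<exists>z\<in>N. emeasure expos (Q z) > 0"
  proof (rule ccontr)
    assume "\<not> ?thesis"
    then have z0: "emeasure expos (Q z) = 0" if "z \<in> N" for z using that by (auto simp: not_less)
    have "emeasure \<mu> (B \<times> {k}) = (\<integral>\<^sup>+z. emeasure expos (Q z) \<partial>\<mu>)"
      unfolding Q_def by (rule invariance_emeasure[OF t]) (use B in auto)
    also have "\<dots> \<le> (\<integral>\<^sup>+z. indicator (space \<mu> - N) z \<partial>\<mu>)"
    proof (rule nn_integral_mono)
      fix z assume "z \<in> space \<mu>"
      then show "emeasure expos (Q z) \<le> indicator (space \<mu> - N) z"
        using z0[of z] stream.P.emeasure_le_1[of "Q z"] by (cases "z \<in> N") auto
    qed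
    also have "\<dots> = emeasure \<mu> (space \<mu> - N)" by (rule nn_integral_indicator[OF sets.compl_sets[OF N]])
    finally have "emeasure \<mu> N + emeasure \<mu> (B \<times> {k}) \<le> emeasure \<mu> N + emeasure \<mu> (space \<mu> - N)"
      by (rule add_left_mono)
    also have "\<dots> = emeasure \<mu> (N \<union> (space \<mu> - N))" by (rule plus_emeasure[OF N sets.compl_sets[OF N]]) auto
    also have "N \<union> (space \<mu> - N) = space \<mu>" using sets.sets_into_space[OF N] by auto
    finally show False using n \<mu>.emeasure_space_1 by (simp add: N_def)
  qed
  then obtain z where z: "z \<in> N" "emeasure expos (Q z) > 0" by blast
  have "\<exists>e\<in>Q z. good e"
  proof (rule ccontr)
    assume "\<not> ?thesis"
    then have "AE e in expos. e \<notin> Q z" using AE_good by (auto elim!: eventually_mono)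
    then have "emeasure expos (Q z) = 0" using Qm[of z] by (subst (asm) AE_iff_measurable[OF Qm[of z]]) auto
    then show False using z by simp
  qed
  then obtain e where "e \<in> Q z" "good e" by blast
  then show ?thesis using that[of "fst z" e "snd z"] z by (auto simp: Q_def N_def)
qed

lemma norm_ball_mass:
  assumes "\<delta> > 0"
  shows "\<exists>n. emeasure \<mu> {z. norm (fst z) \<le> n} + \<delta> > 1"
proof -
  have sp: "space \<mu> = UNIV" using sets_eq_imp_space_eq[OF \<mu>_sets] by (simp add: space_pair_measure)
  define N where "N n = {z :: (real^'d) \<times> bool. norm (fst z) \<le> real n}" for n
  have N: "N n \<in> sets \<mu>" for n
  proof -
    have "{z \<in> space \<mu>. norm (fst z) \<le> real n} \<in> sets \<mu>" by measurable
    then show ?thesis by (simp add: N_def sp)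
  qed
  have "(\<lambda>n. emeasure \<mu> (N n)) \<longlonglongrightarrow> emeasure \<mu> (\<Union>n. N n)"
    by (rule Lim_emeasure_incseq) (use N in \<open>auto simp: incseq_def N_def intro: order_trans\<close>)
  moreover have "emeasure \<mu> (\<Union>n. N n) = 1"
  proof -
    have "(\<Union>n. N n) = space \<mu>" using real_arch_simple by (auto simp: N_def sp)
    then show ?thesis using \<mu>.emeasure_space_1 by simp
  qed
  ultimately have lim: "(\<lambda>n. emeasure \<mu> (N n)) \<longlonglongrightarrow> 1" using \<mu>.emeasure_space_1 by simp
  have "(\<lambda>n. emeasure \<mu> (N n) + \<delta>) \<longlonglongrightarrow> 1 + \<delta>" by (intro tendsto_intros lim)
  moreover have "1 < 1 + \<delta>" using assms by (cases \<delta>) (auto simp: ennreal_plus[symmetric] ennreal_less_iff simp del: ennreal_plus ennreal_1 simp flip: ennreal_1)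
  ultimately have "\<forall>\<^sub>F n in sequentially. 1 < emeasure \<mu> (N n) + \<delta>" by (rule order_tendstoD(1))
  then show ?thesis unfolding N_def by (auto dest!: eventually_happens)
qed

text \<open>Invariance provides a path from a bounded start \<open>z\<close> that ends near
  \<open>x\<close>. Driving \<open>y\<close> by the same control for the same time changes the end
  point by \<open>flow A t (y - z)\<close>, which contraction makes small.\<close>

lemma \<rho>_pos_subset_accessible:
  assumes C: "C > 0" and c: "c < 0" and growth: "\<And>t x. t \<ge> 0 \<Longrightarrow> norm (flow A t x) \<le> C * exp (c * t) * norm x"
  shows "{x. \<rho> k x > 0} \<subseteq> accessible_set A p"
proof
  fix x assume "x \<in> {x. \<rho> k x > 0}"
  then have x: "\<rho> k x > 0" by simp
  show "x \<in> accessible_set A p"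
    unfolding accessible_set_def
  proof
    fix y
    show "x \<in> closure (reachable A p y)"
      unfolding closure_approachable
    proof (intro allI impI)
      fix \<epsilon> :: real assume \<epsilon>: "\<epsilon> > 0"
      define B where "B = ball x (\<epsilon> / 2)"
      have pos: "emeasure \<mu> (B \<times> {k}) > 0" unfolding B_def using emeasure_pos_ball[OF x, of "\<epsilon> / 2"] \<epsilon> by simp
      \<comment> \<open>The radius is fixed first; a large \<open>t\<close> then beats
        \<open>norm y + n\<close>.\<close>
      obtain n where n: "emeasure \<mu> {z. norm (fst z) \<le> n} + emeasure \<mu> (B \<times> {k}) > 1"
        using norm_ball_mass[OF pos] by blast
      have "((\<lambda>t. C * exp (c * t) * (norm y + n)) \<longlongrightarrow> 0) at_top"
        using c by real_asymp
      then have "\<forall>\<^sub>F t in at_top. C * exp (c * t) * (norm y + n) < \<epsilon> / 2"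
        using \<epsilon> by (intro order_tendstoD(2)) auto
      moreover have "\<forall>\<^sub>F t::real in at_top. t \<ge> 0" by (rule eventually_ge_at_top)
      ultimately have "\<forall>\<^sub>F t in at_top. C * exp (c * t) * (norm y + n) < \<epsilon> / 2 \<and> t \<ge> 0" by eventually_elim simp
      then obtain t where t: "C * exp (c * t) * (norm y + n) < \<epsilon> / 2" "t \<ge> 0"
        using eventually_happens'[OF trivial_limit_at_top_linorder] by blast
      obtain z i e where z: "norm z \<le> n" "good e" "flow A t z + noise i t e \<in> B"
        by (rule invariance_sample[OF t(2) _ pos n]) (auto simp: B_def)
      define j where "j s = state i s e" for s
      have [measurable]: "Measurable.pred borel j"
        unfolding j_def by (rule state_measurable) (auto intro: measurable_const)
      have jp: "piecewise_cont j" by (rule state_piecewise_cont[OF z(2)]) (simp add: j_def)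
      obtain u where u: "solves A p j y u" using solution_exists[OF jp, of y] by auto
      have ut: "u t = flow A t y + noise i t e" by (rule state_solves[OF z(2) _ u t(2)]) (simp add: j_def)
      have "u t - (flow A t z + noise i t e) = flow A t (y - z)" by (simp add: ut flow_simps)
      also have "norm \<dots> \<le> C * exp (c * t) * norm (y - z)" by (rule growth[OF t(2)])
      also have "\<dots> \<le> C * exp (c * t) * (norm y + n)"
        using norm_triangle_ineq4[of y z] z C by (intro mult_left_mono) auto
      finally have "dist (u t) (flow A t z + noise i t e) < \<epsilon> / 2" using t by (simp add: dist_norm)
      moreover have "dist (flow A t z + noise i t e) x < \<epsilon> / 2" using z(3) by (simp add: B_def dist_commute)
      ultimately have "dist (u t) x < \<epsilon>" using dist_triangle[of "u t" x "flow A t z + noise i t e"] by simp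
      moreover have "u t \<in> reachable A p y" unfolding reachable_def using t jp u by blast
      ultimately show "\<exists>w\<in>reachable A p y. dist w x < \<epsilon>" by blast
    qed
  qed
qed

text \<open>One start with positive density is enough: everything reachable from it has positive
  density, and the accessible set lies in the closure of what is reachable.\<close>

lemma accessible_subset_closure: "accessible_set A p \<subseteq> closure {x. \<rho> k x > 0}"
proof -
  obtain z where z: "\<rho> k z > 0" using \<rho>_pos_exists by blast
  have "reachable A p z \<subseteq> {x. \<rho> k x > 0}" unfolding reachable_def using \<rho>_pos_reachable[OF z] by blast
  then have "closure (reachable A p z) \<subseteq> closure {x. \<rho> k x > 0}" by (rule closure_mono)
  then show ?thesis unfolding accessible_set_def by blast
qed

end

section \<open>Pulse controls and the interior of the accessible set\<close>

text \<open>A nonzero vector orthogonal to \<open>flow A (- s) b\<close> for all \<open>s\<close>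
  between 0 and \<open>T\<close> would give uncountably many zeros of the phase velocity. As
  \<open>T\<close> is arbitrary, steering is possible in arbitrarily short time.\<close>

lemma flow_basis:
  fixes A :: "real^'d^'d"
  assumes zeros: "\<And>\<theta>. \<theta> \<noteq> 0 \<Longrightarrow> countable {s. \<theta> \<bullet> flow A s b = 0}" and T: "T > 0"
  obtains \<tau> :: "'d \<Rightarrow> real" where "inj \<tau>" "\<And>k. 0 < \<tau> k" "\<And>k. \<tau> k < T"
    "span (range (\<lambda>k. flow A (- \<tau> k) b)) = UNIV"
proof -
  define S where "S = (\<lambda>s. flow A (- s) b) ` {0<..<T}"
  have spanS: "span S = UNIV"
  proof (rule ccontr)
    assume "span S \<noteq> UNIV"
    then obtain \<theta> where \<theta>: "\<theta> \<noteq> 0" "\<forall>x\<in>span S. \<theta> \<bullet> x = 0" using span_not_UNIV_orthogonal by blast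
    have "{- T<..<0} \<subseteq> {s. \<theta> \<bullet> flow A s b = 0}"
    proof
      fix s assume "s \<in> {- T<..<0}"
      then have "flow A (- (- s)) b \<in> S" unfolding S_def by (intro imageI) auto
      then show "s \<in> {s. \<theta> \<bullet> flow A s b = 0}" using \<theta>(2) span_base by auto
    qed
    then have "countable {- T<..<0}" using zeros[OF \<theta>(1)] by (rule countable_subset)
    then show False using uncountable_open_interval[of "- T" 0] T by simp
  qed
  obtain B where B: "B \<subseteq> S" "independent B" "S \<subseteq> span B" "card B = dim S" by (rule basis_exists[of S])
  have "dim S = CARD('d)" using dim_span[of S] by (simp add: spanS)
  then have "card (UNIV :: 'd set) = card B" using B by simp
  then obtain f where f: "bij_betw f (UNIV :: 'd set) B"
    using finite_same_card_bij[of "UNIV :: 'd set" B] independent_imp_finite[OF B(2)] by auto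
  have "\<exists>s. 0 < s \<and> s < T \<and> f k = flow A (- s) b" for k
  proof -
    have "f k \<in> S" using f B(1) by (auto simp: bij_betw_def)
    then show ?thesis by (auto simp: S_def)
  qed
  then obtain \<tau> where \<tau>: "\<And>k. 0 < \<tau> k \<and> \<tau> k < T \<and> f k = flow A (- \<tau> k) b" by metis
  have "range (\<lambda>k. flow A (- \<tau> k) b) = range f" by (rule image_cong) (use \<tau> in auto)
  then have rng: "range (\<lambda>k. flow A (- \<tau> k) b) = B" using f by (simp add: bij_betw_def)
  have "S \<subseteq> span B" by (rule B(3))
  then have sp: "span B = UNIV" using span_mono[of S "span B"] spanS by (simp add: span_span top.extremum_unique)
  have inj: "inj \<tau>"
  proof (rule injI)
    fix k l assume "\<tau> k = \<tau> l"
    then have "f k = f l" using \<tau> by simp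
    then show "k = l" using f by (auto simp: bij_betw_def inj_on_def)
  qed
  show ?thesis by (rule that[OF inj]) (use \<tau> rng sp in auto)
qed

lemma flow_neg_has_vector_derivative:
  "((\<lambda>u. flow A (- u) p) has_vector_derivative flow A (- u) (- (A *v p))) (at u within S)"
  using flow_comp_has_vector_derivative[of "\<lambda>_. p" 0 u S A 0] by simp

text \<open>The control is \<open>True\<close> exactly on short pulses \<open>[\<tau> k - \<eta>, \<tau> k + s $ k]\<close>; the starting points
  it steers to \<open>x\<close> depend on \<open>s\<close> through a submersion.\<close>

lemma pulse_solution:
  fixes A :: "real^'d^'d" and \<tau> :: "'d \<Rightarrow> real"
  assumes sep: "\<And>k l. k \<noteq> l \<Longrightarrow> 2 * \<eta> < \<bar>\<tau> k - \<tau> l\<bar>" and \<tau>: "\<And>k. \<eta> < \<tau> k" "\<And>k. \<tau> k + \<eta> < T"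
    and s: "\<And>k. \<bar>s k\<bar> < \<eta>" 
    and j: "\<And>u. j u \<longleftrightarrow> (\<exists>k. \<tau> k - \<eta> \<le> u \<and> u \<le> \<tau> k + s k)"
    and pc: "piecewise_cont j"
    and y: "solves A p j w y"
  shows "y T = flow A T (w + (\<Sum>k\<in>UNIV. flow A (- (\<tau> k + s k)) p - flow A (- (\<tau> k - \<eta>)) p))"
proof -
  \<comment> \<open>\<open>undefined\<close> stands for some index; the index type is
    nonempty.\<close>
  have T: "T > 0" and \<eta>: "\<eta> > 0" using s[of undefined] \<tau>[of undefined] by auto
  define J where "J k = {\<tau> k - \<eta>..\<tau> k + s k}" for k
  define b where "b = - (A *v p)"
  define \<Sigma> where "\<Sigma> = (\<Sum>k\<in>UNIV. flow A (- (\<tau> k + s k)) p - flow A (- (\<tau> k - \<eta>)) p)"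
  have "((\<lambda>u. if u \<in> J k then flow A (- u) b else 0) has_integral (flow A (- (\<tau> k + s k)) p - flow A (- (\<tau> k - \<eta>)) p)) {0..T}" for k
  proof -
    have sk: "\<bar>s k\<bar> < \<eta>" "\<eta> < \<tau> k" "\<tau> k + \<eta> < T" using s \<tau> by auto
    have sub: "J k \<subseteq> {0..T}" using sk by (auto simp: J_def)
    have "((\<lambda>u. flow A (- u) b) has_integral (flow A (- (\<tau> k + s k)) p - flow A (- (\<tau> k - \<eta>)) p)) (J k)"
      unfolding J_def b_def
      by (rule fundamental_theorem_of_calculus) (use sk in \<open>auto intro: flow_neg_has_vector_derivative\<close>)
    then show ?thesis by (simp add: has_integral_restrict[OF sub])
  qed
  then have "((\<lambda>u. \<Sum>k\<in>UNIV. if u \<in> J k then flow A (- u) b else 0) has_integral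
     (\<Sum>k\<in>UNIV. flow A (- (\<tau> k + s k)) p - flow A (- (\<tau> k - \<eta>)) p)) {0..T}"
    by (intro has_integral_sum) auto
  \<comment> \<open>By \<open>sep\<close> the pulses are disjoint, so at most one summand is
    nonzero.\<close>
  moreover have "(\<Sum>k\<in>UNIV. if u \<in> J k then flow A (- u) b else 0) = (if j u then flow A (- u) b else 0)" for u
  proof (cases "j u")
    case True
    then obtain k where k: "u \<in> J k" using j by (auto simp: J_def)
    have "u \<notin> J l" if "l \<noteq> k" for l using k sep[OF that] s[of k] s[of l] by (auto simp: J_def)
    then have "(\<Sum>l\<in>UNIV. if u \<in> J l then flow A (- u) b else 0) = (\<Sum>l\<in>UNIV. if l = k then flow A (- u) b else 0)"
      using k by (intro sum.cong) auto
    then show ?thesis using True by simp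
  next
    case False
    then have "u \<notin> J k" for k using j by (auto simp: J_def)
    then show ?thesis using False by simp
  qed
  ultimately have "((\<lambda>u. if j u then flow A (- u) b else 0) has_integral
     (\<Sum>k\<in>UNIV. flow A (- (\<tau> k + s k)) p - flow A (- (\<tau> k - \<eta>)) p)) {0..T}" by simp
  then have h: "((\<lambda>u. if j u then flow A (- u) b else 0) has_integral \<Sigma>) {0..T}" by (simp only: \<Sigma>_def)
  have "((\<lambda>u. flow A T (if j u then flow A (- u) b else 0)) has_integral flow A T \<Sigma>) {0..T}"
    using has_integral_linear[OF h bounded_linear_flow, of A T] by (simp add: o_def)
  moreover have "(\<lambda>u. flow A T (if j u then flow A (- u) b else 0)) = (\<lambda>u. if j u then flow A (T - u) b else 0)"
    by (auto simp: fun_eq_iff flow_simps flow_add[symmetric])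
  ultimately have h1: "((\<lambda>u. if j u then flow A (T - u) b else 0) has_integral flow A T \<Sigma>) {0..T}" by simp
  have h2: "((\<lambda>u. if j u then flow A (T - u) b else 0) has_integral (y T - flow A T w)) {0..T}"
    unfolding b_def by (rule solves_has_integral[OF pc y]) (use T in simp)
  have "y T - flow A T w = flow A T \<Sigma>" by (rule has_integral_unique[OF h2 h1])
  then have "y T = flow A T (w + \<Sigma>)" by (simp add: flow_simps diff_eq_eq add.commute)
  then show ?thesis by (simp only: \<Sigma>_def)
qed

lemma pulse_piecewise_cont:
  fixes J :: "'k::finite \<Rightarrow> real set"
  assumes J: "\<And>k. J k = {l k..r k}" and j: "\<And>u. j u \<longleftrightarrow> u \<in> (\<Union>k. J k)"
  shows "piecewise_cont j" "Measurable.pred borel j"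
proof -
  show "Measurable.pred borel j"
  proof -
    have "(\<Union>k. J k) \<in> sets borel" unfolding J by (intro sets.finite_UN) auto
    then have "Measurable.pred borel (\<lambda>u. u \<in> (\<Union>k. J k))" by measurable
    then show ?thesis using j by (simp cong: measurable_cong)
  qed
  define E where "E = range l \<union> range r"
  show "piecewise_cont j"
    unfolding piecewise_cont_def
  proof (intro allI impI)
    fix T :: real assume "T \<ge> 0"
    show "finite {t \<in> {0..T}. \<not> continuous (at t within {0..}) j}"
    proof (rule finite_subset)
      show "finite E" by (simp add: E_def)
      show "{t \<in> {0..T}. \<not> continuous (at t within {0..}) j} \<subseteq> E"
      proof (rule ccontr)
        assume "\<not> ?thesis"
        then obtain t where t: "t \<notin> E" "\<not> continuous (at t within {0..}) j" by blast
        have "\<forall>\<^sub>F u in nhds t. (u \<in> J k) = (t \<in> J k)" for k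
        proof -
          have "t \<noteq> l k" "t \<noteq> r k" using t(1) by (auto simp: E_def)
          then have "t \<in> {l k<..<r k} \<or> t \<in> - {l k..r k}" by auto
          then show ?thesis
          proof
            assume "t \<in> {l k<..<r k}"
            then have "\<forall>\<^sub>F u in nhds t. u \<in> {l k<..<r k}" by (intro eventually_nhds_in_open) auto
            then show ?thesis using \<open>t \<in> {l k<..<r k}\<close> by (auto simp: J elim!: eventually_mono)
          next
            assume "t \<in> - {l k..r k}"
            then have "\<forall>\<^sub>F u in nhds t. u \<in> - {l k..r k}" by (intro eventually_nhds_in_open) auto
            then show ?thesis using \<open>t \<in> - {l k..r k}\<close> by (auto simp: J elim!: eventually_mono)
          qed
        qed
        then have "\<forall>\<^sub>F u in nhds t. \<forall>k. (u \<in> J k) = (t \<in> J k)" by (rule eventually_all_finite)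
        then have "\<forall>\<^sub>F u in nhds t. j u = j t" by (auto simp: j elim!: eventually_mono)
        then have "\<forall>\<^sub>F u in at t within {0..}. j u = j t" by (auto simp: eventually_at_filter elim!: eventually_mono)
        then have "continuous (at t within {0..}) j" unfolding continuous_within by (rule tendsto_eventually)
        then show False using t by simp
      qed
    qed
  qed
qed

context stationary_density
begin

text \<open>The end point \<open>x\<close> is fixed and the start varies: \<open>F s\<close> is the
  start that the pulses with shifts \<open>s\<close> steer to \<open>x\<close> in time
  \<open>T\<close>. The columns of its derivative at 0 span, so \<open>F\<close> covers a
  neighbourhood of \<open>F 0\<close>, a point of the accessible set. Points of positive density are
  dense there, and positivity travels along the trajectory to \<open>x\<close>.\<close>

lemma interior_accessible_subset:
  assumes zeros: "\<And>\<theta>. \<theta> \<noteq> 0 \<Longrightarrow> countable {s. \<theta> \<bullet> flow A s b = 0}"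
  shows "interior (accessible_set A p) \<subseteq> {x. \<rho> i x > 0}"
proof
  fix x assume "x \<in> interior (accessible_set A p)"
  then obtain R where R: "R > 0" "ball x R \<subseteq> accessible_set A p" by (auto simp: mem_interior)
  have "continuous_on UNIV (\<lambda>t. flow A (- t) x)" by (intro continuous_intros)
  then have "isCont (\<lambda>t. flow A (- t) x) 0" by (simp add: continuous_on_eq_continuous_at)
  then have "((\<lambda>t. flow A (- t) x) \<longlongrightarrow> x) (at 0)" unfolding isCont_def by simp
  then have "((\<lambda>t. flow A (- t) x) \<longlongrightarrow> x) (at_right 0)" by (rule filterlim_mono[OF _ order_refl at_le]) simp
  then have "\<forall>\<^sub>F t in at_right 0. dist (flow A (- t) x) x < R / 2" by (rule tendstoD) (use R in simp)
  moreover have "\<forall>\<^sub>F t::real in at_right 0. t > 0" by (rule eventually_at_right_less)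
  ultimately have "\<forall>\<^sub>F t in at_right 0. dist (flow A (- t) x) x < R / 2 \<and> t > 0" by eventually_elim simp
  from eventually_happens'[OF trivial_limit_at_right_real this]
  obtain T where T: "dist (flow A (- T) x) x < R / 2" "T > 0" by blast
  obtain \<tau> :: "'d \<Rightarrow> real" where \<tau>: "inj \<tau>" "\<And>k. 0 < \<tau> k" "\<And>k. \<tau> k < T"
    and span: "span (range (\<lambda>k. flow A (- \<tau> k) b)) = UNIV"
    using flow_basis[OF zeros T(2)] by blast
  \<comment> \<open>Displacement caused by the unshifted pulses; it vanishes with their length,
    which keeps \<open>F 0\<close> within \<open>R\<close> of \<open>x\<close>.\<close>
  define D where "D \<eta> = (\<Sum>k\<in>UNIV. flow A (- \<tau> k) p - flow A (- (\<tau> k - \<eta>)) p)" for \<eta>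
  have "continuous_on UNIV D" unfolding D_def by (intro continuous_intros)
  then have "isCont D 0" by (simp add: continuous_on_eq_continuous_at)
  then have "(D \<longlongrightarrow> 0) (at 0)" unfolding isCont_def by (simp add: D_def)
  then have "(D \<longlongrightarrow> 0) (at_right 0)" by (rule filterlim_mono[OF _ order_refl at_le]) simp
  then have e1: "\<forall>\<^sub>F \<eta> in at_right 0. norm (D \<eta>) < R / 2" using tendstoD[of D 0 _ "R / 2"] R by simp
  have small: "\<forall>\<^sub>F \<eta>::real in at_right 0. \<eta> < c" if "c > 0" for c
    using that by (auto simp: eventually_at_right intro!: exI[of _ c])
  have e2: "\<forall>\<^sub>F \<eta> in at_right 0. \<forall>k. \<eta> < \<tau> k" by (intro eventually_all_finite small \<tau>)
  have e3: "\<forall>\<^sub>F \<eta> in at_right 0. \<forall>k. \<eta> < T - \<tau> k" by (intro eventually_all_finite small) (use \<tau> in simp)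
  \<comment> \<open>The value 1 on the diagonal is a dummy that keeps the bounds positive for all
    pairs.\<close>
  have e4: "\<forall>\<^sub>F \<eta> in at_right 0. \<forall>k l. \<eta> < (if k = l then 1 else \<bar>\<tau> k - \<tau> l\<bar> / 2)"
    by (intro eventually_all_finite small) (use \<tau>(1) in \<open>auto dest: injD\<close>)
  have e5: "\<forall>\<^sub>F \<eta>::real in at_right 0. \<eta> > 0" by (rule eventually_at_right_less)
  have "\<forall>\<^sub>F \<eta> in at_right 0. norm (D \<eta>) < R / 2 \<and> (\<forall>k. \<eta> < \<tau> k) \<and> (\<forall>k. \<eta> < T - \<tau> k)
      \<and> (\<forall>k l. \<eta> < (if k = l then 1 else \<bar>\<tau> k - \<tau> l\<bar> / 2)) \<and> \<eta> > 0"
    using e1 e2 e3 e4 e5 by eventually_elim (intro conjI)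
  from eventually_happens'[OF trivial_limit_at_right_real this]
  obtain \<eta> where \<eta>: "norm (D \<eta>) < R / 2" "\<And>k. \<eta> < \<tau> k" "\<And>k. \<eta> < T - \<tau> k" "\<eta> > 0"
    and sep: "\<And>k l. \<eta> < (if k = l then 1 else \<bar>\<tau> k - \<tau> l\<bar> / 2)" by blast
  define F where "F s = flow A (- T) x - (\<Sum>k\<in>UNIV. flow A (- (\<tau> k + s $ k)) p - flow A (- (\<tau> k - \<eta>)) p)"
    for s :: "real^'d"
  define S where "S = {s :: real^'d. \<forall>k. \<bar>s $ k\<bar> < \<eta>}"
  \<comment> \<open>Lengthening pulse \<open>k\<close> adds a multiple of
    \<open>flow A (- \<tau> k) b\<close> to the drive, which the start has to compensate; hence the
    sign.\<close>
  define F' where "F' v = - (\<Sum>k\<in>UNIV. (v $ k) *\<^sub>R flow A (- \<tau> k) b)" for v :: "real^'d"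
  have S: "open S"
  proof -
    have "S = (\<Inter>k. {s. \<bar>s $ k\<bar> < \<eta>})" by (auto simp: S_def)
    moreover have "open {s :: real^'d. \<bar>s $ k\<bar> < \<eta>}" for k by (intro open_Collect_less continuous_intros)
    ultimately show ?thesis by (simp add: open_INT)
  qed
  have S0: "0 \<in> S" using \<eta> by (simp add: S_def)
  have F0: "dist (F 0) x < R"
  proof -
    have "F 0 - x = (flow A (- T) x - x) - D \<eta>" by (simp add: F_def D_def)
    then have "norm (F 0 - x) \<le> norm (flow A (- T) x - x) + norm (D \<eta>)" using norm_triangle_ineq4 by metis
    then show ?thesis using T(1) \<eta>(1) by (simp add: dist_norm)
  qed
  have Fc: "continuous_on S F" unfolding F_def by (intro continuous_intros)
  have der: "(F has_derivative F') (at 0)"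
  proof -
    have "((\<lambda>s :: real^'d. flow A (- (\<tau> k + s $ k)) p) has_derivative (\<lambda>v. (v $ k) *\<^sub>R flow A (- \<tau> k) b)) (at 0)" for k
    proof -
      have i: "((\<lambda>s :: real^'d. \<tau> k + s $ k) has_derivative (\<lambda>v. v $ k)) (at 0)"
        by (auto intro!: derivative_eq_intros bounded_linear_imp_has_derivative bounded_linear_vec_nth)
      have o: "((\<lambda>u. flow A (- u) p) has_derivative (\<lambda>h. h *\<^sub>R flow A (- \<tau> k) b)) (at (\<tau> k + 0 $ k))"
        using flow_neg_has_vector_derivative[of A p "\<tau> k" UNIV] by (simp add: has_vector_derivative_def b_def)
      show ?thesis by (rule has_derivative_compose[OF i o])
    qed
    then have "((\<lambda>s. flow A (- T) x - (\<Sum>k\<in>UNIV. flow A (- (\<tau> k + s $ k)) p - flow A (- (\<tau> k - \<eta>)) p))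
       has_derivative (\<lambda>v. 0 - (\<Sum>k\<in>UNIV. (v $ k) *\<^sub>R flow A (- \<tau> k) b - 0))) (at (0 :: real^'d))"
      by (intro has_derivative_diff has_derivative_sum has_derivative_const)
    then show ?thesis by (simp add: F_def[abs_def] F'_def[abs_def])
  qed
  have linF: "linear F'"
    unfolding F'_def
    by (intro linear_compose_neg linear_compose_sum ballI linearI) (simp_all add: scaleR_add_left)
  have "surj F'"
  proof -
    have "flow A (- \<tau> k) b \<in> range F'" for k
    proof
      have "(\<Sum>l\<in>UNIV. ((- axis k 1) $ l) *\<^sub>R flow A (- \<tau> l) b) = (\<Sum>l\<in>UNIV. if l = k then - flow A (- \<tau> k) b else 0)"
        by (rule sum.cong) (auto simp: axis_def)
      then show "flow A (- \<tau> k) b = F' (- axis k 1)" by (simp add: F'_def)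
    qed simp
    then have "span (range (\<lambda>k. flow A (- \<tau> k) b)) \<subseteq> range F'"
      by (intro span_minimal) (auto intro: linear_subspace_image[OF linF] subspace_UNIV)
    then show ?thesis using span by auto
  qed
  then obtain G where G: "linear G" "F' \<circ> G = id" using linear_surjective_right_inverse[OF linF] by blast
  \<comment> \<open>Continuity on \<open>S\<close> and a right inverse of the derivative at the
    single point 0 give openness at that point.\<close>
  have "F 0 \<in> interior (F ` S)"
    by (rule sussmann_open_mapping[OF S Fc S0 der _ G(2), of S])
       (use G(1) S S0 in \<open>auto simp: linear_conv_bounded_linear interior_open\<close>)
  define V where "V = interior (F ` S) \<inter> ball x R"
  have V: "open V" "F 0 \<in> V" using \<open>F 0 \<in> interior (F ` S)\<close> F0 by (auto simp: V_def dist_commute)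
  have "F 0 \<in> closure {x. \<rho> i x > 0}" using V accessible_subset_closure[of i] R by (auto simp: V_def)
  then have "V \<inter> {x. \<rho> i x > 0} \<noteq> {}" using V by (auto simp: closure_iff_nhds_not_empty)
  then obtain w where w: "w \<in> V" "\<rho> i w > 0" by blast
  then obtain s where s: "s \<in> S" "w = F s" using interior_subset by (auto simp: V_def)
  define j where "j u \<longleftrightarrow> u \<in> (\<Union>k. {\<tau> k - \<eta>..\<tau> k + s $ k})" for u
  have jp: "piecewise_cont j" "Measurable.pred borel j"
    by (rule pulse_piecewise_cont[where J = "\<lambda>k. {\<tau> k - \<eta>..\<tau> k + s $ k}", OF refl j_def])+
  obtain y where y: "solves A p j w y" using solution_exists[OF jp] by blast
  have "y T = flow A T (w + (\<Sum>k\<in>UNIV. flow A (- (\<tau> k + s $ k)) p - flow A (- (\<tau> k - \<eta>)) p))"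
  proof (rule pulse_solution[OF _ _ _ _ _ jp(1) y])
    fix k l :: 'd assume "k \<noteq> l"
    then show "2 * \<eta> < \<bar>\<tau> k - \<tau> l\<bar>" using sep[of k l] by simp
  next
    fix k :: 'd
    show "\<eta> < \<tau> k" "\<tau> k + \<eta> < T" "\<bar>s $ k\<bar> < \<eta>" using \<eta>(2,3)[of k] s(1) by (auto simp: S_def)
  qed (simp add: j_def)
  also have "\<dots> = x" by (simp add: s(2) F_def)
  finally show "x \<in> {x. \<rho> i x > 0}" using \<rho>_pos_reachable[OF w(2) jp(1) y, of T] T(2) by simp
qed

lemma \<rho>_pos_eq_interior:
  assumes "\<And>\<theta>. \<theta> \<noteq> 0 \<Longrightarrow> countable {s. \<theta> \<bullet> flow A s b = 0}"
    and "C > 0" "c < 0" "\<And>t x. t \<ge> 0 \<Longrightarrow> norm (flow A t x) \<le> C * exp (c * t) * norm x"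
  shows "{x. \<rho> i x > 0} = interior (accessible_set A p)"
  using interior_accessible_subset[OF assms(1)] interior_maximal[OF \<rho>_pos_subset_accessible[OF assms(2-4)] open_\<rho>_pos]
  by blast

end

section \<open>Stability, controllability and the conclusion\<close>

text \<open>A vector in the kernel of \<open>A\<close> is fixed by the flow and cannot decay unless
  it is 0.\<close>

lemma decay_imp_inj:
  fixes A :: "real^'d^'d"
  assumes c: "c < 0" and growth: "\<And>t x. t \<ge> 0 \<Longrightarrow> norm (flow A t x) \<le> C * exp (c * t) * norm x"
  shows "inj ((*v) A)"
proof -
  have "v = 0" if v: "A *v v = 0" for v
  proof -
    have "((\<lambda>t. flow A t v) has_vector_derivative 0) (at t within UNIV)" for t
      using flow_has_vector_derivative(2)[of A v t UNIV] v by (simp add: flow_simps)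
    then obtain w where "\<And>t. flow A t v = w"
      using has_vector_derivative_zero_constant[of UNIV "\<lambda>t. flow A t v"] by auto
    then have fv: "flow A t v = v" for t by (metis flow_0)
    have "((\<lambda>t. C * exp (c * t) * norm v) \<longlongrightarrow> 0) at_top" using c by real_asymp
    moreover have "\<forall>\<^sub>F t in at_top. norm v \<le> C * exp (c * t) * norm v"
      using eventually_ge_at_top[of 0] by eventually_elim (use growth[of _ v] fv in simp)
    ultimately have "norm v \<le> 0"
      by (intro tendsto_lowerbound[OF _ _ trivial_limit_at_top_linorder])
    then show ?thesis by simp
  qed
  then show ?thesis by (subst linear_injective_0) auto
qed

text \<open>The independence assumption concerns \<open>p\<close>, while the phase velocity is built
  from \<open>b = - A p\<close>. Orthogonality to the iterates of \<open>b\<close> means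
  orthogonality to the range of \<open>A\<close>, which is everything because \<open>A\<close> is
  invertible.\<close>

lemma krylov_observable:
  fixes A :: "real^'d^'d"
  assumes inj: "inj ((*v) A)"
    and p: "inj_on (\<lambda>k. (((*v) A) ^^ k) p) {..<CARD('d)}"
      "independent ((\<lambda>k. (((*v) A) ^^ k) p) ` {..<CARD('d)})"
    and \<theta>: "\<And>k. k < CARD('d) \<Longrightarrow> \<theta> \<bullet> (((*v) A) ^^ k) (- (A *v p)) = 0"
  shows "\<theta> = 0"
proof -
  define K where "K = (\<lambda>k. (((*v) A) ^^ k) p) ` {..<CARD('d)}"
  have "card K = CARD('d)" unfolding K_def using card_image[OF p(1)] by simp
  then have span: "span K = UNIV"
    using card_ge_dim_independent[of K UNIV] p(2) by (auto simp: K_def)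
  have pow: "(((*v) A) ^^ k) (- (A *v p)) = - (A *v (((*v) A) ^^ k) p)" for k
    by (induction k) (simp_all add: linear_neg[OF matrix_vector_mul_linear])
  have sub: "subspace {w. \<theta> \<bullet> (A *v w) = 0}"
    by (rule subspaceI) (simp_all add: matrix_vector_right_distrib inner_add_right matrix_vector_mult_scaleR)
  have "K \<subseteq> {w. \<theta> \<bullet> (A *v w) = 0}" using \<theta> by (auto simp: K_def pow)
  then have "span K \<subseteq> {w. \<theta> \<bullet> (A *v w) = 0}" by (rule span_minimal[OF _ sub])
  then have orth: "\<theta> \<bullet> (A *v w) = 0" for w using span by auto
  have "surj ((*v) A)" using linear_injective_imp_surjective[OF matrix_vector_mul_linear inj] by simp
  then obtain w where "\<theta> = A *v w" by (metis surjD)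
  then show ?thesis using orth[of w] by simp
qed

theorem theorem2p2:
  fixes A :: "real^'d^'d" and p :: "real^'d"
    and \<Lambda> :: "nat \<Rightarrow> real"
    and \<alpha>01 \<alpha>10 :: real and r :: nat
    and M :: "(real^'d) \<times> bool \<Rightarrow> 'w measure"
    and X :: "real \<Rightarrow> 'w \<Rightarrow> real^'d" and I :: "real \<Rightarrow> 'w \<Rightarrow> bool"
    and \<mu> :: "((real^'d) \<times> bool) measure"
  assumes "CARD('d) \<ge> 2"
    and "image_mset \<Lambda> (mset_set {1..CARD('d)}) = image_mset Re (proots (charpoly A))"
    and "mono_on {1..CARD('d)} \<Lambda>"
    and "\<Lambda> CARD('d) < 0"
    and "p \<noteq> 0"
    and "inj_on (\<lambda>k. (((*v) A) ^^ k) p) {..<CARD('d)}"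
    and "independent ((\<lambda>k. (((*v) A) ^^ k) p) ` {..<CARD('d)})"
    and "\<alpha>01 > 0" and "\<alpha>10 > 0"
    and "switching_process A p \<alpha>01 \<alpha>10 M X I"
    and "invariant_prob M X I \<mu>"
    and "min \<alpha>01 \<alpha>10 > - ((\<Sum>i=1..CARD('d). \<Lambda> i) + real r * \<Lambda> 1)"
  shows "\<exists>\<rho> :: bool \<Rightarrow> real^'d \<Rightarrow> real.
           (\<forall>i x. \<rho> i x \<ge> 0) \<and>
           \<mu> = density ref_measure (\<lambda>(x, i). ennreal (\<rho> i x)) \<and>
           (\<forall>i. C_k r (\<rho> i)) \<and>
           (\<forall>i. {x. \<rho> i x > 0} = interior (accessible_set A p))"
proof -
  define al where "al = leave_rate \<alpha>01 \<alpha>10"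
  interpret spectrum A \<Lambda> by standard (rule assms(2))
  interpret switching al A p by standard (simp add: al_def leave_rate_def assms(8,9))
  have stat: "stationary al A p \<mu>"
  proof (intro stationary.intro stationary_axioms.intro switching_axioms)
    show "prob_space \<mu>" "sets \<mu> = sets (borel \<Otimes>\<^sub>M count_space UNIV)"
      using assms(11) by (simp_all add: invariant_prob_def)
    fix t :: real and f :: "(real^'d) \<times> bool \<Rightarrow> real"
    assume t: "t \<ge> 0" and f: "f \<in> borel_measurable (borel \<Otimes>\<^sub>M count_space UNIV)" "bounded (range f)"
    have eq: "semigroup_op M X I t f z = (\<integral>e. f (flow A t (fst z) + noise (snd z) t e, state (snd z) t e) \<partial>expos)" for z
      using semigroup_op_canonical[OF assms(10,8,9) t f(1), of "fst z" "snd z"] by (simp add: al_def)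
    have "(\<integral>z. semigroup_op M X I t f z \<partial>\<mu>) = (\<integral>z. f z \<partial>\<mu>)"
      using assms(11) t f unfolding invariant_prob_def by blast
    then show "(\<integral>z. (\<integral>e. f (flow A t (fst z) + noise (snd z) t e, state (snd z) t e) \<partial>expos) \<partial>\<mu>) = (\<integral>z. f z \<partial>\<mu>)"
      by (simp only: eq)
  qed
  interpret stationary al A p \<mu> by (rule stat)
  have d1: "1 \<le> CARD('d)" by (simp add: Suc_leI)
  \<comment> \<open>Strictly between the top real part and 0, as \<open>flow_growth\<close> asks for
    a strict bound.\<close>
  define c where "c = \<Lambda> CARD('d) / 2"
  have c: "c < 0" "\<Lambda> CARD('d) < c" using assms(4) by (simp_all add: c_def)
  have "Re m < c" if "det (mat m - cmat A) = 0" for m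
  proof -
    obtain k where k: "k \<in> {1..CARD('d)}" "Re m = \<Lambda> k" using eigenvalue_Re[OF \<open>det (mat m - cmat A) = 0\<close>] by blast
    then have "\<Lambda> k \<le> \<Lambda> CARD('d)" using d1 by (intro mono_onD[OF assms(3)]) auto
    then show ?thesis using k c by simp
  qed
  then obtain C where C: "C > 0" "\<And>t x. t \<ge> 0 \<Longrightarrow> norm (flow A t x) \<le> C * exp (c * t) * norm x"
    using flow_growth[of A c] by blast
  have inj: "inj ((*v) A)" by (rule decay_imp_inj[OF c(1) C(2)])
  have zeros: "countable {s. \<theta> \<bullet> flow A s b = 0}" if "\<theta> \<noteq> 0" for \<theta>
    by (rule countable_zeros_flow[OF _ that, where n = "CARD('d)"])
       (rule krylov_observable[OF inj assms(6,7)], simp add: b_def)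
  have min: "min \<alpha>01 \<alpha>10 \<le> al i" for i by (simp add: al_def leave_rate_def)
  have wint: "integrable lborel (\<lambda>\<xi>. (1 + norm \<xi>) ^ r * norm (cfun (marg k) \<xi>))" for k
    by (rule integrable_cfun_weighted[OF spectrum_axioms assms(3,4) zeros min assms(12)])
  \<comment> \<open>The weight is at least 1, so plain integrability, which Fourier inversion asks
    for, is included.\<close>
  have int: "integrable lborel (cfun (marg k))" for k
  proof (rule Bochner_Integration.integrable_bound[OF wint])
    show "cfun (marg k) \<in> borel_measurable lborel" using marg.cfun_measurable by simp
    show "AE \<xi> in lborel. norm (cfun (marg k) \<xi>) \<le> norm ((1 + norm \<xi>) ^ r * norm (cfun (marg k) \<xi>))"
    proof (rule AE_I2)
      fix \<xi> :: "real^'d"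
      have "1 * norm (cfun (marg k) \<xi>) \<le> (1 + norm \<xi>) ^ r * norm (cfun (marg k) \<xi>)"
        by (intro mult_right_mono one_le_power) auto
      then show "norm (cfun (marg k) \<xi>) \<le> norm ((1 + norm \<xi>) ^ r * norm (cfun (marg k) \<xi>))" by simp
    qed
  qed
  define \<rho> where "\<rho> i = inv_fourier (cfun (marg i))" for i
  interpret stationary_density al A p \<mu> \<rho>
  proof
    fix i x
    show "\<rho> i x \<ge> 0" unfolding \<rho>_def by (rule marg.inv_fourier_nonneg[OF int])
    show "continuous_on UNIV (\<rho> i)" unfolding \<rho>_def by (rule continuous_on_inv_fourier[OF int])
    show "marg i = density lborel (\<lambda>x. ennreal (\<rho> i x))"
      unfolding \<rho>_def by (rule marg.measure_eq_density_inv_fourier[OF int])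
  qed
  show ?thesis
  proof (intro exI[of _ \<rho>] conjI allI)
    show "\<mu> = density ref_measure (\<lambda>(x, i). ennreal (\<rho> i x))" by (rule \<mu>_eq_density[OF marg_eq \<rho>_measurable])
    fix i x
    show "\<rho> i x \<ge> 0" by (rule \<rho>_nonneg)
    show "C_k r (\<rho> i)" unfolding \<rho>_def by (rule C_k_inv_fourier[OF marg.cfun_measurable wint])
    show "{x. \<rho> i x > 0} = interior (accessible_set A p)" by (rule \<rho>_pos_eq_interior[OF zeros C(1) c(1) C(2)])
  qed
qed

end
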